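(* Let $\alpha=10^{-4}$ and, for each $n\in\mathbb{N}$, let $T=\lfloor (1-n^{-\alpha})n\rfloor$. Let $Q(T)$ be the outcome of the toroidal random greedy algorithm run on the $n\times n$ board for $T$ steps. Then with high probability (i.e. with probability tending to $1$ as $n\to\infty$) the absorption algorithm applied to $Q(T)$ does not abort and constructs an $n$-queens configuration.
   Context: Write $[n]=\{1,\dots,n\}$ and identify the $n\times n$ chessboard with $[n]^2$; row $r$ is $\{r\}\times[n]$ and column $c$ is $[n]\times\{c\}$. The (non-toroidal) diagonals containing $(x,y)\in[n]^2$ are $\{(x',y')\in[n]^2: x'+y'=x+y\}$ and $\{(x',y')\in[n]^2: x'-y'=x-y\}$. The toroidal diagonals containing $(x,y)$ are defined by the same equations taken modulo $n$. A partial $n$-queens configuration is a set $Q\subset[n]^2$ such that every row, column and (non-toroidal) diagonal contains at most one element of $Q$; an $n$-queens configuration is one of size $n$. The toroidal random greedy algorithm: set $Q(0)=\emptyset$. For each $0\le t<T$ let $\mathcal{A}(t)\subseteq[n]^2$ be the set of positions whose row, column and both toroidal diagonals contain no element of $Q(t)$. If $\mathcal{A}(t)=\emptyset$, abort. Otherwise choose $(x_t,y_t)\in\mathcal{A}(t)$ uniformly at random, independently of previous choices, and set $Q(t+1)=Q(t)\cup\{(x_t,y_t)\}$. If the algorithm aborts at time $t$, set $Q(s)=Q(t)$ for all $t<s\le T$. Absorbers: for a partial $n$-queens configuration $Q$ and $(r,c)\in[n]^2$, an absorber for $(r,c)$ in $Q$ is a queen $(x,y)\in Q$ such that (i) $(r,y)$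 and $(x,c)$ do not share a (non-toroidal) diagonal (equivalently, $(r,c)$ and $(x,y)$ do not share a diagonal), and (ii) none of the (non-toroidal) diagonals containing $(r,y)$ or $(x,c)$ contains an element of $Q$. The set of absorbers for $(r,c)$ in $Q$ is denoted $\mathcal{B}_Q(r,c)$. The absorption algorithm applied to $Q(T)$: let $L_R$ and $L_C$ be the sets of rows and columns, respectively, containing no element of $Q(T)$; then $|L_R|=|L_C|=:k$. Let $(r_1,c_1),\dots,(r_k,c_k)$ be an arbitrary perfect matching of $L_R$ and $L_C$. Set $R(0)=Q(T)$. For $i=1,\dots,k$: if $\mathcal{B}_{R(i-1)}(r_i,c_i)=\emptyset$, abort; otherwise choose some (arbitrary) $(x_i,y_i)\in\mathcal{B}_{R(i-1)}(r_i,c_i)$ and set $R(i)=\left(R(i-1)\setminus\{(x_i,y_i)\}\right)\cup\{(x_i,c_i),(r_i,y_i)\}$. The output, if the algorithm does not abort, is $R(k)$. *)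

theory Defs
  imports "HOL-Probability.Probability"
begin

type_synonym pos = "int \<times> int"

definition board :: "nat \<Rightarrow> pos set" where
  "board n = {1..int n} \<times> {1..int n}"

definition board_row :: "nat \<Rightarrow> int \<Rightarrow> pos set" where
  "board_row n r = {r} \<times> {1..int n}"

definition board_column :: "nat \<Rightarrow> int \<Rightarrow> pos set" where
  "board_column n c = {1..int n} \<times> {c}"

fun diagonals :: "nat \<Rightarrow> pos \<Rightarrow> pos set set" where
  "diagonals n (x, y) =
     {{(x', y') \<in> board n. x' + y' = x + y},
      {(x', y') \<in> board n. x' - y' = x - y}}"

fun toroidal_diagonals :: "nat \<Rightarrow> pos \<Rightarrow> pos set set" where
  "toroidal_diagonals n (x, y) =
     {{(x', y') \<in> board n. (x' + y') mod int n = (x + y) mod int n},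
      {(x', y') \<in> board n. (x' - y') mod int n = (x - y) mod int n}}"

definition partial_queens :: "nat \<Rightarrow> pos set \<Rightarrow> bool" where
  "partial_queens n Q \<longleftrightarrow> Q \<subseteq> board n
     \<and> (\<forall>r\<in>{1..int n}. card (Q \<inter> board_row n r) \<le> 1)
     \<and> (\<forall>c\<in>{1..int n}. card (Q \<inter> board_column n c) \<le> 1)
     \<and> (\<forall>p\<in>board n. \<forall>D\<in>diagonals n p. card (Q \<inter> D) \<le> 1)"

definition queens :: "nat \<Rightarrow> pos set \<Rightarrow> bool" where
  "queens n Q \<longleftrightarrow> partial_queens n Q \<and> card Q = n"


definition available :: "nat \<Rightarrow> pos set \<Rightarrow> pos set" where
  "available n Q = {(x, y) \<in> board n. Q \<inter> board_row n x = {} \<and> Q \<inter> board_column n y = {}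
     \<and> (\<forall>D\<in>toroidal_diagonals n (x, y). Q \<inter> D = {})}"

text \<open>The law of the set of queens after \<open>t\<close> steps. Aborting is rendered by keeping the
  current set: a set without available positions is never changed again.\<close>

fun greedy :: "nat \<Rightarrow> nat \<Rightarrow> pos set pmf" where
  "greedy n 0 = return_pmf {}"
| "greedy n (Suc t) = bind_pmf (greedy n t)
     (\<lambda>Q. if available n Q = {} then return_pmf Q
          else map_pmf (\<lambda>p. Q \<union> {p}) (pmf_of_set (available n Q)))"


definition absorbers :: "nat \<Rightarrow> pos set \<Rightarrow> int \<Rightarrow> int \<Rightarrow> pos set" where
  "absorbers n Q r c = {(x, y) \<in> Q. diagonals n (r, y) \<inter> diagonals n (x, c) = {}
     \<and> (\<forall>D \<in> diagonals n (r, y) \<union> diagonals n (x, c). Q \<inter> D = {})}"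

definition empty_rows :: "nat \<Rightarrow> pos set \<Rightarrow> int set" where
  "empty_rows n Q = {r \<in> {1..int n}. Q \<inter> board_row n r = {}}"

definition empty_columns :: "nat \<Rightarrow> pos set \<Rightarrow> int set" where
  "empty_columns n Q = {c \<in> {1..int n}. Q \<inter> board_column n c = {}}"

text \<open>An enumerated perfect matching \<open>[(r\<^sub>1, c\<^sub>1), \<dots>, (r\<^sub>k, c\<^sub>k)]\<close> of \<open>L\<close> and \<open>M\<close>.\<close>

definition perfect_matching :: "int set \<Rightarrow> int set \<Rightarrow> pos list \<Rightarrow> bool" where
  "perfect_matching L M ms \<longleftrightarrow>
     distinct (map fst ms) \<and> set (map fst ms) = L \<and>
     distinct (map snd ms) \<and> set (map snd ms) = M"

text \<open>\<open>absorption_run n R ms res\<close>: some sequence of choices of absorbers, starting from \<open>R\<close>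
  with the pairs \<open>ms\<close> still to be processed, leads to the result \<open>res\<close>, where \<open>None\<close> stands
  for abortion.\<close>

inductive absorption_run :: "nat \<Rightarrow> pos set \<Rightarrow> pos list \<Rightarrow> pos set option \<Rightarrow> bool" for n where
  finish: "absorption_run n R [] (Some R)"
| abort: "absorbers n R r c = {} \<Longrightarrow> absorption_run n R ((r, c) # ms) None"
| absorb: "(x, y) \<in> absorbers n R r c \<Longrightarrow>
     absorption_run n ((R - {(x, y)}) \<union> {(x, c), (r, y)}) ms res \<Longrightarrow>
     absorption_run n R ((r, c) # ms) res"

text \<open>The matching and the absorbers are arbitrary, so every possible run has to succeed.\<close>

definition absorption_succeeds :: "nat \<Rightarrow> pos set \<Rightarrow> bool" where
  "absorption_succeeds n Q \<longleftrightarrow>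
     (\<forall>ms res. perfect_matching (empty_rows n Q) (empty_columns n Q) ms \<longrightarrow>
        absorption_run n Q ms res \<longrightarrow> (\<exists>R. res = Some R \<and> queens n R))"


text \<open>The quantification over runs is not vacuous on outcomes of the greedy algorithm.\<close>

lemma absorption_run_exists: "\<exists>res. absorption_run n R ms res"
proof (induction ms arbitrary: R)
  case Nil
  then show ?case by (blast intro: finish)
next
  case (Cons m ms)
  obtain r c where m: "m = (r, c)" by fastforce
  show ?case
  proof (cases "absorbers n R r c = {}")
    case True
    then show ?thesis unfolding m by (blast intro: abort)
  next
    case False
    then obtain x y where "(x, y) \<in> absorbers n R r c" by fastforce
    then show ?thesis unfolding m using Cons.IH absorb by blast
  qed
qed

lemma finite_board [simp]: "finite (board n)"
  by (simp add: board_def)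

lemma finite_available [simp]: "finite (available n Q)"
  by (rule finite_subset[of _ "board n"]) (auto simp: available_def)

lemma card_insert_Int_le_1:
  assumes "card (Q \<inter> D) \<le> 1" "p \<in> D \<Longrightarrow> Q \<inter> D = {}"
  shows "card ((Q \<union> {p}) \<inter> D) \<le> 1"
  using assms by (cases "p \<in> D") auto

lemma partial_queens_greedy:
  "Q \<in> set_pmf (greedy n t) \<Longrightarrow> partial_queens n Q"
proof (induction t arbitrary: Q)
  case 0
  then show ?case by (simp add: partial_queens_def)
next
  case (Suc t)
  then obtain Q' where Q': "Q' \<in> set_pmf (greedy n t)"
    and step: "Q \<in> set_pmf (if available n Q' = {} then return_pmf Q'
      else map_pmf (\<lambda>p. Q' \<union> {p}) (pmf_of_set (available n Q')))"
    by (auto simp del: Un_insert_right)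
  have Q: "Q = Q' \<or> (\<exists>p\<in>available n Q'. Q = Q' \<union> {p})"
  proof (cases "available n Q' = {}")
    case False
    then have "set_pmf (pmf_of_set (available n Q')) = available n Q'" by simp
    with False step show ?thesis by auto
  qed (use step in simp)
  have IH: "partial_queens n Q'" using Suc.IH Q' by blast
  show ?case
  proof (cases "Q = Q'")
    case False
    then obtain p where p: "p \<in> available n Q'" "Q = Q' \<union> {p}" using Q by blast
    obtain x y where xy: "p = (x, y)" by fastforce
    have av: "Q' \<inter> board_row n x = {}" "Q' \<inter> board_column n y = {}" "(x, y) \<in> board n"
      "Q' \<inter> {(x', y') \<in> board n. (x' + y') mod int n = (x + y) mod int n} = {}"
      "Q' \<inter> {(x', y') \<in> board n. (x' - y') mod int n = (x - y) mod int n} = {}"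
      using p(1) unfolding xy available_def by auto
    have "Q' \<inter> D = {}" if "p \<in> D" "q \<in> board n" "D \<in> diagonals n q" for q D
    proof -
      obtain a b where ab: "q = (a, b)" by fastforce
      from that have "D = {(x', y') \<in> board n. x' + y' = x + y}
                    \<or> D = {(x', y') \<in> board n. x' - y' = x - y}"
        unfolding ab xy by auto
      then have "D \<subseteq> {(x', y') \<in> board n. (x' + y') mod int n = (x + y) mod int n}
               \<or> D \<subseteq> {(x', y') \<in> board n. (x' - y') mod int n = (x - y) mod int n}"
        by auto
      then show ?thesis using av(4,5) by blast
    qed
    moreover have "Q' \<inter> board_row n r = {}" if "p \<in> board_row n r" for r
      using that av(1) by (auto simp: xy board_row_def)
    moreover have "Q' \<inter> board_column n c = {}" if "p \<in> board_column n c" for c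
      using that av(2) by (auto simp: xy board_column_def)
    moreover have "p \<in> board n" using av(3) by (simp add: xy)
    ultimately show ?thesis
      using IH unfolding p(2) partial_queens_def
      by (intro conjI ballI card_insert_Int_le_1) blast+
  qed (use IH in simp)
qed

lemma perfect_matching_exists:
  assumes "partial_queens n Q"
  shows "\<exists>ms. perfect_matching (empty_rows n Q) (empty_columns n Q) ms"
proof -
  have sub: "Q \<subseteq> board n" and fin: "finite Q"
    using assms finite_subset[OF _ finite_board] by (auto simp: partial_queens_def)
  have one: "p = q" if "card (Q \<inter> D) \<le> 1" "p \<in> Q \<inter> D" "q \<in> Q \<inter> D" for p q D
    using that fin by (metis One_nat_def card_le_Suc0_iff_eq finite_Int)
  have "inj_on fst Q"
  proof (rule inj_onI)
    fix p q assume pq: "p \<in> Q" "q \<in> Q" "fst p = fst q"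
    then have "fst p \<in> {1..int n}" "p \<in> board_row n (fst p)" "q \<in> board_row n (fst p)"
      using sub by (auto simp: board_def board_row_def)
    then show "p = q" using pq one[of "board_row n (fst p)" p q] assms
      by (auto simp: partial_queens_def)
  qed
  moreover have "inj_on snd Q"
  proof (rule inj_onI)
    fix p q assume pq: "p \<in> Q" "q \<in> Q" "snd p = snd q"
    then have "snd p \<in> {1..int n}" "p \<in> board_column n (snd p)" "q \<in> board_column n (snd p)"
      using sub by (auto simp: board_def board_column_def)
    then show "p = q" using pq one[of "board_column n (snd p)" p q] assms
      by (auto simp: partial_queens_def)
  qed
  moreover have "empty_rows n Q = {1..int n} - fst ` Q"
    using sub by (force simp: empty_rows_def board_row_def board_def)
  moreover have "empty_columns n Q = {1..int n} - snd ` Q"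
    using sub by (force simp: empty_columns_def board_column_def board_def)
  moreover have "fst ` Q \<subseteq> {1..int n}" "snd ` Q \<subseteq> {1..int n}"
    using sub by (auto simp: board_def)
  ultimately have card: "card (empty_rows n Q) = card (empty_columns n Q)"
    using fin by (simp add: card_Diff_subset card_image)
  have fin_rows: "finite (empty_rows n Q)" and fin_columns: "finite (empty_columns n Q)"
    unfolding empty_rows_def empty_columns_def by (auto intro: finite_subset[of _ "{1..int n}"])
  obtain rs cs where "set rs = empty_rows n Q" "distinct rs"
    "set cs = empty_columns n Q" "distinct cs"
    using finite_distinct_list[OF fin_rows] finite_distinct_list[OF fin_columns] by blast
  moreover from this have "length rs = length cs"
    using card by (metis distinct_card)
  ultimately have "perfect_matching (empty_rows n Q) (empty_columns n Q) (zip rs cs)"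
    by (simp add: perfect_matching_def del: set_map)
  then show ?thesis by blast
qed

end

theory Submission
  imports Defs "HOL-Real_Asymp.Real_Asymp"
begin

text \<open>An absorption step destroys at most nine absorbers of any other pair \<open>(r, c)\<close>. So all runs of the
  absorption algorithm succeed if, for some constant \<open>\<delta>\<close>, every \<open>(r, c)\<close> has at least \<open>\<delta> n\<close>
  absorbers and fewer than \<open>\<delta> n / 9\<close> rows are empty (lemma \<open>absorption_succeedsI\<close>). Both
  conditions follow from properties of the greedy process at times of the form \<open>const * n\<close>.

  \<^emph>\<open>Few empty rows.\<close> The toroidal board is a 4-uniform, \<open>n\<close>-regular hypergraph on \<open>4 n\<close> lines in
  which two lines share at most two cells. Were everything perfectly regular, then each free line
  would contain \<open>N\<^sup>3 / n\<^sup>2\<close> available cells at the time when \<open>N\<close> rows are free. Let \<open>W\<close> be the sum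
  of the squared deviations from this value over all free lines. While there are \<open>const * n\<^sup>2\<close>
  available cells, one step changes \<open>W\<close> in expectation to at most \<open>(1 + C / n) W + C' n\<close>
  (lemma \<open>irregularity_step\<close>), because the potentially large terms cancel by the Cauchy-Schwarz
  inequality. So \<open>W\<close> is typically of order \<open>n\<^sup>2\<close>. On the other hand the number of available cells
  is close to \<open>N\<^sup>4 / n\<^sup>2\<close> as long as \<open>W\<close> is small compared to \<open>n\<^sup>3\<close> (lemma \<open>many_available\<close>).
  Hence for every fixed \<open>\<epsilon>\<close> the process reaches \<open>(1 - \<epsilon>) n\<close> queens except with probability
  \<open>O(1/n)\<close> (lemma \<open>greedy_almost_complete\<close>).

  \<^emph>\<open>Many absorbers.\<close> A queen \<open>(x, y)\<close> in general position with respect to \<open>(r, c)\<close> is called safe if each of the four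
  diagonals through \<open>(r, y)\<close> and \<open>(x, c)\<close> is empty while the toroidal diagonal that contains it is
  occupied. Such a queen is an absorber, and it remains one during the whole greedy process, which
  puts at most one queen on a toroidal diagonal. It is therefore enough to produce
  \<open>\<delta> n\<close> safe queens in the first \<open>n / 400\<close> steps, where trivial counting shows that most of the
  board is available. Give a queen the weight \<open>0\<close> if one of its four diagonals is occupied, and the
  weight \<open>\<beta> ^ k\<close> otherwise, where \<open>k\<close> of its toroidal diagonals are still free and \<open>\<beta>\<close> is small and
  decreases linearly to \<open>0\<close>. The sum of the weights has bounded increments and a drift of order
  \<open>\<beta>\<^sup>4\<close> contributed by new queens (lemma \<open>potential_drift\<close>), so it is of order \<open>n\<close> except with an
  exponentially small probability (lemma \<open>potential_concentration\<close>). At the end of this phase it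
  counts the safe queens. The exponential bound permits a union over all \<open>(r, c)\<close>.\<close>

section \<open>Random greedy matchings in regular hypergraphs\<close>

text \<open>The cells of the toroidal board are the edges of a hypergraph whose vertices are the
  rows, columns and toroidal diagonals; a set of queens that do not attack each other on the torus
  is a matching. Only the following regularity of this hypergraph matters for the analysis of the
  greedy process.\<close>

locale quad_hypergraph =
  fixes E :: "'e set" and V :: "'v set" and inc :: "'e \<Rightarrow> 'v set" and n :: nat
  assumes finite_E: "finite E" and finite_V: "finite V" and n_pos: "n > 0"
    and inc_subset: "e \<in> E \<Longrightarrow> inc e \<subseteq> V"
    and card_inc: "e \<in> E \<Longrightarrow> card (inc e) = 4"
    and card_V: "card V = 4 * n"
    and degree: "v \<in> V \<Longrightarrow> card {e \<in> E. v \<in> inc e} = n"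
    and codegree: "u \<in> V \<Longrightarrow> v \<in> V \<Longrightarrow> u \<noteq> v \<Longrightarrow> card {e \<in> E. u \<in> inc e \<and> v \<in> inc e} \<le> 2"
begin

definition matching :: "'e set \<Rightarrow> bool" where
  "matching Q \<longleftrightarrow> Q \<subseteq> E \<and> (\<forall>p\<in>Q. \<forall>q\<in>Q. p \<noteq> q \<longrightarrow> inc p \<inter> inc q = {})"

definition free :: "'e set \<Rightarrow> 'v set" where
  "free Q = V - \<Union>(inc ` Q)"

definition avail :: "'e set \<Rightarrow> 'e set" where
  "avail Q = {e \<in> E. inc e \<subseteq> free Q}"

definition deg :: "'e set \<Rightarrow> 'v \<Rightarrow> nat" where
  "deg Q v = card {e \<in> avail Q. v \<in> inc e}"

text \<open>The number of available edges at a free vertex that one expects when \<open>N\<close> of the \<open>n\<close> vertices of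
  each kind are free: each of the other three vertices of an edge should be free with probability
  about \<open>N / n\<close>.\<close>

definition target :: "nat \<Rightarrow> real" where
  "target N = real N ^ 3 / real n ^ 2"

definition irregularity :: "'e set \<Rightarrow> real" where
  "irregularity Q = (\<Sum>v\<in>free Q. (real (deg Q v) - target (n - card Q))\<^sup>2)"

lemma finite_inc: "e \<in> E \<Longrightarrow> finite (inc e)"
  using inc_subset finite_V finite_subset by blast

lemma finite_free [simp]: "finite (free Q)"
  using finite_V by (simp add: free_def)

lemma finite_avail [simp]: "finite (avail Q)"
  using finite_E by (simp add: avail_def)

lemma avail_subset: "avail Q \<subseteq> E" by (auto simp: avail_def)

lemma inc_ne: "e \<in> E \<Longrightarrow> inc e \<noteq> {}"
  using card_inc by fastforce

lemma avail_disjoint: "e \<in> avail Q \<Longrightarrow> q \<in> Q \<Longrightarrow> inc e \<inter> inc q = {}"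
  by (auto simp: avail_def free_def)

lemma avail_notin: "e \<in> avail Q \<Longrightarrow> e \<notin> Q"
  using avail_disjoint[of e Q e] inc_ne avail_subset by auto

lemma card_free:
  assumes "matching Q"
  shows "card (free Q) = 4 * (n - card Q)" and "card Q \<le> n"
proof -
  have Q: "Q \<subseteq> E" "finite Q" using assms finite_subset[OF _ finite_E] by (auto simp: matching_def)
  have "card (\<Union>(inc ` Q)) = (\<Sum>q\<in>Q. card (inc q))"
    using Q assms finite_inc by (intro card_UN_disjoint) (auto simp: matching_def)
  also have "\<dots> = (\<Sum>q\<in>Q. 4)" using Q card_inc by (intro sum.cong) auto
  finally have c: "card (\<Union>(inc ` Q)) = 4 * card Q" by simp
  have sub: "\<Union>(inc ` Q) \<subseteq> V" using Q inc_subset by blast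
  have "card (\<Union>(inc ` Q)) \<le> card V" using card_mono[OF finite_V sub] .
  then show "card Q \<le> n" using c card_V by simp
  show "card (free Q) = 4 * (n - card Q)"
    unfolding free_def using sub c card_V finite_V
    by (subst card_Diff_subset) (auto intro: finite_subset)
qed

lemma free_insert: "free (insert e Q) = free Q - inc e"
  by (auto simp: free_def)

lemma avail_insert: "avail (insert e Q) = {a \<in> avail Q. inc a \<inter> inc e = {}}"
  by (auto simp: avail_def free_insert)

lemma matching_insert:
  assumes "matching Q" "e \<in> avail Q"
  shows "matching (insert e Q)"
  unfolding matching_def
proof (intro conjI ballI impI)
  show "insert e Q \<subseteq> E" using assms avail_subset by (auto simp: matching_def)
next
  fix p q assume "p \<in> insert e Q" "q \<in> insert e Q" "p \<noteq> q"
  then show "inc p \<inter> inc q = {}"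
    using avail_disjoint[OF assms(2)] assms(1) unfolding matching_def by (metis Int_commute insert_iff)
qed

lemma deg_le: 
  assumes "v \<in> free Q"
  shows "deg Q v \<le> n"
proof -
  have "deg Q v \<le> card {e \<in> E. v \<in> inc e}"
    unfolding deg_def using finite_E by (intro card_mono) (auto simp: avail_def)
  then show ?thesis using degree assms by (auto simp: free_def)
qed

text \<open>Double counting of the incidences between available edges and free vertices.\<close>

lemma sum_avail_inc:
  fixes h :: "'v \<Rightarrow> real"
  shows "(\<Sum>e\<in>avail Q. \<Sum>v\<in>inc e. h v) = (\<Sum>v\<in>free Q. real (deg Q v) * h v)"
proof -
  have "(\<Sum>e\<in>avail Q. \<Sum>v\<in>inc e. h v) = (\<Sum>e\<in>avail Q. \<Sum>v | v \<in> free Q \<and> v \<in> inc e. h v)"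
    by (intro sum.cong refl) (auto simp: avail_def)
  also have "\<dots> = (\<Sum>v\<in>free Q. \<Sum>e | e \<in> avail Q \<and> v \<in> inc e. h v)"
    by (rule sum.swap_restrict) auto
  also have "\<dots> = (\<Sum>v\<in>free Q. real (deg Q v) * h v)"
    by (simp add: deg_def)
  finally show ?thesis .
qed

lemma sum_deg: "(\<Sum>v\<in>free Q. real (deg Q v)) = 4 * real (card (avail Q))"
proof -
  have "(\<Sum>v\<in>free Q. real (deg Q v)) = (\<Sum>e\<in>avail Q. \<Sum>v\<in>inc e. 1)"
    using sum_avail_inc[of "\<lambda>_. 1" Q] by simp
  also have "\<dots> = (\<Sum>e\<in>avail Q. 4)"
    using card_inc avail_subset by (intro sum.cong) auto
  finally show ?thesis by simp
qed

definition conflicts :: "'e set \<Rightarrow> 'v \<Rightarrow> 'e \<Rightarrow> nat" where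
  "conflicts Q v e = card {a \<in> avail Q. v \<in> inc a \<and> inc a \<inter> inc e \<noteq> {}}"

lemma deg_insert:
  "real (deg (insert e Q) v) = real (deg Q v) - real (conflicts Q v e)"
proof -
  have "{a \<in> avail Q. v \<in> inc a} =
    {a \<in> avail (insert e Q). v \<in> inc a} \<union> {a \<in> avail Q. v \<in> inc a \<and> inc a \<inter> inc e \<noteq> {}}"
    by (auto simp: avail_insert)
  moreover have "{a \<in> avail (insert e Q). v \<in> inc a} \<inter> {a \<in> avail Q. v \<in> inc a \<and> inc a \<inter> inc e \<noteq> {}} = {}"
    by (auto simp: avail_insert)
  ultimately have "deg Q v = deg (insert e Q) v + conflicts Q v e"
    unfolding deg_def conflicts_def by (simp add: card_Un_disjoint)
  then show ?thesis by simp
qed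

lemma card_meeting_line_le:
  assumes "e \<in> E" "v \<in> V" "v \<notin> inc e"
  shows "card {a \<in> E. v \<in> inc a \<and> inc a \<inter> inc e \<noteq> {}} \<le> 8"
proof -
  have "{a \<in> E. v \<in> inc a \<and> inc a \<inter> inc e \<noteq> {}} = (\<Union>u\<in>inc e. {a \<in> E. u \<in> inc a \<and> v \<in> inc a})"
    by auto
  also have "card \<dots> \<le> (\<Sum>u\<in>inc e. card {a \<in> E. u \<in> inc a \<and> v \<in> inc a})"
    using finite_inc[OF assms(1)] by (rule card_UN_le)
  also have "\<dots> \<le> (\<Sum>u\<in>inc e. 2)"
    using assms inc_subset[OF assms(1)] by (intro sum_mono codegree) auto
  finally show ?thesis using card_inc[OF assms(1)] by simp
qed

lemma conflicts_le:
  assumes "e \<in> E" "v \<in> V" "v \<notin> inc e"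
  shows "conflicts Q v e \<le> 8"
proof -
  have "conflicts Q v e \<le> card {a \<in> E. v \<in> inc a \<and> inc a \<inter> inc e \<noteq> {}}"
    unfolding conflicts_def using finite_E by (intro card_mono) (auto simp: avail_def)
  then show ?thesis using card_meeting_line_le[OF assms] by simp
qed

text \<open>There are at most \<open>16\<close> ordered pairs of vertices in \<open>e\<close>, and each is contained in at most two
  edges.\<close>

lemma card_double_meeting:
  assumes "e \<in> E"
  shows "card {a \<in> E. \<exists>u\<in>inc e. \<exists>w\<in>inc e. u \<noteq> w \<and> u \<in> inc a \<and> w \<in> inc a} \<le> 32"
proof -
  have fin: "finite (inc e)" using finite_inc[OF assms] .
  have "{a \<in> E. \<exists>u\<in>inc e. \<exists>w\<in>inc e. u \<noteq> w \<and> u \<in> inc a \<and> w \<in> inc a} =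
    (\<Union>(u, w)\<in>{(u, w) \<in> inc e \<times> inc e. u \<noteq> w}. {a \<in> E. u \<in> inc a \<and> w \<in> inc a})"
    by auto
  also have "card \<dots> \<le> (\<Sum>(u, w)\<in>{(u, w) \<in> inc e \<times> inc e. u \<noteq> w}. card {a \<in> E. u \<in> inc a \<and> w \<in> inc a})"
    using fin by (intro order.trans[OF card_UN_le]) (auto simp: case_prod_unfold
       intro: finite_subset[of _ "inc e \<times> inc e"])
  also have "\<dots> \<le> (\<Sum>(u, w)\<in>{(u, w) \<in> inc e \<times> inc e. u \<noteq> w}. 2)"
    using inc_subset[OF assms] by (intro sum_mono) (auto intro!: codegree)
  also have "\<dots> = 2 * card {(u, w) \<in> inc e \<times> inc e. u \<noteq> w}" by (simp add: case_prod_unfold)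
  also have "\<dots> \<le> 2 * card (inc e \<times> inc e)" using fin by (intro mult_le_mono card_mono) auto
  finally show ?thesis using card_inc[OF assms] by (simp add: card_cartesian_product)
qed

text \<open>Counting the edges that meet \<open>a\<close> through the vertices of \<open>a\<close> is wrong only for edges that
  share two vertices with \<open>a\<close>. There are at most \<open>32\<close> of those, each counted at most four times.\<close>

lemma conflict_count:
  assumes "v \<in> inc a" "a \<in> avail Q"
  defines "X \<equiv> {e \<in> avail Q. v \<notin> inc e \<and> inc a \<inter> inc e \<noteq> {}}"
  shows "real (card X) \<le> (\<Sum>u\<in>inc a - {v}. real (deg Q u))"
    and "(\<Sum>u\<in>inc a - {v}. real (deg Q u)) \<le> real (card X) + 128"
proof -
  have aE: "a \<in> E" using assms(2) avail_subset by auto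
  have fin: "finite (inc a)" using finite_inc[OF aE] .
  let ?Y = "{e \<in> E. \<exists>u\<in>inc a. \<exists>w\<in>inc a. u \<noteq> w \<and> u \<in> inc e \<and> w \<in> inc e}"
  have eq: "(\<Sum>u\<in>inc a - {v}. deg Q u) = (\<Sum>e\<in>avail Q. card {u \<in> inc a - {v}. u \<in> inc e})"
  proof -
    have "(\<Sum>u\<in>inc a - {v}. \<Sum>e | e \<in> avail Q \<and> u \<in> inc e. 1) =
        (\<Sum>e\<in>avail Q. \<Sum>u | u \<in> inc a - {v} \<and> u \<in> inc e. (1::nat))"
      by (rule sum.swap_restrict) (use fin in auto)
    then show ?thesis by (simp add: deg_def)
  qed
  have X: "card X = (\<Sum>e\<in>avail Q. of_bool (e \<in> X))"
    by (simp add: X_def Int_def)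
  have "card X \<le> (\<Sum>e\<in>avail Q. card {u \<in> inc a - {v}. u \<in> inc e})"
    unfolding X
  proof (rule sum_mono)
    fix e assume "e \<in> avail Q"
    show "of_bool (e \<in> X) \<le> card {u \<in> inc a - {v}. u \<in> inc e}"
    proof (cases "e \<in> X")
      case True
      then have "{u \<in> inc a - {v}. u \<in> inc e} \<noteq> {}" by (auto simp: X_def)
      then show ?thesis using fin True by (simp add: Suc_leI card_gt_0_iff)
    qed simp
  qed
  then have "card X \<le> (\<Sum>u\<in>inc a - {v}. deg Q u)" using eq by simp
  then have "real (card X) \<le> real (\<Sum>u\<in>inc a - {v}. deg Q u)" by (rule of_nat_mono)
  then show "real (card X) \<le> (\<Sum>u\<in>inc a - {v}. real (deg Q u))" by simp
  have "(\<Sum>e\<in>avail Q. card {u \<in> inc a - {v}. u \<in> inc e}) \<le>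
        (\<Sum>e\<in>avail Q. of_bool (e \<in> X) + 4 * of_bool (e \<in> ?Y))"
  proof (rule sum_mono)
    fix e assume e: "e \<in> avail Q"
    have le: "card {u \<in> inc a - {v}. u \<in> inc e} \<le> 4"
      using card_mono[of "inc a" "{u \<in> inc a - {v}. u \<in> inc e}"] fin card_inc[OF aE] by auto
    show "card {u \<in> inc a - {v}. u \<in> inc e} \<le> of_bool (e \<in> X) + 4 * of_bool (e \<in> ?Y)"
    proof (cases "e \<in> ?Y")
      case True
      then show ?thesis using le by simp
    next
      case False
      then have one: "u = w" if "u \<in> inc a" "w \<in> inc a" "u \<in> inc e" "w \<in> inc e" for u w
        using that e avail_subset by blast
      show ?thesis
      proof (cases "{u \<in> inc a - {v}. u \<in> inc e} = {}")
        case True then show ?thesis by (simp only: card.empty)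
      next
        case ne: False
        then obtain u where u: "u \<in> inc a" "u \<noteq> v" "u \<in> inc e" by auto
        then have "{u \<in> inc a - {v}. u \<in> inc e} = {u}" using one by auto
        moreover have "e \<in> X" using u one[of u v] assms(1) e unfolding X_def by auto
        ultimately show ?thesis by simp
      qed
    qed
  qed
  also have "\<dots> = card X + 4 * card (avail Q \<inter> ?Y)"
    by (simp add: sum.distrib X flip: sum_distrib_left) 
  also have "card (avail Q \<inter> ?Y) \<le> card ?Y" using finite_E by (intro card_mono) auto
  finally have "(\<Sum>u\<in>inc a - {v}. deg Q u) \<le> card X + 128"
    using card_double_meeting[OF aE] eq by linarith
  then have "real (\<Sum>u\<in>inc a - {v}. deg Q u) \<le> real (card X + 128)" by (rule of_nat_mono)
  then show "(\<Sum>u\<in>inc a - {v}. real (deg Q u)) \<le> real (card X) + 128" by simp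
qed

lemma sum_conflicts:
  fixes v Q
  defines "K \<equiv> (\<Sum>e | e \<in> avail Q \<and> v \<notin> inc e. real (conflicts Q v e))"
    and "P \<equiv> (\<Sum>a | a \<in> avail Q \<and> v \<in> inc a. \<Sum>u\<in>inc a - {v}. real (deg Q u))"
  shows "\<bar>K - P\<bar> \<le> 128 * real (deg Q v)"
proof -
  let ?X = "\<lambda>a. {e \<in> avail Q. v \<notin> inc e \<and> inc a \<inter> inc e \<noteq> {}}"
  let ?A = "{a \<in> avail Q. v \<in> inc a}"
  have "(\<Sum>e | e \<in> avail Q \<and> v \<notin> inc e. \<Sum>a | a \<in> ?A \<and> inc a \<inter> inc e \<noteq> {}. 1) =
      (\<Sum>a\<in>?A. \<Sum>e | e \<in> {e. e \<in> avail Q \<and> v \<notin> inc e} \<and> inc a \<inter> inc e \<noteq> {}. (1::real))"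
    using sum.swap_restrict[of "{e \<in> avail Q. v \<notin> inc e}" ?A "\<lambda>_ _. (1::real)" "\<lambda>e a. inc a \<inter> inc e \<noteq> {}"]
    by simp
  then have K: "K = (\<Sum>a\<in>?A. real (card (?X a)))"
    by (simp add: K_def conflicts_def conj_assoc)
  have "\<bar>K - P\<bar> = \<bar>\<Sum>a\<in>?A. real (card (?X a)) - (\<Sum>u\<in>inc a - {v}. real (deg Q u))\<bar>"
    unfolding K P_def by (simp add: sum_subtractf)
  also have "\<dots> \<le> (\<Sum>a\<in>?A. 128)"
  proof (intro order.trans[OF sum_abs] sum_mono)
    fix a assume "a \<in> ?A"
    then show "\<bar>real (card (?X a)) - (\<Sum>u\<in>inc a - {v}. real (deg Q u))\<bar> \<le> 128"
      using conflict_count[of v a Q] by force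
  qed
  also have "\<dots> = 128 * real (deg Q v)" by (simp add: deg_def)
  finally show ?thesis .
qed


text \<open>The heart of the analysis of the greedy process. Write \<open>d v\<close> for the deviation of the
  degree of \<open>v\<close> from its target \<open>u\<close>. When the edge \<open>e\<close> is chosen, a surviving vertex \<open>v\<close> loses
  \<open>conflicts Q v e\<close> available edges while the target decreases by \<open>\<Delta>\<close>. Summed over all choices of
  \<open>e\<close>, the change of the squared deviations is, up to lower order terms, a quadratic form in \<open>d\<close>: the
  loss caused by the edges through \<open>a\<close> is governed by the sum of the deviations over \<open>a\<close>, whose
  square enters with a favourable sign, and the change of the target contributes a multiple of
  \<open>S\<^sup>2\<close> with \<open>S\<close> the sum of all deviations. By the Cauchy-Schwarz inequality this last term is
  at most the gain \<open>6 u W\<close> that the quadratic form provides. What is left is \<open>2 n W\<close>, so that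
  after division by the number \<open>A\<close> of available edges the irregularity grows by a factor
  \<open>1 + O(1/n)\<close> as long as \<open>A\<close> is of order \<open>n\<^sup>2\<close>.\<close>

lemma irregularity_step:
  fixes Q and A :: real
  assumes Q: "matching Q" and size: "card Q < n"
  defines "A \<equiv> real (card (avail Q))"
  shows "(\<Sum>e\<in>avail Q. irregularity (insert e Q)) \<le>
    (A + 2 * n) * irregularity Q + 1500 * n * A + 24 * n ^ 3"
proof -
  define N where "N = real (n - card Q)"
  define u where "u = target (n - card Q)"
  define \<Delta> where "\<Delta> = u - target (n - card Q - 1)"
  define d where "d = (\<lambda>v. real (deg Q v) - u)"
  define W where "W = irregularity Q"
  define S where "S = (\<Sum>v\<in>free Q. d v)"
  define K where "K = (\<lambda>v. \<Sum>e | e \<in> avail Q \<and> v \<notin> inc e. real (conflicts Q v e))"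
  define P where "P = (\<lambda>v. \<Sum>a | a \<in> avail Q \<and> v \<in> inc a. \<Sum>w\<in>inc a - {v}. real (deg Q w))"
  have fQ: "finite Q" using Q finite_E finite_subset by (auto simp: matching_def)
  have n0: "real n > 0" using n_pos by simp
  have N1: "1 \<le> N" "N \<le> n" using size by (auto simp: N_def)
  have A0: "A \<ge> 0" by (simp add: A_def)
  have W: "W = (\<Sum>v\<in>free Q. (d v)\<^sup>2)" by (simp add: W_def irregularity_def d_def u_def)
  have uN: "u = N ^ 3 / real n ^ 2" by (simp add: u_def target_def N_def)
  have "real (n - card Q - 1) = N - 1" using size by (simp add: N_def)
  then have \<Delta>: "\<Delta> = (3 * N\<^sup>2 - 3 * N + 1) / real n ^ 2"
    using n0 by (simp add: \<Delta>_def uN target_def power3_eq_cube power2_eq_square divide_simps) (simp add: algebra_simps)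
  have N2: "N\<^sup>2 \<le> real n ^ 2" using N1 by (intro power_mono) auto
  have NN: "N \<le> N\<^sup>2" using N1 by (simp add: power2_eq_square)
  have \<Delta>0: "0 \<le> \<Delta>" "\<Delta> \<le> 3"
  proof -
    have "0 \<le> 3 * N\<^sup>2 - 3 * N + 1" "3 * N\<^sup>2 - 3 * N + 1 \<le> 3 * real n ^ 2"
      using N1 NN N2 by linarith+
    then show "0 \<le> \<Delta>" "\<Delta> \<le> 3" using n0 by (simp_all add: \<Delta> divide_simps)
  qed
  have u0: "0 \<le> u" "u \<le> n"
  proof -
    show "0 \<le> u" using N1 by (simp add: uN)
    have "N ^ 3 \<le> real n ^ 3" using N1 by (intro power_mono) auto
    then show "u \<le> n" using n0 by (simp add: uN divide_simps power3_eq_cube power2_eq_square)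
  qed
  have dn: "\<bar>d v\<bar> \<le> n" if "v \<in> free Q" for v
    using deg_le[OF that] u0 by (auto simp: d_def)
  have cf: "real (card (free Q)) = 4 * N" using card_free[OF Q] by (simp add: N_def)
  have fV: "v \<in> V" if "v \<in> free Q" for v using that by (simp add: free_def)
  have step: "irregularity (insert e Q) \<le> (\<Sum>v\<in>free Q - inc e. (d v)\<^sup>2 + 2 * d v * \<Delta> - 2 * d v * conflicts Q v e + 64)"
    if e: "e \<in> avail Q" for e
  proof -
    have "card (insert e Q) = card Q + 1" using avail_notin[OF e] fQ by simp
    then have t: "target (n - card (insert e Q)) = u - \<Delta>" by (simp add: \<Delta>_def)
    have "irregularity (insert e Q) = (\<Sum>v\<in>free Q - inc e. (d v + (\<Delta> - conflicts Q v e))\<^sup>2)"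
      by (simp add: irregularity_def t free_insert deg_insert d_def algebra_simps)
    also have "\<dots> \<le> (\<Sum>v\<in>free Q - inc e. (d v)\<^sup>2 + 2 * d v * \<Delta> - 2 * d v * conflicts Q v e + 64)"
    proof (rule sum_mono)
      fix v assume v: "v \<in> free Q - inc e"
      have "conflicts Q v e \<le> 8" using conflicts_le[of e v Q] v fV e avail_subset by auto
      then have "\<bar>\<Delta> - conflicts Q v e\<bar> \<le> 8" using \<Delta>0 by linarith
      then have "(\<Delta> - conflicts Q v e)\<^sup>2 \<le> 8\<^sup>2" by (metis abs_le_square_iff abs_numeral)
      then show "(d v + (\<Delta> - conflicts Q v e))\<^sup>2 \<le> (d v)\<^sup>2 + 2 * d v * \<Delta> - 2 * d v * conflicts Q v e + 64"
        unfolding power2_sum[of "d v" "\<Delta> - _"] by (simp add: right_diff_distrib)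
    qed
    finally show ?thesis .
  qed
  have "(\<Sum>e\<in>avail Q. irregularity (insert e Q)) \<le>
     (\<Sum>e\<in>avail Q. \<Sum>v | v \<in> free Q \<and> v \<notin> inc e. (d v)\<^sup>2 + 2 * d v * \<Delta> - 2 * d v * conflicts Q v e + 64)"
    using step by (intro sum_mono) (simp add: set_diff_eq)
  also have "\<dots> = (\<Sum>v\<in>free Q. \<Sum>e | e \<in> avail Q \<and> v \<notin> inc e. (d v)\<^sup>2 + 2 * d v * \<Delta> - 2 * d v * conflicts Q v e + 64)"
    by (rule sum.swap_restrict) auto
  also have "\<dots> \<le> (\<Sum>v\<in>free Q. A * (d v)\<^sup>2 + 2 * A * \<Delta> * d v - 2 * d v * P v + (6 * n ^ 2 + 64 * A + 256 * n * deg Q v))"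
  proof (rule sum_mono)
    fix v assume v: "v \<in> free Q"
    let ?B = "{e \<in> avail Q. v \<notin> inc e}"
    have "avail Q = ?B \<union> {e \<in> avail Q. v \<in> inc e}" by auto
    then have "card (avail Q) = card ?B + deg Q v"
      unfolding deg_def by (subst (1) \<open>avail Q = _\<close>, subst card_Un_disjoint) auto
    then have B: "real (card ?B) = A - deg Q v" by (simp add: A_def)
    have "(\<Sum>e\<in>?B. (d v)\<^sup>2 + 2 * d v * \<Delta> - 2 * d v * conflicts Q v e + 64) =
       real (card ?B) * ((d v)\<^sup>2 + 2 * d v * \<Delta> + 64) - 2 * d v * K v"
      by (simp add: K_def sum.distrib sum_subtractf sum_distrib_left algebra_simps)
    also have "\<dots> = A * (d v)\<^sup>2 + 2 * A * \<Delta> * d v - 2 * d v * P v + 64 * A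
        - deg Q v * ((d v)\<^sup>2 + 64) - 2 * (d v * (deg Q v * \<Delta>)) - 2 * (d v * (K v - P v))"
      unfolding B by (simp add: algebra_simps)
    also have "\<dots> \<le> A * (d v)\<^sup>2 + 2 * A * \<Delta> * d v - 2 * d v * P v + 64 * A
        - 0 + 2 * (real n * (real n * 3)) + 2 * (real n * (128 * real (deg Q v)))"
    proof -
      have "\<bar>d v * (deg Q v * \<Delta>)\<bar> \<le> real n * (real n * 3)"
        unfolding abs_mult using dn[OF v] deg_le[OF v] \<Delta>0 by (intro mult_mono) auto
      moreover have "\<bar>d v * (K v - P v)\<bar> \<le> real n * (128 * real (deg Q v))"
        unfolding abs_mult using dn[OF v] sum_conflicts[of Q v]
        by (intro mult_mono) (auto simp: K_def P_def)
      moreover have "real (deg Q v) * ((d v)\<^sup>2 + 64) \<ge> 0" by simp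
      ultimately show ?thesis by linarith
    qed
    finally show "(\<Sum>e\<in>?B. (d v)\<^sup>2 + 2 * d v * \<Delta> - 2 * d v * conflicts Q v e + 64) \<le>
      A * (d v)\<^sup>2 + 2 * A * \<Delta> * d v - 2 * d v * P v + (6 * n ^ 2 + 64 * A + 256 * n * deg Q v)"
      by (simp add: power2_eq_square algebra_simps)
  qed
  also have "\<dots> = A * W + 2 * A * \<Delta> * S - 2 * (\<Sum>v\<in>free Q. d v * P v)
       + (4 * N * (6 * n ^ 2 + 64 * A) + 256 * n * (4 * A))"
    using cf by (simp add: W S_def sum.distrib sum_subtractf mult.assoc sum_deg[of Q, folded A_def]
      flip: sum_distrib_left)
  finally have "(\<Sum>e\<in>avail Q. irregularity (insert e Q)) \<le> A * W + 2 * A * \<Delta> * S - 2 * (\<Sum>v\<in>free Q. d v * P v)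
       + (4 * N * (6 * n ^ 2 + 64 * A) + 256 * n * (4 * A))" .
  moreover have "(\<Sum>v\<in>free Q. d v * P v) \<ge> 3 * u * (W + u * S) - n * W"
  proof -
    have "(\<Sum>v\<in>free Q. d v * P v) = (\<Sum>v\<in>free Q. \<Sum>a | a \<in> avail Q \<and> v \<in> inc a. d v * (\<Sum>w\<in>inc a - {v}. real (deg Q w)))"
      by (simp add: P_def sum_distrib_left)
    also have "\<dots> = (\<Sum>a\<in>avail Q. \<Sum>v | v \<in> free Q \<and> v \<in> inc a. d v * (\<Sum>w\<in>inc a - {v}. real (deg Q w)))"
      by (rule sum.swap_restrict[symmetric]) auto
    also have "\<dots> = (\<Sum>a\<in>avail Q. \<Sum>v\<in>inc a. d v * (\<Sum>w\<in>inc a - {v}. real (deg Q w)))"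
      by (intro sum.cong refl) (auto simp: avail_def)
    also have "\<dots> \<ge> (\<Sum>a\<in>avail Q. 3 * u * (\<Sum>v\<in>inc a. d v) - (\<Sum>v\<in>inc a. (d v)\<^sup>2))"
    proof (rule sum_mono)
      fix a assume "a \<in> avail Q"
      then have a: "a \<in> E" using avail_subset by auto
      have fa: "finite (inc a)" using finite_inc[OF a] .
      let ?D = "\<Sum>w\<in>inc a. d w"
      have rest: "(\<Sum>w\<in>inc a - {v}. real (deg Q w)) = 3 * u + ?D - d v" if "v \<in> inc a" for v
      proof -
        have "(\<Sum>w\<in>inc a - {v}. real (deg Q w)) = (\<Sum>w\<in>inc a - {v}. u + d w)"
          by (simp add: d_def)
        also have "\<dots> = 3 * u + (?D - d v)"
          using that fa card_inc[OF a] by (simp add: sum.distrib sum_diff1)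
        finally show ?thesis by simp
      qed
      have "(\<Sum>v\<in>inc a. d v * (\<Sum>w\<in>inc a - {v}. real (deg Q w))) = (\<Sum>v\<in>inc a. 3 * u * d v + ?D * d v - (d v)\<^sup>2)"
        by (intro sum.cong refl) (simp only: rest, simp add: algebra_simps power2_eq_square)
      also have "\<dots> = 3 * u * ?D + ?D * ?D - (\<Sum>v\<in>inc a. (d v)\<^sup>2)"
        by (simp add: sum.distrib sum_subtractf flip: sum_distrib_left)
      finally show "3 * u * ?D - (\<Sum>v\<in>inc a. (d v)\<^sup>2) \<le> (\<Sum>v\<in>inc a. d v * (\<Sum>w\<in>inc a - {v}. real (deg Q w)))"
        by simp
    qed
    also have "(\<Sum>a\<in>avail Q. 3 * u * (\<Sum>v\<in>inc a. d v) - (\<Sum>v\<in>inc a. (d v)\<^sup>2)) =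
       3 * u * (\<Sum>v\<in>free Q. deg Q v * d v) - (\<Sum>v\<in>free Q. deg Q v * (d v)\<^sup>2)"
      by (simp add: sum_subtractf sum_avail_inc flip: sum_distrib_left)
    also have "(\<Sum>v\<in>free Q. deg Q v * d v) = W + u * S"
      by (simp add: W S_def d_def power2_eq_square algebra_simps sum_distrib_left flip: sum.distrib)
    finally have "(\<Sum>v\<in>free Q. d v * P v) \<ge> 3 * u * (W + u * S) - (\<Sum>v\<in>free Q. deg Q v * (d v)\<^sup>2)" .
    moreover have "(\<Sum>v\<in>free Q. deg Q v * (d v)\<^sup>2) \<le> n * W"
      unfolding W sum_distrib_left using deg_le by (intro sum_mono mult_right_mono) auto
    ultimately show ?thesis by linarith
  qed
  ultimately have main: "(\<Sum>e\<in>avail Q. irregularity (insert e Q)) \<le>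
    A * W + 2 * A * \<Delta> * S - 2 * (3 * u * (W + u * S) - n * W) + (4 * N * (6 * n ^ 2 + 64 * A) + 256 * n * (4 * A))"
    by simp
  have "4 * N * (6 * n ^ 2 + 64 * A) \<le> 4 * n * (6 * n ^ 2 + 64 * A)"
    using N1 A0 by (intro mult_right_mono) auto
  then have err: "4 * N * (6 * n ^ 2 + 64 * A) + 256 * n * (4 * A) \<le> 24 * n ^ 3 + 1280 * n * A"
    by (simp add: power3_eq_cube power2_eq_square algebra_simps)
  have S: "S = 4 * (A - N * u)"
    using cf sum_deg[of Q] by (simp add: S_def d_def sum_subtractf A_def)
  have "S\<^sup>2 \<le> real (card (free Q)) * W"
    unfolding S_def W by (subst mult.commute) (rule sum_squared_le_sum_of_squares)
  then have S2: "S\<^sup>2 \<le> 4 * N * W" using cf by simp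
  have Sn: "\<bar>S\<bar> \<le> 4 * n * n"
  proof -
    have "\<bar>S\<bar> \<le> (\<Sum>v\<in>free Q. real n)"
      unfolding S_def using dn by (intro order.trans[OF sum_abs] sum_mono) auto
    also have "\<dots> \<le> 4 * n * n" using cf N1 by simp
    finally show ?thesis .
  qed
  \<comment> \<open>The discrete decrease of the target is compared with its derivative \<open>3 u / N\<close>.\<close>
  define \<rho> where "\<rho> = 3 * u / N - \<Delta>"
  have \<rho>: "0 \<le> \<rho>" "\<rho> \<le> 3 / n"
  proof -
    have "\<rho> = (3 * N - 1) / real n ^ 2"
      using N1 n0 by (simp add: \<rho>_def \<Delta> uN divide_simps power3_eq_cube power2_eq_square)
    moreover have "(3 * N - 1) / real n ^ 2 \<le> (3 * n) / real n ^ 2"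
      using N1 by (intro divide_right_mono) auto
    moreover have "(3 * n) / real n ^ 2 = 3 / n" using n0 by (simp add: power2_eq_square)
    ultimately show "0 \<le> \<rho>" "\<rho> \<le> 3 / n" using N1 by auto
  qed
  \<comment> \<open>Since \<open>S = 4 (A - N u)\<close>, the terms linear in \<open>S\<close> combine to a multiple of \<open>S\<^sup>2\<close>.\<close>
  have "2 * A * \<Delta> * S - 6 * u * u * S = (6 * u / N) * (S * (A - N * u)) - 2 * A * \<rho> * S"
    using N1 by (simp add: \<rho>_def field_simps)
  also have "S * (A - N * u) = S\<^sup>2 / 4" using S by (simp add: power2_eq_square)
  also have "(6 * u / N) * (S\<^sup>2 / 4) \<le> (6 * u / N) * (4 * N * W / 4)"
    using S2 u0 N1 by (intro mult_left_mono divide_right_mono) auto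
  also have "(6 * u / N) * (4 * N * W / 4) = 6 * u * W" using N1 by simp
  finally have 1: "2 * A * \<Delta> * S - 6 * u * u * S \<le> 6 * u * W - 2 * A * \<rho> * S" by simp
  have "\<bar>\<rho> * S\<bar> \<le> (3 / n) * (4 * n * n)"
    unfolding abs_mult using \<rho> Sn by (intro mult_mono) auto
  also have "\<dots> = 12 * n" using n0 by simp
  finally have "A * (- (\<rho> * S)) \<le> A * (12 * n)" using A0 by (intro mult_left_mono) auto
  then have "- 2 * A * \<rho> * S \<le> 24 * n * A" by (simp add: algebra_simps)
  then have "(\<Sum>e\<in>avail Q. irregularity (insert e Q)) \<le> A * W + 2 * n * W + 24 * n * A + (24 * n ^ 3 + 1280 * n * A)"
    using main err 1 by (simp add: algebra_simps)
  also have "\<dots> \<le> (A + 2 * n) * W + 1500 * n * A + 24 * n ^ 3"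
    using A0 by (simp add: algebra_simps)
  finally show ?thesis by (simp add: W_def)
qed

lemma irregularity_empty: "irregularity {} = 0"
proof -
  have "avail {} = E" using inc_subset by (auto simp: avail_def free_def)
  then have "deg {} v = n" if "v \<in> free {}" for v
    using that degree by (simp add: deg_def free_def)
  then show ?thesis using n_pos
    by (simp add: irregularity_def target_def power3_eq_cube power2_eq_square)
qed

lemma irregularity_nonneg: "irregularity Q \<ge> 0"
  unfolding irregularity_def by (intro sum_nonneg) auto

text \<open>The deviation of the number of available edges from its target value \<open>N u\<close> is a quarter of the
  sum of all deviations of degrees, hence controlled by the irregularity. The threshold
  \<open>\<epsilon> ^ 8 * n ^ 3\<close> is chosen such that the deviation is at most half of the target.\<close>

lemma many_available:
  fixes \<epsilon> :: real
  assumes Q: "matching Q" and size: "real (card Q) \<le> (1 - \<epsilon>) * n" and "\<epsilon> > 0"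
    and W: "irregularity Q \<le> \<epsilon> ^ 8 * n ^ 3"
  shows "real (card (avail Q)) \<ge> \<epsilon> ^ 4 * n ^ 2 / 2"
proof -
  define A where "A = real (card (avail Q))"
  define N where "N = real (n - card Q)"
  define u where "u = target (n - card Q)"
  define S where "S = (\<Sum>v\<in>free Q. real (deg Q v) - u)"
  have n0: "real n > 0" using n_pos by simp
  have N: "\<epsilon> * n \<le> N" "N \<le> n" using size card_free(2)[OF Q] by (auto simp: N_def algebra_simps of_nat_diff)
  have cf: "real (card (free Q)) = 4 * N" using card_free[OF Q] by (simp add: N_def)
  have S: "S = 4 * (A - N * u)"
    using cf sum_deg[of Q] by (simp add: S_def sum_subtractf A_def)
  have "S\<^sup>2 \<le> real (card (free Q)) * irregularity Q"
    unfolding S_def irregularity_def u_def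
    by (subst mult.commute) (rule sum_squared_le_sum_of_squares)
  also have "\<dots> \<le> (4 * n) * (\<epsilon> ^ 8 * n ^ 3)"
    using cf N W irregularity_nonneg by (intro mult_mono) auto
  also have "\<dots> = (2 * \<epsilon> ^ 4 * n ^ 2)\<^sup>2" by (simp add: power2_eq_square eval_nat_numeral algebra_simps)
  finally have "\<bar>S\<bar> \<le> \<bar>2 * \<epsilon> ^ 4 * n ^ 2\<bar>" using abs_le_square_iff by blast
  then have "S \<ge> - (2 * \<epsilon> ^ 4 * n ^ 2)" using assms(3) by simp
  moreover have "N * u \<ge> \<epsilon> ^ 4 * n ^ 2"
  proof -
    have "N * u = N ^ 4 / n ^ 2" by (simp add: u_def target_def N_def eval_nat_numeral)
    also have "\<dots> \<ge> (\<epsilon> * n) ^ 4 / n ^ 2"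
      using N assms(3) by (intro divide_right_mono power_mono) auto
    also have "(\<epsilon> * n) ^ 4 / n ^ 2 = \<epsilon> ^ 4 * n ^ 2" using n0 by (simp add: eval_nat_numeral field_simps)
    finally show ?thesis by simp
  qed
  ultimately show ?thesis using S by (simp add: A_def)
qed

end

section \<open>The toroidal board as a regular hypergraph\<close>

text \<open>The rows, columns, sum diagonals and difference diagonals of the torus are numbered by residues
  and tagged by \<open>0\<close>, \<open>1\<close>, \<open>2\<close>, \<open>3\<close>.\<close>

fun lines :: "nat \<Rightarrow> pos \<Rightarrow> (nat \<times> int) set" where
  "lines n (x, y) =
     {(0, x mod int n), (1, y mod int n), (2, (x + y) mod int n), (3, (x - y) mod int n)}"

lemma ex1_residue:
  assumes "n > 0"
  shows "\<exists>!y\<in>{1..int n}. y mod int n = z mod int n"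
proof (rule ex1I)
  let ?y = "(z - 1) mod int n + 1"
  show "?y \<in> {1..int n} \<and> ?y mod int n = z mod int n"
  proof -
    have "(z - 1) mod int n < int n" using assms by simp
    then have "(z - 1) mod int n + 1 \<le> int n" by linarith
    then show ?thesis using assms by (simp add: mod_simps)
  qed
  fix y assume y: "y \<in> {1..int n} \<and> y mod int n = z mod int n"
  then have "(y - 1) mod int n = (z - 1) mod int n" by (metis mod_diff_left_eq)
  then show "y = ?y" using y by simp
qed

lemma residue_unique:
  assumes "x \<in> {1..int n}" "y \<in> {1..int n}" "x mod int n = y mod int n"
  shows "x = y"
  using ex1_residue[of n y] assms by (cases n) auto

lemma card_board_fibres:
  assumes "\<And>x. x \<in> {1..int n} \<Longrightarrow> \<exists>!y\<in>{1..int n}. R x y"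
  shows "card {(x, y) \<in> board n. R x y} = n"
proof -
  have "bij_betw fst {(x, y) \<in> board n. R x y} {1..int n}"
    unfolding bij_betw_def inj_on_def using assms by (force simp: board_def image_iff)
  then show ?thesis by (simp add: bij_betw_same_card)
qed

lemma mod_shift_iff:
  fixes x :: int
  assumes "s \<in> {0..<int n}"
  shows "(x + y) mod int n = s \<longleftrightarrow> y mod int n = (s - x) mod int n"
    and "(x - y) mod int n = s \<longleftrightarrow> y mod int n = (x - s) mod int n"
proof -
  have s: "s mod int n = s" using assms by simp
  show "(x + y) mod int n = s \<longleftrightarrow> y mod int n = (s - x) mod int n"
    by (metis s add_diff_cancel_left' diff_add_cancel mod_add_left_eq mod_diff_left_eq add.commute)
  show "(x - y) mod int n = s \<longleftrightarrow> y mod int n = (x - s) mod int n"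
    by (metis s diff_diff_eq2 add_diff_cancel_left' mod_diff_right_eq)
qed

lemma card_line:
  assumes n: "n > 0" and v: "v \<in> {0..3} \<times> {0..<int n}"
  shows "card {e \<in> board n. v \<in> lines n e} = n"
proof -
  obtain i s where v': "v = (i, s)" by fastforce
  have s: "s \<in> {0..<int n}" "s = s mod int n" and i: "i \<in> {0, 1, 2, 3}" using v by (auto simp: v')
  have sel: "{e \<in> board n. v \<in> lines n e} = {(x, y) \<in> board n. v \<in> lines n (x, y)}" by auto
  have "card {(x, y) \<in> board n. v \<in> lines n (x, y)} = n"
  proof (cases "i = 0")
    case True
    have "{(x, y) \<in> board n. v \<in> lines n (x, y)} = prod.swap ` {(x, y) \<in> board n. y mod int n = s}"
      by (force simp: v' True board_def image_iff)
    moreover have "card {(x, y) \<in> board n. y mod int n = s} = n"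
      using ex1_residue[OF n, of s] s by (intro card_board_fibres) auto
    ultimately show ?thesis by (simp add: card_image)
  next
    case False
    show ?thesis
    proof (rule card_board_fibres)
      fix x :: int assume "x \<in> {1..int n}"
      consider "i = 1" | "i = 2" | "i = 3" using i False by auto
      then show "\<exists>!y\<in>{1..int n}. v \<in> lines n (x, y)"
      proof cases
        case 1
        then show ?thesis using ex1_residue[OF n, of s] s by (simp add: v' eq_commute[of s])
      next
        case 2
        then show ?thesis using ex1_residue[OF n, of "s - x"] mod_shift_iff(1)[OF s(1), of x]
          by (simp add: v' eq_commute[of s])
      next
        case 3
        then show ?thesis using ex1_residue[OF n, of "x - s"] mod_shift_iff(2)[OF s(1), of x]
          by (simp add: v' eq_commute[of s])
      qed
    qed
  qed
  then show ?thesis using sel by simp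
qed

text \<open>If \<open>n\<close> is even, two diagonals of different directions meet in zero or two cells: this is
  the only case in which two lines share more than one cell.\<close>

lemma card_double_residue: "card {x \<in> {1..int n}. (2 * x) mod int n = s} \<le> 2"
proof -
  define X where "X = {x \<in> {1..int n}. (2 * x) mod int n = s}"
  show ?thesis
  proof (cases "X = {}")
    case True
    then have "card X \<le> 2" by simp
    then show ?thesis by (simp only: X_def)
  next
    case False
    have fin: "finite X" by (rule finite_subset[of _ "{1..int n}"]) (auto simp: X_def)
    define m where "m = Min X"
    have m: "m \<in> X" "\<And>x. x \<in> X \<Longrightarrow> m \<le> x" using fin False by (auto simp: m_def)
    have "x = m \<or> x = m + int n div 2" if x: "x \<in> X" for x
    proof -
      have "(2 * x) mod int n = (2 * m) mod int n" using x m(1) by (simp add: X_def)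
      then have "int n dvd 2 * x - 2 * m" by (simp only: mod_eq_dvd_iff)
      then obtain k where k: "2 * x - 2 * m = int n * k" by (elim dvdE)
      have "0 \<le> int n * k" "int n * k < int n * 2" "int n > 0"
        using x m by (auto simp: X_def simp flip: k)
      then have "0 \<le> k" "k < 2" by (simp_all add: zero_le_mult_iff)
      then have "k = 0 \<or> k = 1" by auto
      then show ?thesis using k by auto
    qed
    then have "X \<subseteq> {m, m + int n div 2}" by auto
    then have "card X \<le> card {m, m + int n div 2}" by (intro card_mono) auto
    also have "\<dots> \<le> 2" by (simp add: card_insert_if)
    finally show ?thesis by (simp add: X_def)
  qed
qed

text \<open>Two lines of different kinds determine the residues of both coordinates, unless they are
  diagonals of different directions, which determine only twice the first coordinate.\<close>

lemma card_two_lines: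
  assumes n: "n > 0" and "u \<noteq> v"
  shows "card {e \<in> board n. u \<in> lines n e \<and> v \<in> lines n e} \<le> 2"
proof -
  have main: "card {e \<in> board n. (i, a) \<in> lines n e \<and> (j, b) \<in> lines n e} \<le> 2" if "i < j" for i j a b
  proof (cases "i = 2 \<and> j = 3")
    case True
    let ?X = "{e \<in> board n. (i, a) \<in> lines n e \<and> (j, b) \<in> lines n e}"
    have "inj_on fst ?X"
    proof (rule inj_onI)
      fix p q assume pq: "p \<in> ?X" "q \<in> ?X" "fst p = fst q"
      obtain x y y' where e: "p = (x, y)" "q = (x, y')" using pq by (metis prod.collapse)
      have "(x + y) mod int n = (x + y') mod int n" using pq True by (auto simp: e)
      then have "y mod int n = y' mod int n" by (metis add_diff_cancel_left' mod_diff_left_eq)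
      then show "p = q" using pq residue_unique[of y n y'] by (auto simp: e board_def)
    qed
    then have "card ?X = card (fst ` ?X)" by (simp add: card_image)
    also have "\<dots> \<le> card {x \<in> {1..int n}. (2 * x) mod int n = (a + b) mod int n}"
    proof (rule card_mono)
      show "finite {x \<in> {1..int n}. (2 * x) mod int n = (a + b) mod int n}"
        by (rule finite_subset[of _ "{1..int n}"]) auto
      show "fst ` ?X \<subseteq> {x \<in> {1..int n}. (2 * x) mod int n = (a + b) mod int n}"
      proof (clarsimp simp: board_def True)
        fix x y :: int
        show "(2 * x) mod int n = ((x + y) mod int n + (x - y) mod int n) mod int n"
          by (simp add: mod_simps)
      qed
    qed
    also have "\<dots> \<le> 2" by (rule card_double_residue)
    finally show ?thesis .
  next
    case False
    let ?X = "{e \<in> board n. (i, a) \<in> lines n e \<and> (j, b) \<in> lines n e}"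
    have "p = q" if pq: "p \<in> ?X" "q \<in> ?X" for p q
    proof -
      obtain x y x' y' where e: "p = (x, y)" "q = (x', y')" by fastforce
      have r: "x \<in> {1..int n}" "x' \<in> {1..int n}" "y \<in> {1..int n}" "y' \<in> {1..int n}"
        using pq by (auto simp: e board_def)
      have mods: "x mod int n = x' mod int n \<and> y mod int n = y' mod int n"
      proof -
        have 1: "y mod int n = y' mod int n"
          if "x mod int n = x' mod int n" "(x + y) mod int n = (x' + y') mod int n" 
          using mod_diff_cong[OF that(2,1)] by simp
        have 2: "y mod int n = y' mod int n"
          if "x mod int n = x' mod int n" "(x - y) mod int n = (x' - y') mod int n" 
          using mod_diff_cong[OF that(1,2)] by simp
        have 3: "x mod int n = x' mod int n"
          if "y mod int n = y' mod int n" "(x + y) mod int n = (x' + y') mod int n" 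
          using mod_diff_cong[OF that(2,1)] by simp
        have 4: "x mod int n = x' mod int n"
          if "y mod int n = y' mod int n" "(x - y) mod int n = (x' - y') mod int n" 
          using mod_add_cong[OF that(2,1)] by simp
        consider "i = 0" "j = 1" | "i = 0" "j = 2" | "i = 0" "j = 3" | "i = 1" "j = 2" | "i = 1" "j = 3"
          using pq(1) \<open>i < j\<close> False by (auto simp: e)
        moreover have "i = 0 \<Longrightarrow> x mod int n = x' mod int n"
          "i = 1 \<or> j = 1 \<Longrightarrow> y mod int n = y' mod int n"
          "j = 2 \<Longrightarrow> (x + y) mod int n = (x' + y') mod int n"
          "j = 3 \<Longrightarrow> (x - y) mod int n = (x' - y') mod int n"
          using pq by (auto simp: e)
        ultimately show ?thesis using 1 2 3 4 by cases blast+
      qed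
      then show "p = q" using residue_unique[of x n x'] residue_unique[of y n y'] r by (simp add: e)
    qed
    then have "card ?X \<le> Suc 0" by (subst card_le_Suc0_iff_eq) (auto intro: finite_subset[OF _ finite_board[of n]])
    then show ?thesis by simp
  qed
  obtain i a j b where uv: "u = (i, a)" "v = (j, b)" by fastforce
  consider "i < j" | "j < i" | "i = j" "a \<noteq> b"
    using assms(2) unfolding uv by (metis linorder_neqE_nat)
  then show ?thesis
  proof cases
    case 1 then show ?thesis using main[of i j a b] by (simp add: uv)
  next
    case 2 then show ?thesis using main[of j i b a] by (simp add: uv conj_commute)
  next
    case 3
    then have "{e \<in> board n. u \<in> lines n e \<and> v \<in> lines n e} = {}" by (auto simp: uv)
    then show ?thesis by (simp only: card.empty)
  qed
qed

lemma torus_hypergraph: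
  assumes "n > 0"
  shows "quad_hypergraph (board n) ({0..3} \<times> {0..<int n}) (lines n) n"
proof
  show "finite (board n)" "finite ({0..3::nat} \<times> {0..<int n})" "0 < n" using assms by auto
  show "card ({0..3::nat} \<times> {0..<int n}) = 4 * n" by (simp add: card_cartesian_product)
  fix e assume "e \<in> board n"
  show "lines n e \<subseteq> {0..3} \<times> {0..<int n}" using assms by (cases e) auto
  show "card (lines n e) = 4" by (cases e) simp
next
  fix v assume "v \<in> {0..3::nat} \<times> {0..<int n}"
  then show "card {e \<in> board n. v \<in> lines n e} = n" by (rule card_line[OF assms])
next
  fix u v :: "nat \<times> int" assume "u \<noteq> v"
  then show "card {e \<in> board n. u \<in> lines n e \<and> v \<in> lines n e} \<le> 2" by (rule card_two_lines[OF assms])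
qed

section \<open>The greedy process\<close>

abbreviation "toroidal n \<equiv> quad_hypergraph.matching (board n) (lines n)"

lemma available_eq_avail:
  assumes n: "n > 0" and Q: "Q \<subseteq> board n"
  shows "available n Q = quad_hypergraph.avail (board n) ({0..3} \<times> {0..<int n}) (lines n) Q"
proof -
  interpret quad_hypergraph "board n" "{0..3} \<times> {0..<int n}" "lines n" n using torus_hypergraph[OF n] .
  have "e \<in> available n Q \<longleftrightarrow> (\<forall>q\<in>Q. lines n e \<inter> lines n q = {})" if e: "e \<in> board n" for e
  proof -
    obtain x y where xy: "e = (x, y)" by fastforce
    have r: "x \<in> {1..int n}" "y \<in> {1..int n}" using e by (auto simp: xy board_def)
    have key: "q' \<in> board_row n x \<or> q' \<in> board_column n y
        \<or> (\<exists>D\<in>toroidal_diagonals n (x, y). q' \<in> D) \<longleftrightarrow> lines n e \<inter> lines n q' \<noteq> {}"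
      if q': "q' \<in> Q" for q'
    proof -
      obtain a b where ab': "q' = (a, b)" by fastforce
      have q: "(a, b) \<in> Q" using q' ab' by simp
      have ab: "a \<in> {1..int n}" "b \<in> {1..int n}" "(a, b) \<in> board n" using Q q by (auto simp: board_def)
      have "(a, b) \<in> board_row n x \<longleftrightarrow> a mod int n = x mod int n"
        using ab r residue_unique[of a n x] by (auto simp: board_row_def)
      moreover have "(a, b) \<in> board_column n y \<longleftrightarrow> b mod int n = y mod int n"
        using ab r residue_unique[of b n y] by (auto simp: board_column_def)
      moreover have "lines n e \<inter> lines n (a, b) \<noteq> {} \<longleftrightarrow> a mod int n = x mod int n \<or> b mod int n = y mod int n
         \<or> (a + b) mod int n = (x + y) mod int n \<or> (a - b) mod int n = (x - y) mod int n"
        by (auto simp: xy)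
      ultimately show ?thesis using ab by (simp add: ab')
    qed
    have "e \<in> available n Q \<longleftrightarrow> (\<forall>q\<in>Q. q \<notin> board_row n x \<and> q \<notin> board_column n y
        \<and> (\<forall>D\<in>toroidal_diagonals n (x, y). q \<notin> D))"
      using e unfolding available_def xy mem_Collect_eq prod.case by blast
    also have "\<dots> \<longleftrightarrow> (\<forall>q\<in>Q. lines n e \<inter> lines n q = {})" using key by blast
    finally show ?thesis .
  qed
  moreover have "e \<in> avail Q \<longleftrightarrow> (\<forall>q\<in>Q. lines n e \<inter> lines n q = {})" if e: "e \<in> board n" for e
    using e inc_subset[OF e] by (auto simp: avail_def free_def)
  moreover have "available n Q \<subseteq> board n" "avail Q \<subseteq> board n"
    using avail_subset by (auto simp: available_def)
  ultimately show ?thesis by blast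
qed

lemma set_pmf_greedy_Suc:
  "set_pmf (greedy n (Suc t)) = (\<Union>Q\<in>set_pmf (greedy n t).
     if available n Q = {} then {Q} else (\<lambda>p. insert p Q) ` available n Q)"
proof -
  have "set_pmf (if available n Q = {} then return_pmf Q
      else map_pmf (\<lambda>p. Q \<union> {p}) (pmf_of_set (available n Q))) =
    (if available n Q = {} then {Q} else (\<lambda>p. insert p Q) ` available n Q)" for Q
    by (simp add: set_pmf_of_set)
  then show ?thesis unfolding greedy.simps set_bind_pmf by simp
qed

lemma greedy_toroidal:
  assumes n: "n > 0" and "Q \<in> set_pmf (greedy n t)"
  shows "toroidal n Q"
  using assms(2)
proof (induction t arbitrary: Q)
  interpret quad_hypergraph "board n" "{0..3} \<times> {0..<int n}" "lines n" n using torus_hypergraph[OF n] .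
  case 0
  then show ?case by (simp add: matching_def)
next
  interpret quad_hypergraph "board n" "{0..3} \<times> {0..<int n}" "lines n" n using torus_hypergraph[OF n] .
  case (Suc t)
  then obtain Q' where Q': "Q' \<in> set_pmf (greedy n t)" and Q: "Q = Q' \<or> (\<exists>p\<in>available n Q'. Q = insert p Q')"
    unfolding set_pmf_greedy_Suc by (auto split: if_splits)
  have m: "matching Q'" using Suc.IH[OF Q'] .
  then have "available n Q' = avail Q'" using available_eq_avail[OF n, of Q'] by (simp add: matching_def)
  then show ?case using Q m matching_insert by auto
qed

lemma finite_set_pmf_greedy: "finite (set_pmf (greedy n t))"
proof (rule finite_subset)
  show "set_pmf (greedy n t) \<subseteq> Pow (board n)"
    using partial_queens_greedy unfolding partial_queens_def by blast
qed simp

lemma expectation_greedy_Suc: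
  fixes g :: "pos set \<Rightarrow> real"
  shows "measure_pmf.expectation (greedy n (Suc t)) g = measure_pmf.expectation (greedy n t)
    (\<lambda>Q. if available n Q = {} then g Q
         else (\<Sum>p\<in>available n Q. g (insert p Q)) / card (available n Q))"
proof -
  let ?k = "\<lambda>Q. if available n Q = {} then return_pmf Q
          else map_pmf (\<lambda>p. Q \<union> {p}) (pmf_of_set (available n Q))"
  have k: "measure_pmf.expectation (?k Q) g = (if available n Q = {} then g Q
         else (\<Sum>p\<in>available n Q. g (insert p Q)) / card (available n Q))" for Q
    by (simp add: integral_pmf_of_set)
  have "measure_pmf.expectation (greedy n (Suc t)) g =
    (\<Sum>Q\<in>set_pmf (greedy n t). pmf (greedy n t) Q *\<^sub>R measure_pmf.expectation (?k Q) g)"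
    unfolding greedy.simps
    by (rule pmf_expectation_bind) (auto simp: finite_set_pmf_greedy set_pmf_of_set)
  also have "\<dots> = measure_pmf.expectation (greedy n t) (\<lambda>Q. measure_pmf.expectation (?k Q) g)"
    by (rule integral_measure_pmf[symmetric]) (auto simp: finite_set_pmf_greedy)
  finally show ?thesis by (simp only: k)
qed

text \<open>Truncating at \<open>1\<close> takes the place of a stopping time: a state with \<open>f t Q \<ge> 1\<close> already counts as
  a failure, so the supermartingale inequality is needed only where \<open>f t Q < 1\<close>. Then the
  expectation of \<open>min 1 (f t Q)\<close> decreases in \<open>t\<close>, and Markov's inequality applies at time \<open>m\<close>.\<close>

lemma greedy_supermartingale:
  fixes f :: "nat \<Rightarrow> pos set \<Rightarrow> real"
  assumes nonneg: "\<And>t Q. f t Q \<ge> 0"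
    and step: "\<And>t Q. t < m \<Longrightarrow> Q \<in> set_pmf (greedy n t) \<Longrightarrow> f t Q < 1 \<Longrightarrow> available n Q \<noteq> {} \<and>
       (\<Sum>p\<in>available n Q. f (Suc t) (insert p Q)) \<le> card (available n Q) * f t Q"
  shows "measure_pmf.prob (greedy n m) {Q. f m Q \<ge> 1} \<le> f 0 {}"
proof -
  let ?E = "\<lambda>t. measure_pmf.expectation (greedy n t) (\<lambda>Q. min 1 (f t Q))"
  have int: "integrable (measure_pmf (greedy n t)) h" for t and h :: "pos set \<Rightarrow> real"
    by (simp add: integrable_measure_pmf_finite finite_set_pmf_greedy)
  have le: "?E (Suc t) \<le> ?E t" if t: "t < m" for t
    unfolding expectation_greedy_Suc
  proof (intro integral_mono_AE int AE_pmfI)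
    fix Q assume Q: "Q \<in> set_pmf (greedy n t)"
    let ?A = "available n Q"
    show "(if ?A = {} then min 1 (f (Suc t) Q)
         else (\<Sum>p\<in>?A. min 1 (f (Suc t) (insert p Q))) / card ?A) \<le> min 1 (f t Q)"
    proof (cases "f t Q < 1")
      case True
      have ne: "?A \<noteq> {}" and le: "(\<Sum>p\<in>?A. f (Suc t) (insert p Q)) \<le> card ?A * f t Q"
        using step[OF t Q True] by auto
      have c: "card ?A > 0" using ne by (simp add: card_gt_0_iff)
      have "(\<Sum>p\<in>?A. min 1 (f (Suc t) (insert p Q))) \<le> (\<Sum>p\<in>?A. f (Suc t) (insert p Q))"
        by (intro sum_mono) auto
      then show ?thesis using ne True le c by (auto simp: field_simps)
    next
      case False
      have "(\<Sum>p\<in>?A. min 1 (f (Suc t) (insert p Q))) \<le> (\<Sum>p\<in>?A. 1)"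
        by (intro sum_mono) auto
      then show ?thesis using False by (auto simp: divide_le_eq_1)
    qed
  qed
  have "t \<le> m \<Longrightarrow> ?E t \<le> f 0 {}" for t
  proof (induction t)
    case 0
    then show ?case using nonneg by simp
  next
    case (Suc t)
    then show ?case using le[of t] by simp
  qed
  then have E: "?E m \<le> f 0 {}" by simp
  have "measure_pmf.prob (greedy n m) {Q. f m Q \<ge> 1} = measure_pmf.expectation (greedy n m) (indicator {Q. f m Q \<ge> 1})"
    by simp
  also have "\<dots> \<le> ?E m"
    using nonneg by (intro integral_mono_AE int AE_pmfI) (auto simp: indicator_def)
  finally show ?thesis using E by simp
qed

lemma greedy_prob_mono:
  assumes up: "\<And>t Q p. Q \<in> set_pmf (greedy n t) \<Longrightarrow> Q \<in> U \<Longrightarrow> p \<in> available n Q \<Longrightarrow> insert p Q \<in> U"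
    and "s \<le> t"
  shows "measure_pmf.prob (greedy n s) U \<le> measure_pmf.prob (greedy n t) U"
  using \<open>s \<le> t\<close>
proof (induction t rule: dec_induct)
  case base
  then show ?case by simp
next
  case (step t)
  have "measure_pmf.prob (greedy n t) U = measure_pmf.expectation (greedy n t) (indicator U)" by simp
  also have "\<dots> \<le> measure_pmf.expectation (greedy n (Suc t)) (indicator U)"
    unfolding expectation_greedy_Suc
  proof (intro integral_mono_AE integrable_measure_pmf_finite finite_set_pmf_greedy AE_pmfI)
    fix Q assume Q: "Q \<in> set_pmf (greedy n t)"
    show "indicator U Q \<le> (if available n Q = {} then indicator U Q
         else (\<Sum>p\<in>available n Q. indicator U (insert p Q)) / real (card (available n Q)))"
    proof (cases "Q \<in> U \<and> available n Q \<noteq> {}")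
      case True
      then have "(\<Sum>p\<in>available n Q. indicator U (insert p Q)) = (\<Sum>p\<in>available n Q. 1::real)"
        using up[OF Q] by (intro sum.cong) auto
      then show ?thesis using True by (simp add: card_gt_0_iff)
    next
      case False
      then show ?thesis by (auto intro!: divide_nonneg_nonneg sum_nonneg)
    qed
  qed
  also have "\<dots> = measure_pmf.prob (greedy n (Suc t)) U" by simp
  finally show ?case using step.IH by simp
qed

text \<open>For every fixed \<open>\<epsilon>\<close> the process runs without aborting up to time \<open>(1 - \<epsilon>) n\<close>, except with
  probability \<open>O(1/n)\<close>. The supermartingale is the irregularity, normalised by its critical value
  \<open>\<epsilon> ^ 8 * n ^ 3\<close>: the additive term \<open>C3 * n\<^sup>2\<close> absorbs the bounded contributions of a step, and the
  factor \<open>(1 + C / n) ^ (m - t)\<close> absorbs the relative growth. As long as its value is below \<open>1\<close>, the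
  irregularity is below the critical value and there are many available cells. A state in which
  some step has been skipped gets the value \<open>1\<close>.\<close>

lemma greedy_almost_complete:
  fixes \<epsilon> :: real and n m :: nat
  assumes n: "n > 0" and eps: "0 < \<epsilon>" "\<epsilon> \<le> 1" and m: "real m \<le> (1 - \<epsilon>) * n"
  shows "measure_pmf.prob (greedy n m) {Q. card Q \<noteq> m} \<le>
    (1500 + 48 / \<epsilon> ^ 4) * exp (4 / \<epsilon> ^ 4) / \<epsilon> ^ 8 / n"
proof -
  interpret quad_hypergraph "board n" "{0..3} \<times> {0..<int n}" "lines n" n using torus_hypergraph[OF n] .
  define C where "C = 4 / \<epsilon> ^ 4"
  define C3 where "C3 = 1500 + 48 / \<epsilon> ^ 4"
  define f where "f = (\<lambda>t Q. if card Q = t then (irregularity Q + C3 * n ^ 2) * (1 + C / n) ^ (m - t) / (\<epsilon> ^ 8 * n ^ 3) else 1)"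
  have n0: "real n > 0" using n by simp
  have "\<epsilon> ^ 4 \<le> 1" using eps by (simp add: power_le_one)
  then have C: "C \<ge> 1" using eps by (simp add: C_def le_divide_eq)
  have C3: "C3 \<ge> 0" using eps by (simp add: C3_def)
  have nonneg: "f t Q \<ge> 0" for t Q
    using irregularity_nonneg[of Q] C C3 eps by (simp add: f_def)
  have step: "available n Q \<noteq> {} \<and> (\<Sum>p\<in>available n Q. f (Suc t) (insert p Q)) \<le> card (available n Q) * f t Q"
    if t: "t < m" and Q: "Q \<in> set_pmf (greedy n t)" and lt: "f t Q < 1" for t Q
  proof -
    have mQ: "matching Q" using greedy_toroidal[OF n Q] .
    then have sub: "Q \<subseteq> board n" by (simp add: matching_def)
    have av: "available n Q = avail Q" using available_eq_avail[OF n sub] .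
    have fQ: "finite Q" using sub finite_board finite_subset by blast
    have card: "card Q = t" using lt by (auto simp: f_def split: if_splits)
    define W where "W = irregularity Q"
    define A where "A = real (card (avail Q))"
    define R where "R = (1 + C / n) ^ (m - Suc t) / (\<epsilon> ^ 8 * n ^ 3)"
    have R: "R \<ge> 0" using C eps by (simp add: R_def)
    have W0: "W \<ge> 0" using irregularity_nonneg by (simp add: W_def)
    have ft: "f t Q = (W + C3 * n ^ 2) * (1 + C / n) * R"
    proof -
      have "m - t = Suc (m - Suc t)" using t by simp
      then show ?thesis by (simp add: f_def card W_def R_def)
    qed
    have "W \<le> \<epsilon> ^ 8 * n ^ 3"
    proof -
      have "W * 1 \<le> (W + C3 * n ^ 2) * (1 + C / n) ^ (m - t)"
        using W0 C3 C n0 by (intro mult_mono) (auto intro: one_le_power)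
      moreover have "(W + C3 * n ^ 2) * (1 + C / n) ^ (m - t) < \<epsilon> ^ 8 * n ^ 3"
        using lt card eps n0 by (simp add: f_def W_def divide_less_eq)
      ultimately show ?thesis by simp
    qed
    moreover have size: "real (card Q) \<le> (1 - \<epsilon>) * n" using m t card by simp
    ultimately have A: "A \<ge> \<epsilon> ^ 4 * n ^ 2 / 2"
      using many_available[OF mQ _ eps(1)] by (simp add: A_def W_def)
    moreover have "\<epsilon> ^ 4 * n ^ 2 / 2 > 0" using eps n0 by simp
    ultimately have A0: "A > 0" by linarith
    have "(1 - \<epsilon>) * n < n" using eps n0 by simp
    then have "card Q < n" using size by linarith
    then have irr: "(\<Sum>p\<in>avail Q. irregularity (insert p Q)) \<le> (A + 2 * n) * W + 1500 * n * A + 24 * n ^ 3"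
      using irregularity_step[OF mQ] by (simp add: A_def W_def)
    have "(\<Sum>p\<in>avail Q. f (Suc t) (insert p Q)) = (\<Sum>p\<in>avail Q. (irregularity (insert p Q) + C3 * n ^ 2) * R)"
      using avail_notin fQ card by (intro sum.cong refl) (simp add: f_def R_def)
    also have "\<dots> = ((\<Sum>p\<in>avail Q. irregularity (insert p Q)) + A * (C3 * n ^ 2)) * R"
      by (simp add: sum.distrib A_def flip: sum_distrib_right)
    also have "\<dots> \<le> (A * ((W + C3 * n ^ 2) * (1 + C / n))) * R"
    proof (intro mult_right_mono R)
      have "2 * n * W \<le> A * (C / n) * W"
      proof (intro mult_right_mono W0)
        have "2 * n = \<epsilon> ^ 4 * n ^ 2 / 2 * (C / n)" using eps n0 by (simp add: C_def power2_eq_square)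
        also have "\<dots> \<le> A * (C / n)" using A C n0 by (intro mult_right_mono) auto
        finally show "real (2 * n) \<le> A * (C / n)" by simp
      qed
      moreover have "1500 * n * A + 24 * n ^ 3 \<le> A * (C3 * n ^ 2 * (C / n))"
      proof -
        have "24 * n ^ 3 = (\<epsilon> ^ 4 * n ^ 2 / 2) * (48 * n / \<epsilon> ^ 4)"
          using eps by (simp add: power2_eq_square power3_eq_cube)
        also have "\<dots> \<le> A * (48 * n / \<epsilon> ^ 4)" using A eps by (intro mult_right_mono) auto
        finally have "1500 * n * A + 24 * n ^ 3 \<le> A * (C3 * n)" by (simp add: C3_def algebra_simps)
        also have "\<dots> \<le> A * (C3 * n) * C" using A0 C3 C mult_left_mono[of 1 C "A * (C3 * n)"] by simp
        also have "\<dots> = A * (C3 * n ^ 2 * (C / n))" using n0 by (simp add: power2_eq_square)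
        finally show ?thesis by simp
      qed
      ultimately show "(\<Sum>p\<in>avail Q. irregularity (insert p Q)) + A * (C3 * n ^ 2) \<le>
        A * ((W + C3 * n ^ 2) * (1 + C / n))"
        using irr by (simp add: algebra_simps)
    qed
    also have "\<dots> = card (avail Q) * f t Q" by (simp add: ft A_def)
    finally show ?thesis using A0 by (auto simp: av A_def card_gt_0_iff)
  qed
  have "measure_pmf.prob (greedy n m) {Q. card Q \<noteq> m} \<le> measure_pmf.prob (greedy n m) {Q. f m Q \<ge> 1}"
    by (intro measure_pmf.finite_measure_mono) (auto simp: f_def)
  also have "\<dots> \<le> f 0 {}" by (rule greedy_supermartingale[where f = f, OF nonneg step])
  also have "f 0 {} = C3 * (1 + C / n) ^ m / \<epsilon> ^ 8 / n"
    using n0 by (simp add: f_def irregularity_empty power2_eq_square power3_eq_cube)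
  also have "(1 + C / n) ^ m \<le> exp C"
  proof -
    have "(1 + C / n) ^ m \<le> exp (C / n) ^ m"
      using C n0 by (intro power_mono) (auto intro: exp_ge_add_one_self)
    also have "\<dots> = exp (m * (C / n))" by (rule exp_of_nat_mult[symmetric])
    also have "\<dots> \<le> exp C"
    proof -
      have "real m \<le> n" using m eps n0 by (smt (verit) mult_le_cancel_right1)
      then have "m * C \<le> n * C" using C by (intro mult_right_mono) auto
      then show ?thesis using n0 by (simp add: divide_le_eq mult.commute)
    qed
    finally show ?thesis .
  qed
  finally show ?thesis using eps C3 by (simp add: C_def C3_def divide_right_mono mult_left_mono)
qed

section \<open>The absorption algorithm\<close>

text \<open>Partial configurations are easier to handle pairwise than through intersections with lines.\<close>

fun attack :: "pos \<Rightarrow> pos \<Rightarrow> bool" where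
  "attack (x, y) (x', y') \<longleftrightarrow> x = x' \<or> y = y' \<or> x + y = x' + y' \<or> x - y = x' - y'"

lemma partial_queens_iff:
  "partial_queens n Q \<longleftrightarrow> Q \<subseteq> board n \<and> (\<forall>p\<in>Q. \<forall>q\<in>Q. p \<noteq> q \<longrightarrow> \<not> attack p q)"
proof (cases "Q \<subseteq> board n")
  case True
  then have fin: "finite Q" using finite_board finite_subset by blast
  have one: "card (Q \<inter> D) \<le> 1 \<longleftrightarrow> (\<forall>p\<in>Q \<inter> D. \<forall>q\<in>Q \<inter> D. p = q)" for D
    using fin card_le_Suc0_iff_eq[of "Q \<inter> D"] by simp
  show ?thesis
  proof
    assume pq: "partial_queens n Q"
    have "p = q" if p: "p \<in> Q" and q: "q \<in> Q" and a: "attack p q" for p q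
    proof -
      obtain x y x' y' where xy: "p = (x, y)" "q = (x', y')" by fastforce
      have b: "(x, y) \<in> board n" "(x', y') \<in> board n" using p q True xy by auto
      then have r: "x \<in> {1..int n}" "y \<in> {1..int n}" "x' \<in> {1..int n}" "y' \<in> {1..int n}"
        by (auto simp: board_def)
      consider "x = x'" | "y = y'" | "x + y = x' + y'" | "x - y = x' - y'" using a by (auto simp: xy)
      then show ?thesis
      proof cases
        case 1
        have "card (Q \<inter> board_row n x) \<le> 1" using pq r by (simp add: partial_queens_def)
        then show ?thesis using p q r 1 unfolding one xy board_row_def by blast
      next
        case 2
        have "card (Q \<inter> board_column n y) \<le> 1" using pq r by (simp add: partial_queens_def)
        then show ?thesis using p q r 2 unfolding one xy board_column_def by blast
      next
        case 3
        have "card (Q \<inter> {(x', y') \<in> board n. x' + y' = x + y}) \<le> 1"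
          using pq b unfolding partial_queens_def by force
        then show ?thesis using p q b 3 unfolding one xy by force
      next
        case 4
        have "card (Q \<inter> {(x', y') \<in> board n. x' - y' = x - y}) \<le> 1"
          using pq b unfolding partial_queens_def by force
        then show ?thesis using p q b 4 unfolding one xy by force
      qed
    qed
    then show "Q \<subseteq> board n \<and> (\<forall>p\<in>Q. \<forall>q\<in>Q. p \<noteq> q \<longrightarrow> \<not> attack p q)" using True by blast
  next
    assume "Q \<subseteq> board n \<and> (\<forall>p\<in>Q. \<forall>q\<in>Q. p \<noteq> q \<longrightarrow> \<not> attack p q)"
    then have na: "p = q" if "p \<in> Q" "q \<in> Q" "attack p q" for p q using that by blast
    have le: "card (Q \<inter> D) \<le> 1" if "\<And>p q. p \<in> D \<Longrightarrow> q \<in> D \<Longrightarrow> attack p q" for D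
      unfolding one using that na by blast
    have "card (Q \<inter> board_row n r) \<le> 1" "card (Q \<inter> board_column n r) \<le> 1" for r
      by (rule le; auto simp: board_row_def board_column_def)+
    moreover have "card (Q \<inter> D) \<le> 1" if "D \<in> diagonals n p" for D p
      using that by (intro le) (cases p; auto)
    ultimately show "partial_queens n Q"
      using True unfolding partial_queens_def by blast
  qed
qed (auto simp: partial_queens_def)

lemma partial_queens_unique:
  assumes "partial_queens n Q" "(x, y) \<in> Q" "(x', y') \<in> Q" "x = x' \<or> y = y' \<or> x + y = x' + y' \<or> x - y = x' - y'"
  shows "x = x'" and "y = y'"
proof -
  have "(x, y) = (x', y')" using assms unfolding partial_queens_iff by fastforce
  then show "x = x'" and "y = y'" by auto
qed

lemma partial_queens_inj:
  assumes "partial_queens n Q"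
  shows "inj_on fst Q" "inj_on snd Q"
  by (rule inj_onI, metis partial_queens_unique[OF assms] prod.collapse)+

lemma absorbers_iff:
  assumes "Q \<subseteq> board n" "r \<in> {1..int n}" "c \<in> {1..int n}"
  shows "(x, y) \<in> absorbers n Q r c \<longleftrightarrow> (x, y) \<in> Q \<and> r + y \<noteq> x + c \<and> r - y \<noteq> x - c \<and>
    (\<forall>(a, b)\<in>Q. a + b \<noteq> r + y \<and> a - b \<noteq> r - y \<and> a + b \<noteq> x + c \<and> a - b \<noteq> x - c)"
proof (cases "(x, y) \<in> Q")
  case True
  then have xy: "(r, y) \<in> board n" "(x, c) \<in> board n" using assms by (auto simp: board_def)
  have "diagonals n (r, y) \<inter> diagonals n (x, c) = {} \<longleftrightarrow> r + y \<noteq> x + c \<and> r - y \<noteq> x - c"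
  proof
    assume "diagonals n (r, y) \<inter> diagonals n (x, c) = {}"
    then show "r + y \<noteq> x + c \<and> r - y \<noteq> x - c" by auto
  next
    assume ne: "r + y \<noteq> x + c \<and> r - y \<noteq> x - c"
    have "(r, y) \<in> D \<Longrightarrow> D \<notin> diagonals n (x, c)" for D using ne by auto
    moreover have "(r, y) \<in> D" if "D \<in> diagonals n (r, y)" for D using that xy by auto
    ultimately show "diagonals n (r, y) \<inter> diagonals n (x, c) = {}" by blast
  qed
  moreover have "(\<forall>D \<in> diagonals n (r, y) \<union> diagonals n (x, c). Q \<inter> D = {}) \<longleftrightarrow>
     (\<forall>(a, b)\<in>Q. a + b \<noteq> r + y \<and> a - b \<noteq> r - y \<and> a + b \<noteq> x + c \<and> a - b \<noteq> x - c)"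
    using assms(1) by auto
  ultimately show ?thesis using True unfolding absorbers_def mem_Collect_eq prod.case by blast
qed (simp add: absorbers_def)

lemma empty_rows_eq: "Q \<subseteq> board n \<Longrightarrow> empty_rows n Q = {1..int n} - fst ` Q"
  by (force simp: empty_rows_def board_row_def board_def)

lemma empty_columns_eq: "Q \<subseteq> board n \<Longrightarrow> empty_columns n Q = {1..int n} - snd ` Q"
  by (force simp: empty_columns_def board_column_def board_def)

lemma card_empty_rows:
  assumes "partial_queens n Q"
  shows "card (empty_rows n Q) = n - card Q" and "card Q \<le> n"
proof -
  have Q: "Q \<subseteq> board n" using assms by (simp add: partial_queens_def)
  have c: "card (fst ` Q) = card Q" using partial_queens_inj(1)[OF assms] by (rule card_image)
  have sub: "fst ` Q \<subseteq> {1..int n}" using Q by (auto simp: board_def)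
  show "card (empty_rows n Q) = n - card Q"
    unfolding empty_rows_eq[OF Q] using sub c by (subst card_Diff_subset) (auto intro: finite_subset)
  show "card Q \<le> n" using card_mono[OF _ sub] c by simp
qed

context
  fixes n Q r c x y R
  assumes pq: "partial_queens n Q" and r: "r \<in> empty_rows n Q" and c: "c \<in> empty_columns n Q"
    and xy: "(x, y) \<in> absorbers n Q r c"
  defines "R \<equiv> (Q - {(x, y)}) \<union> {(x, c), (r, y)}"
begin

private lemma facts:
  shows "Q \<subseteq> board n" "(x, y) \<in> Q" "r + y \<noteq> x + c" "r - y \<noteq> x - c"
    "r \<in> {1..int n}" "c \<in> {1..int n}" "x \<in> {1..int n}" "y \<in> {1..int n}" "r \<noteq> x" "c \<noteq> y"
    "(a, b) \<in> Q \<Longrightarrow> a + b \<noteq> r + y \<and> a - b \<noteq> r - y \<and> a + b \<noteq> x + c \<and> a - b \<noteq> x - c \<and> a \<noteq> r \<and> b \<noteq> c"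
proof -
  show Q: "Q \<subseteq> board n" using pq by (simp add: partial_queens_def)
  show r': "r \<in> {1..int n}" "c \<in> {1..int n}" using r c by (auto simp: empty_rows_def empty_columns_def)
  note ab = absorbers_iff[OF Q r', THEN iffD1, OF xy]
  show q: "(x, y) \<in> Q" "r + y \<noteq> x + c" "r - y \<noteq> x - c" using ab by auto
  then show "x \<in> {1..int n}" "y \<in> {1..int n}" using Q by (auto simp: board_def)
  have "a \<noteq> r \<and> b \<noteq> c" if "(a, b) \<in> Q" for a b
    using r c that unfolding empty_rows_eq[OF Q] empty_columns_eq[OF Q] by force
  then show "r \<noteq> x" "c \<noteq> y"
    "(a, b) \<in> Q \<Longrightarrow> a + b \<noteq> r + y \<and> a - b \<noteq> r - y \<and> a + b \<noteq> x + c \<and> a - b \<noteq> x - c \<and> a \<noteq> r \<and> b \<noteq> c"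
    using ab q by auto
qed

lemma partial_queens_absorb: "partial_queens n R"
  unfolding partial_queens_iff
proof (intro conjI ballI impI)
  show "R \<subseteq> board n" using facts(1,5-8) unfolding R_def by (auto simp: board_def)
  fix p q assume p: "p \<in> R" and q: "q \<in> R" and ne: "p \<noteq> q"
  have sym: "attack p q \<longleftrightarrow> attack q p" for p q
    by (cases p; cases q) (simp only: attack.simps, metis)
  have old: "\<not> attack p q" if "p \<in> Q" "q \<in> Q" "p \<noteq> q" for p q
    using pq that unfolding partial_queens_iff by blast
  have new: "\<not> attack (x, c) q \<and> \<not> attack (r, y) q" if "q \<in> Q - {(x, y)}" for q
  proof -
    obtain a b where ab: "q = (a, b)" by fastforce
    have "a \<noteq> x \<and> b \<noteq> y"
      using that partial_queens_unique[OF pq, of a b x y] facts(2) unfolding ab by blast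
    moreover have "(a, b) \<in> Q" using that by (simp add: ab)
    note facts(11)[OF this]
    ultimately show ?thesis unfolding ab attack.simps by metis
  qed
  have cross: "\<not> attack (x, c) (r, y)" unfolding attack.simps using facts(3,4,9,10) by metis
  have p': "p = (x, c) \<or> p = (r, y) \<or> p \<in> Q - {(x, y)}"
    and q': "q = (x, c) \<or> q = (r, y) \<or> q \<in> Q - {(x, y)}"
    using p q unfolding R_def by blast+
  show "\<not> attack p q"
  proof (cases "p \<in> Q - {(x, y)} \<and> q \<in> Q - {(x, y)}")
    case True
    then show ?thesis using old[OF _ _ ne] by blast
  next
    case False
    then show ?thesis using p' q' ne new cross sym by metis
  qed
qed

lemma empty_lines_absorb:
  shows "empty_rows n R = empty_rows n Q - {r}" "empty_columns n R = empty_columns n Q - {c}"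
proof -
  have "R \<subseteq> board n" using partial_queens_absorb by (simp add: partial_queens_def)
  moreover have "Q = insert (x, y) (Q - {(x, y)})" using facts(2) by blast
  then have "fst ` Q = insert x (fst ` (Q - {(x, y)}))" "snd ` Q = insert y (snd ` (Q - {(x, y)}))"
    by (metis fst_conv image_insert, metis snd_conv image_insert)
  then have "fst ` R = insert r (fst ` Q)" "snd ` R = insert c (snd ` Q)"
    unfolding R_def by (simp_all add: image_Un insert_commute)
  ultimately show "empty_rows n R = empty_rows n Q - {r}" "empty_columns n R = empty_columns n Q - {c}"
    using facts(1) by (auto simp: empty_rows_eq empty_columns_eq)
qed

text \<open>An absorber \<open>(a, b)\<close> of \<open>(r', c')\<close> is lost if it is the queen \<open>(x, y)\<close> that is removed, or if one
  of the two new queens lies on a diagonal through \<open>(r', b)\<close> or \<open>(a, c')\<close>. A new queen lies on two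
  diagonals, which meet row \<open>r'\<close> in at most two cells and thus exclude at most two values of \<open>b\<close>;
  likewise at most two values of \<open>a\<close>. As \<open>a\<close> and \<open>b\<close> each determine the queen, this is a loss of at
  most \<open>1 + 2 * 4\<close> absorbers.\<close>

lemma card_lost_absorbers:
  assumes "r' \<in> {1..int n}" "c' \<in> {1..int n}"
  shows "card (absorbers n Q r' c') \<le> card (absorbers n R r' c') + 9"
proof -
  have R: "R \<subseteq> board n" using partial_queens_absorb by (simp add: partial_queens_def)
  have fin: "finite Q" "finite R" using facts(1) R finite_board finite_subset by blast+
  let ?B = "{x + c - r', r' - x + c, r + y - r', r' - r + y}"
  let ?A = "{x + c - c', x - c + c', r + y - c', r - y + c'}"
  let ?L = "{(x, y)} \<union> {q \<in> Q. snd q \<in> ?B} \<union> {q \<in> Q. fst q \<in> ?A}"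
  have "absorbers n Q r' c' \<subseteq> absorbers n R r' c' \<union> ?L"
  proof (rule subsetI, rule ccontr)
    fix q assume q: "q \<in> absorbers n Q r' c'" and nq: "q \<notin> absorbers n R r' c' \<union> ?L"
    obtain a b where ab: "q = (a, b)" by fastforce
    have old: "(a, b) \<in> Q" "r' + b \<noteq> a + c'" "r' - b \<noteq> a - c'"
      "\<And>a' b'. (a', b') \<in> Q \<Longrightarrow> a' + b' \<noteq> r' + b \<and> a' - b' \<noteq> r' - b \<and> a' + b' \<noteq> a + c' \<and> a' - b' \<noteq> a - c'"
      using q unfolding ab absorbers_iff[OF facts(1) assms] by auto
    have nB: "(a, b) \<noteq> (x, y)" "b \<notin> ?B" "a \<notin> ?A" using nq old(1) by (auto simp: ab)
    have "(a, b) \<in> absorbers n R r' c'"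
      unfolding absorbers_iff[OF R assms]
    proof (intro conjI)
      show "(a, b) \<in> R" using old(1) nB(1) by (simp add: R_def)
      have B: "b \<noteq> x + c - r'" "b \<noteq> r' - x + c" "b \<noteq> r + y - r'" "b \<noteq> r' - r + y"
        and A: "a \<noteq> x + c - c'" "a \<noteq> x - c + c'" "a \<noteq> r + y - c'" "a \<noteq> r - y + c'"
        using nB(2,3) by simp_all
      have new: "x + c \<noteq> r' + b" "x - c \<noteq> r' - b" "x + c \<noteq> a + c'" "x - c \<noteq> a - c'"
        "r + y \<noteq> r' + b" "r - y \<noteq> r' - b" "r + y \<noteq> a + c'" "r - y \<noteq> a - c'"
        subgoal using B(1) by linarith
        subgoal using B(2) by linarith
        subgoal using A(1) by linarith
        subgoal using A(2) by linarith
        subgoal using B(3) by linarith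
        subgoal using B(4) by linarith
        subgoal using A(3) by linarith
        subgoal using A(4) by linarith
        done
      show "\<forall>(a', b')\<in>R. a' + b' \<noteq> r' + b \<and> a' - b' \<noteq> r' - b \<and> a' + b' \<noteq> a + c' \<and> a' - b' \<noteq> a - c'"
      proof (intro ballI, clarify)
        fix a' b' assume "(a', b') \<in> R"
        then consider "(a', b') \<in> Q" | "a' = x" "b' = c" | "a' = r" "b' = y" unfolding R_def by blast
        then show "a' + b' \<noteq> r' + b \<and> a' - b' \<noteq> r' - b \<and> a' + b' \<noteq> a + c' \<and> a' - b' \<noteq> a - c'"
          using new old(4) by cases blast+
      qed
    qed (use old in simp_all)
    then show False using nq by (simp add: ab)
  qed
  then have "card (absorbers n Q r' c') \<le> card (absorbers n R r' c' \<union> ?L)"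
    using fin by (intro card_mono) (auto simp: absorbers_def intro: finite_subset[OF _ fin(2)])
  also have "\<dots> \<le> card (absorbers n R r' c') + (card {(x, y)} + card {q \<in> Q. snd q \<in> ?B} + card {q \<in> Q. fst q \<in> ?A})"
    by (intro order.trans[OF card_Un_le] add_mono card_Un_le order.refl)
  also have "card {q \<in> Q. snd q \<in> ?B} \<le> card ?B"
    by (rule card_inj_on_le[of snd]) (auto intro: inj_on_subset[OF partial_queens_inj(2)[OF pq]])
  also have "card {q \<in> Q. fst q \<in> ?A} \<le> card ?A"
    by (rule card_inj_on_le[of fst]) (auto intro: inj_on_subset[OF partial_queens_inj(1)[OF pq]])
  also have "card ?B \<le> 4" by (simp add: card_insert_if)
  also have "card ?A \<le> 4" by (simp add: card_insert_if)
  finally show ?thesis by simp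
qed

end

text \<open>The bound on the number of absorbers is kept along the run: every step consumes one pair of the
  matching and at most nine absorbers of every other pair.\<close>

lemma absorption_run_succeeds:
  assumes "partial_queens n Q" and "perfect_matching (empty_rows n Q) (empty_columns n Q) ms"
    and "\<And>r c. r \<in> {1..int n} \<Longrightarrow> c \<in> {1..int n} \<Longrightarrow> 9 * length ms \<le> card (absorbers n Q r c)"
    and "absorption_run n Q ms res"
  shows "\<exists>R. res = Some R \<and> queens n R"
  using assms(4,1-3)
proof (induction rule: absorption_run.induct)
  case (finish R)
  then have "empty_rows n R = {}" by (simp add: perfect_matching_def)
  then have "card R = n" using card_empty_rows[OF finish(1)] by simp
  then show ?case using finish by (simp add: queens_def)
next
  case (abort R r c ms)
  then have "r \<in> empty_rows n R" "c \<in> empty_columns n R" by (auto simp: perfect_matching_def)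
  then have "r \<in> {1..int n}" "c \<in> {1..int n}" by (auto simp: empty_rows_def empty_columns_def)
  then show ?case using abort.prems(3)[of r c] abort.hyps by simp
next
  case (absorb x y R r c ms res)
  have rc: "r \<in> empty_rows n R" "c \<in> empty_columns n R"
    using absorb.prems(2) by (auto simp: perfect_matching_def)
  note ctx = absorb.prems(1) rc absorb.hyps(1)
  show ?case
  proof (rule absorb.IH)
    show "partial_queens n (R - {(x, y)} \<union> {(x, c), (r, y)})" by (rule partial_queens_absorb[OF ctx])
    show "perfect_matching (empty_rows n (R - {(x, y)} \<union> {(x, c), (r, y)}))
      (empty_columns n (R - {(x, y)} \<union> {(x, c), (r, y)})) ms"
      unfolding empty_lines_absorb[OF ctx] using absorb.prems(2)
      unfolding perfect_matching_def by auto
    fix r' c' assume "r' \<in> {1..int n}" "c' \<in> {1..int n}"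
    then show "9 * length ms \<le> card (absorbers n (R - {(x, y)} \<union> {(x, c), (r, y)}) r' c')"
      using card_lost_absorbers[OF ctx, of r' c'] absorb.prems(3)[of r' c'] by simp
  qed
qed

lemma absorption_succeedsI:
  assumes "partial_queens n Q"
    and "\<And>r c. r \<in> {1..int n} \<Longrightarrow> c \<in> {1..int n} \<Longrightarrow> 9 * (n - card Q) \<le> card (absorbers n Q r c)"
  shows "absorption_succeeds n Q"
  unfolding absorption_succeeds_def
proof (intro allI impI)
  fix ms res
  assume ms: "perfect_matching (empty_rows n Q) (empty_columns n Q) ms" and run: "absorption_run n Q ms res"
  have "length ms = card (set (map fst ms))"
    using ms by (metis distinct_card length_map perfect_matching_def)
  also have "\<dots> = n - card Q" using ms card_empty_rows[OF assms(1)] by (simp add: perfect_matching_def)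
  finally show "\<exists>R. res = Some R \<and> queens n R"
    using absorption_run_succeeds[OF assms(1) ms _ run] assms(2) by simp
qed

section \<open>Safe queens: the potential\<close>

lemma power_add_le:
  fixes x d :: real
  assumes "0 \<le> x" "0 \<le> d"
  shows "(x + d) ^ Suc j \<le> x ^ Suc j + real (Suc j) * d * (x + d) ^ j"
proof (induction j)
  case 0
  then show ?case by simp
next
  case (Suc j)
  have "(x + d) ^ Suc (Suc j) = (x + d) ^ Suc j * x + (x + d) ^ Suc j * d" by (simp add: algebra_simps)
  also have "(x + d) ^ Suc j * x \<le> (x ^ Suc j + real (Suc j) * d * (x + d) ^ j) * x"
    using Suc assms by (intro mult_right_mono) auto
  also have "real (Suc j) * d * (x + d) ^ j * x \<le> real (Suc j) * d * (x + d) ^ j * (x + d)"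
    using assms by (intro mult_left_mono) auto
  then have "(x ^ Suc j + real (Suc j) * d * (x + d) ^ j) * x \<le>
    x ^ Suc (Suc j) + real (Suc j) * d * (x + d) ^ Suc j"
    by (simp add: algebra_simps)
  finally show ?case by (simp add: algebra_simps)
qed

text \<open>The numerical inequality behind the growth of the potential. Here \<open>x + d\<close> and \<open>x\<close> are
  the discount factors before and after a step, \<open>A\<close> counts all choices of the step, \<open>B\<close> the harmful
  and \<open>G\<close> the helpful ones. As \<open>x\<close> is small, one helpful choice outweighs many harmful ones and also
  the decrease of the discount factor. The error \<open>1\<close> is needed when \<open>x\<close> is comparable to \<open>d\<close>, that is
  in the last few steps.\<close>

lemma weight_drift:
  fixes x d A B G n :: real
  assumes x: "0 \<le> x" "x \<le> 1 / 1600" and n: "n \<ge> 1" and d: "d = 1 / (800 * n)"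
    and A: "0 \<le> A" "A \<le> n ^ 2" and B: "0 \<le> B" "B \<le> 4 * n" and G: "G \<ge> n / 50" and j: "j \<le> 3"
  shows "(A - B) * x ^ Suc j + G * (x ^ j - x ^ Suc j) \<ge> A * (x + d) ^ Suc j - 1"
proof -
  have d0: "0 \<le> d" "d \<le> 1 / 800" using n by (auto simp: d field_simps)
  have xd: "0 \<le> x + d" "x + d \<le> 1" using x d0 by auto
  have jr: "real (Suc j) \<le> 4" "real j \<le> 3" using j by auto
  have pj: "(x + d) ^ j \<le> x ^ j + 3 * d"
  proof (cases j)
    case 0
    then show ?thesis using d0 by simp
  next
    case (Suc i)
    have "real (Suc i) * d * (x + d) ^ i \<le> 3 * d * 1"
      using jr d0 xd Suc by (intro mult_mono) (auto intro: power_le_one)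
    then show ?thesis using power_add_le[OF x(1) d0(1), of i] Suc by simp
  qed
  have xj: "0 \<le> x ^ j" using x by simp
  have "A * (x + d) ^ Suc j \<le> A * x ^ Suc j + A * (real (Suc j) * d * (x + d) ^ j)"
    using mult_left_mono[OF power_add_le[OF x(1) d0(1), of j] A(1)] by (simp add: algebra_simps)
  also have "A * (real (Suc j) * d * (x + d) ^ j) \<le> n ^ 2 * (4 * d * (x ^ j + 3 * d))"
    using A jr d0 xd pj xj by (intro mult_mono) auto
  also have "\<dots> = n / 200 * x ^ j + 12 * (n * d) * (n * d)"
    using n by (simp add: d power2_eq_square field_simps)
  also have "n * d = 1 / 800" using n by (simp add: d)
  finally have 1: "A * (x + d) ^ Suc j \<le> A * x ^ Suc j + n / 200 * x ^ j + 1" by simp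
  have "B * x ^ Suc j \<le> (4 * n) * ((1 / 1600) * x ^ j)"
    using B x xj n mult_right_mono[OF x(2) xj] by (intro mult_mono) auto
  then have 2: "B * x ^ Suc j \<le> n / 400 * x ^ j" by simp
  have "n / 50 * ((1 / 2) * x ^ j) \<le> G * ((1 - x) * x ^ j)"
    using G n x xj by (intro mult_mono) (auto intro: mult_right_mono)
  then have 3: "G * (x ^ j - x ^ Suc j) \<ge> n / 100 * x ^ j" by (simp add: algebra_simps)
  have "n / 100 * x ^ j \<ge> n / 200 * x ^ j + n / 400 * x ^ j"
    using n xj by (simp add: field_simps)
  then show ?thesis using 1 2 3 by (simp add: algebra_simps)
qed

context quad_hypergraph
begin

text \<open>A test \<open>(v, D)\<close> consists of a line \<open>v\<close> and a part \<open>D\<close> of it. It is passed for good once \<open>v\<close> is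
  occupied outside of \<open>D\<close>, it is failed once \<open>D\<close> is occupied, and it is undecided while \<open>v\<close> is
  free. Every undecided test is discounted by the factor \<open>\<beta>\<close>, a lower estimate for the probability
  that it will be passed in the remaining time.\<close>

definition weight :: "real \<Rightarrow> 'e set \<Rightarrow> ('v \<times> 'e set) set \<Rightarrow> real" where
  "weight \<beta> Q S = (if \<exists>(v, D)\<in>S. Q \<inter> D \<noteq> {} then 0 else \<beta> ^ card {(v, D)\<in>S. v \<in> free Q})"

text \<open>The complement of \<open>D\<close> in the line must be long enough for the test to be passed with a fair
  chance, and distinct tests use distinct lines so that they are almost independent.\<close>

definition test_family :: "('v \<times> 'e set) set \<Rightarrow> bool" where
  "test_family S \<longleftrightarrow> finite S \<and> card S \<le> 4 \<and> inj_on fst S \<and>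
     (\<forall>(v, D)\<in>S. v \<in> V \<and> D \<subseteq> {e \<in> E. v \<in> inc e} \<and> real n / 20 \<le> real (card ({e \<in> E. v \<in> inc e} - D)))"

lemma weight_nonneg: "0 \<le> \<beta> \<Longrightarrow> 0 \<le> weight \<beta> Q S"
  by (simp add: weight_def)

lemma weight_le_1: "0 \<le> \<beta> \<Longrightarrow> \<beta> \<le> 1 \<Longrightarrow> weight \<beta> Q S \<le> 1"
  by (simp add: weight_def power_le_one)

lemma weight_unaffected:
  assumes S: "test_family S" and un: "\<And>v D. (v, D) \<in> S \<Longrightarrow> v \<notin> inc e"
    and \<beta>: "0 \<le> \<beta>" "0 \<le> d" "\<beta> + d \<le> 1"
  shows "\<bar>weight \<beta> (insert e Q) S - weight (\<beta> + d) Q S\<bar> \<le> 4 * d"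
proof -
  have "{(v, D)\<in>S. v \<in> free (insert e Q)} = {(v, D)\<in>S. v \<in> free Q}"
    using un by (auto simp: free_insert)
  moreover have "(\<exists>(v, D)\<in>S. insert e Q \<inter> D \<noteq> {}) \<longleftrightarrow> (\<exists>(v, D)\<in>S. Q \<inter> D \<noteq> {})"
  proof -
    have "insert e Q \<inter> D = Q \<inter> D" if "(v, D) \<in> S" for v D
    proof -
      have "e \<notin> D" using S un[OF that] that by (auto simp: test_family_def)
      then show ?thesis by simp
    qed
    then show ?thesis by fastforce
  qed
  moreover have "\<bar>\<beta> ^ k - (\<beta> + d) ^ k\<bar> \<le> 4 * d" if "k \<le> 4" for k
  proof (cases k)
    case (Suc j)
    have "real (Suc j) * d * (\<beta> + d) ^ j \<le> 4 * d * 1"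
      using that Suc \<beta> by (intro mult_mono) (auto intro: power_le_one)
    moreover have "\<beta> ^ k \<le> (\<beta> + d) ^ k" using \<beta> by (intro power_mono) auto
    ultimately show ?thesis using power_add_le[OF \<beta>(1,2), of j] unfolding Suc by linarith
  qed (use \<beta> in simp)
  moreover have "card {(v, D)\<in>S. v \<in> free Q} \<le> 4"
  proof -
    have "card {(v, D)\<in>S. v \<in> free Q} \<le> card S"
      using S by (intro card_mono) (auto simp: test_family_def)
    then show ?thesis using S by (simp add: test_family_def)
  qed
  ultimately show ?thesis using \<beta> by (simp add: weight_def)
qed

lemma card_unavailable_on_line:
  assumes Q: "matching Q" and v: "v \<in> free Q"
  shows "card {e \<in> E. v \<in> inc e \<and> e \<notin> avail Q} \<le> 8 * card Q"
proof -
  have fQ: "finite Q" "Q \<subseteq> E" using Q finite_E finite_subset by (auto simp: matching_def)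
  have "{e \<in> E. v \<in> inc e \<and> e \<notin> avail Q} \<subseteq> (\<Union>q\<in>Q. {a \<in> E. v \<in> inc a \<and> inc a \<inter> inc q \<noteq> {}})"
    using inc_subset by (fastforce simp: avail_def free_def)
  then have "card {e \<in> E. v \<in> inc e \<and> e \<notin> avail Q} \<le> card (\<Union>q\<in>Q. {a \<in> E. v \<in> inc a \<and> inc a \<inter> inc q \<noteq> {}})"
    using fQ finite_E by (intro card_mono) auto
  also have "\<dots> \<le> (\<Sum>q\<in>Q. card {a \<in> E. v \<in> inc a \<and> inc a \<inter> inc q \<noteq> {}})"
    using fQ by (intro card_UN_le) auto
  also have "\<dots> \<le> (\<Sum>q\<in>Q. 8)"
    using fQ v by (intro sum_mono card_meeting_line_le) (auto simp: free_def)
  finally show ?thesis by simp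
qed

text \<open>The weight is a submartingale up to a small error. If some test is undecided, fix one
  of them, on the line \<open>v0\<close>. A harmful choice occupies the forbidden part of some undecided test; there
  are at most \<open>n\<close> choices for each of the four tests. A helpful choice occupies the rest of \<open>v0\<close>
  without harm; all but few of the at least \<open>n / 20\<close> cells there are still available, because early in
  the process each queen has removed at most eight cells of a given line.\<close>

lemma weight_step:
  assumes Q: "matching Q" and size: "400 * card Q \<le> n" and n: "n \<ge> 1000" and S: "test_family S"
    and \<beta>: "0 \<le> \<beta>" "\<beta> \<le> 1 / 1600" and d: "d = 1 / (800 * real n)"
  shows "(\<Sum>e\<in>avail Q. weight \<beta> (insert e Q) S) \<ge> real (card (avail Q)) * weight (\<beta> + d) Q S - 1"
proof -
  have fS: "finite S" and cS: "card S \<le> 4" and inj: "inj_on fst S" using S by (auto simp: test_family_def)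
  have SD: "v \<in> V" "D \<subseteq> {e \<in> E. v \<in> inc e}" "real n / 20 \<le> real (card ({e \<in> E. v \<in> inc e} - D))"
    if "(v, D) \<in> S" for v D
    using S that by (auto simp: test_family_def)
  have \<beta>1: "\<beta> \<le> 1" using \<beta> by simp
  define A where "A = real (card (avail Q))"
  define F where "F = {(v, D)\<in>S. v \<in> free Q}"
  have F: "finite F" "F \<subseteq> S" "card F \<le> 4"
  proof -
    show sub: "F \<subseteq> S" by (auto simp: F_def)
    then show "finite F" using fS finite_subset by blast
    show "card F \<le> 4" using card_mono[OF fS sub] cS by simp
  qed
  have nohit_occupied: "e \<notin> D" if "e \<in> avail Q" "(v, D) \<in> S" "v \<notin> free Q" for e v D
    using that SD(2)[OF that(2)] by (auto simp: avail_def)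
  have sub: "{(v, D)\<in>S. v \<in> free (insert e Q)} \<subseteq> F" for e
    by (auto simp: F_def free_insert)
  show ?thesis
  proof (cases "\<exists>(v, D)\<in>S. Q \<inter> D \<noteq> {}")
    case True
    then have "weight (\<beta> + d) Q S = 0" by (simp add: weight_def)
    moreover have "(\<Sum>e\<in>avail Q. weight \<beta> (insert e Q) S) \<ge> 0"
      using weight_nonneg[OF \<beta>(1)] by (intro sum_nonneg) auto
    ultimately show ?thesis by simp
  next
    case False
    then have nohit: "Q \<inter> D = {}" if "(v, D) \<in> S" for v D using that by blast
    have wQ: "weight (\<beta> + d) Q S = (\<beta> + d) ^ card F" using False by (simp add: weight_def F_def)
    define Bad where "Bad = {e \<in> avail Q. \<exists>(v, D)\<in>F. e \<in> D}"
    have w: "weight \<beta> (insert e Q) S = \<beta> ^ card {(v, D)\<in>S. v \<in> free (insert e Q)}"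
      if e: "e \<in> avail Q - Bad" for e
    proof -
      have "e \<notin> D" if vD: "(v, D) \<in> S" for v D
      proof (cases "v \<in> free Q")
        case True
        then have "(v, D) \<in> F" using vD by (simp add: F_def)
        then show ?thesis using e by (auto simp: Bad_def)
      next
        case False
        then show ?thesis using e vD nohit_occupied by blast
      qed
      then have "insert e Q \<inter> D = {}" if "(v, D) \<in> S" for v D using that nohit by auto
      then have "\<not> (\<exists>(v, D)\<in>S. insert e Q \<inter> D \<noteq> {})" by blast
      then show ?thesis by (simp add: weight_def)
    qed
    show ?thesis
    proof (cases "F = {}")
      case True
      have "weight \<beta> (insert e Q) S = 1" if "e \<in> avail Q" for e
      proof -
        have "e \<in> avail Q - Bad" using that True by (simp add: Bad_def)
        then have "weight \<beta> (insert e Q) S = \<beta> ^ card {(v, D)\<in>S. v \<in> free (insert e Q)}" by (rule w)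
        also have "{(v, D)\<in>S. v \<in> free (insert e Q)} = {}" using sub[of e] True by blast
        finally show ?thesis by simp
      qed
      then have "(\<Sum>e\<in>avail Q. weight \<beta> (insert e Q) S) = A" by (simp add: A_def)
      then show ?thesis by (simp add: wQ True A_def)
    next
      case False
      then obtain v0 D0 where v0: "(v0, D0) \<in> F" by auto
      define j where "j = card F - 1"
      have j: "card F = Suc j" "j \<le> 3" using F False by (auto simp: j_def card_gt_0_iff Suc_diff_Suc)
      define Good where "Good = {e \<in> avail Q - Bad. v0 \<in> inc e}"
      have v0S: "(v0, D0) \<in> S" "v0 \<in> free Q" using v0 by (auto simp: F_def)
      have cBad: "card Bad \<le> 4 * n"
      proof -
        have "card Bad \<le> card (\<Union>(v, D)\<in>F. {e \<in> E. v \<in> inc e})"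
          using F SD(2) finite_E by (intro card_mono) (fastforce simp: Bad_def)+
        also have "\<dots> \<le> (\<Sum>(v, D)\<in>F. card {e \<in> E. v \<in> inc e})"
          using card_UN_le[OF F(1), of "\<lambda>(v, D). {e \<in> E. v \<in> inc e}"] by (simp add: case_prod_unfold)
        also have "\<dots> = (\<Sum>(v, D)\<in>F. n)"
          using F SD(1) by (intro sum.cong) (auto simp: degree)
        also have "\<dots> = card F * n" by (simp add: case_prod_unfold)
        also have "\<dots> \<le> 4 * n" using F(3) by (intro mult_right_mono) auto
        finally show ?thesis .
      qed
      have cGood: "real (card Good) \<ge> real n / 50"
      proof -
        let ?X = "{e \<in> E. v0 \<in> inc e \<and> e \<notin> avail Q}"
        let ?Y = "\<Union>(v, D)\<in>F - {(v0, D0)}. {e \<in> E. v0 \<in> inc e \<and> v \<in> inc e}"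
        have "{e \<in> E. v0 \<in> inc e} - D0 \<subseteq> Good \<union> (?X \<union> ?Y)"
        proof
          fix e assume e: "e \<in> {e \<in> E. v0 \<in> inc e} - D0"
          show "e \<in> Good \<union> (?X \<union> ?Y)"
          proof (cases "e \<in> Bad")
            case True
            then obtain v D where vD: "(v, D) \<in> F" "e \<in> D" by (auto simp: Bad_def)
            then have "(v, D) \<noteq> (v0, D0)" using e by auto
            moreover have "v \<in> inc e" using vD SD(2)[of v D] F by auto
            ultimately show ?thesis using vD e by blast
          next
            case False
            then show ?thesis using e by (auto simp: Good_def)
          qed
        qed
        then have "card ({e \<in> E. v0 \<in> inc e} - D0) \<le> card (Good \<union> (?X \<union> ?Y))"
          using F finite_E by (intro card_mono) (auto simp: Good_def)
        also have "\<dots> \<le> card Good + (card ?X + card ?Y)"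
          by (intro order.trans[OF card_Un_le] add_mono card_Un_le order.refl)
        also have "card ?X \<le> 8 * card Q" by (rule card_unavailable_on_line[OF Q v0S(2)])
        also have "card ?Y \<le> (\<Sum>(v, D)\<in>F - {(v0, D0)}. card {e \<in> E. v0 \<in> inc e \<and> v \<in> inc e})"
          using card_UN_le[of "F - {(v0, D0)}" "\<lambda>(v, D). {e \<in> E. v0 \<in> inc e \<and> v \<in> inc e}"] F(1)
          by (simp add: case_prod_unfold)
        also have "\<dots> \<le> (\<Sum>(v, D)\<in>F - {(v0, D0)}. 2)"
        proof (rule sum_mono)
          fix p assume p: "p \<in> F - {(v0, D0)}"
          obtain v D where pv: "p = (v, D)" by fastforce
          have vD: "(v, D) \<in> F" "(v, D) \<noteq> (v0, D0)" using p pv by auto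
          have vS: "(v, D) \<in> S" using vD F by auto
          then have "v \<noteq> v0" using inj_onD[OF inj _ vS v0S(1)] vD(2) by auto
          then show "(case p of (v, D) \<Rightarrow> card {e \<in> E. v0 \<in> inc e \<and> v \<in> inc e}) \<le> (case p of (v, D) \<Rightarrow> 2)"
            using SD(1)[OF vS] SD(1)[OF v0S(1)] codegree by (simp add: pv)
        qed
        also have "\<dots> \<le> 2 * card F" using F by (simp add: case_prod_unfold card_mono)
        also have "2 * card F \<le> 8" using F by simp
        finally have "real (card ({e \<in> E. v0 \<in> inc e} - D0)) \<le> real (card Good + (8 * card Q + 8))"
          by linarith
        then have "real n / 20 \<le> real (card Good) + (8 * real (card Q) + 8)"
          using SD(3)[OF v0S(1)] by simp
        moreover have "400 * real (card Q) \<le> n" using size by linarith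
        moreover have "real n \<ge> 1000" using n by linarith
        ultimately show ?thesis by linarith
      qed
      have A: "0 \<le> A" "A \<le> real n ^ 2"
      proof -
        have "4 * A = (\<Sum>v\<in>free Q. real (deg Q v))" using sum_deg[of Q] by (simp add: A_def)
        also have "\<dots> \<le> (\<Sum>v\<in>free Q. real n)" using deg_le by (intro sum_mono) auto
        also have "\<dots> = real (card (free Q)) * n" by simp
        also have "\<dots> \<le> real (4 * n) * n"
          using card_free[OF Q] by (intro mult_right_mono of_nat_mono) auto
        finally show "A \<le> real n ^ 2" by (simp add: power2_eq_square)
      qed (simp add: A_def)
      have "A * (\<beta> + d) ^ Suc j - 1 \<le> (A - card Bad) * \<beta> ^ Suc j + card Good * (\<beta> ^ j - \<beta> ^ Suc j)"
        using weight_drift[OF \<beta> _ d A _ _ cGood j(2), of "card Bad"] n cBad by simp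
      also have "\<dots> = (\<Sum>e\<in>avail Q - Bad. \<beta> ^ Suc j + (if e \<in> Good then \<beta> ^ j - \<beta> ^ Suc j else 0))"
      proof -
        have "Bad \<subseteq> avail Q" by (auto simp: Bad_def)
        then have "real (card (avail Q - Bad)) = A - card Bad"
          by (simp add: card_Diff_subset finite_subset[of Bad "avail Q"] of_nat_diff card_mono A_def)
        moreover have "(avail Q - Bad) \<inter> Good = Good" by (auto simp: Good_def)
        ultimately show ?thesis by (simp add: sum.distrib sum.If_cases)
      qed
      also have "\<dots> \<le> (\<Sum>e\<in>avail Q - Bad. weight \<beta> (insert e Q) S)"
      proof (rule sum_mono)
        fix e assume e: "e \<in> avail Q - Bad"
        have "card {(v, D)\<in>S. v \<in> free (insert e Q)} \<le> (if e \<in> Good then j else Suc j)"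
        proof (cases "e \<in> Good")
          case True
          then have "{(v, D)\<in>S. v \<in> free (insert e Q)} \<subseteq> F - {(v0, D0)}"
            using sub[of e] by (auto simp: Good_def free_insert)
          then have "card {(v, D)\<in>S. v \<in> free (insert e Q)} \<le> card (F - {(v0, D0)})"
            using F by (intro card_mono) auto
          then show ?thesis using True v0 F j by simp
        next
          case False
          then show ?thesis using card_mono[OF F(1) sub[of e]] j by simp
        qed
        then have "\<beta> ^ (if e \<in> Good then j else Suc j) \<le> \<beta> ^ card {(v, D)\<in>S. v \<in> free (insert e Q)}"
          using \<beta> \<beta>1 by (intro power_decreasing)
        then show "\<beta> ^ Suc j + (if e \<in> Good then \<beta> ^ j - \<beta> ^ Suc j else 0) \<le> weight \<beta> (insert e Q) S"
          using w[OF e] by (simp split: if_splits)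
      qed
      also have "\<dots> \<le> (\<Sum>e\<in>avail Q. weight \<beta> (insert e Q) S)"
        using weight_nonneg[OF \<beta>(1)] by (intro sum_mono2) auto
      finally show ?thesis by (simp add: wQ j A_def)
    qed
  qed
qed

end

section \<open>Safe queens: the tests on the board\<close>

definition antidiagonal :: "nat \<Rightarrow> int \<Rightarrow> pos set" where
  "antidiagonal n s = {(a, b) \<in> board n. a + b = s}"

definition diagonal :: "nat \<Rightarrow> int \<Rightarrow> pos set" where
  "diagonal n s = {(a, b) \<in> board n. a - b = s}"

lemma card_antidiagonal_le:
  assumes "2 \<le> s" "s \<le> 2 * int n"
  shows "int (card (antidiagonal n s)) \<le> int n - \<bar>s - int n - 1\<bar>"
proof -
  have "card (antidiagonal n s) \<le> card {max 1 (s - int n)..min (int n) (s - 1)}"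
  proof (rule card_inj_on_le)
    show "inj_on fst (antidiagonal n s)" by (force simp: inj_on_def antidiagonal_def)
    show "fst ` antidiagonal n s \<subseteq> {max 1 (s - int n)..min (int n) (s - 1)}" by (auto simp: antidiagonal_def board_def)
  qed simp
  then show ?thesis using assms unfolding card_atLeastAtMost_int by linarith
qed

lemma card_diagonal_le:
  assumes "\<bar>s\<bar> \<le> int n"
  shows "int (card (diagonal n s)) \<le> int n - \<bar>s\<bar>"
proof -
  have "card (diagonal n s) \<le> card {max 1 (1 + s)..min (int n) (int n + s)}"
  proof (rule card_inj_on_le)
    show "inj_on fst (diagonal n s)" by (force simp: inj_on_def diagonal_def)
    show "fst ` diagonal n s \<subseteq> {max 1 (1 + s)..min (int n) (int n + s)}" by (auto simp: diagonal_def board_def)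
  qed simp
  then show ?thesis using assms unfolding card_atLeastAtMost_int by linarith
qed

lemma card_near: "real (card {z \<in> A. \<not> int n \<le> 20 * \<bar>z - u\<bar>}) \<le> n / 10 + 1"
proof -
  define k where "k = n div 20"
  have k: "n < 20 * k + 20" "20 * k \<le> n" unfolding k_def by linarith+
  then have kI: "int n < 20 * int k + 20" by linarith
  have "{z \<in> A. \<not> int n \<le> 20 * \<bar>z - u\<bar>} \<subseteq> {u - int k..u + int k}"
  proof
    fix z assume "z \<in> {z \<in> A. \<not> int n \<le> 20 * \<bar>z - u\<bar>}"
    then have z: "20 * \<bar>z - u\<bar> < int n" by simp
    define a where "a = \<bar>z - u\<bar>"
    have "20 * a < int n" using z by (simp add: a_def)
    then have "20 * a < 20 * (int k + 1)" using kI by simp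
    then have "\<bar>z - u\<bar> \<le> int k" by (simp add: a_def)
    then show "z \<in> {u - int k..u + int k}" unfolding atLeastAtMost_iff by linarith
  qed
  then have "card {z \<in> A. \<not> int n \<le> 20 * \<bar>z - u\<bar>} \<le> card {u - int k..u + int k}"
    by (intro card_mono) simp
  also have "\<dots> = 2 * k + 1" by simp
  finally show ?thesis using k by linarith
qed

lemma card_congruent:
  assumes "finite Q"
  shows "card {z \<in> {1..int n}. \<exists>q\<in>Q. z mod int n = g q mod int n} \<le> card Q"
proof -
  define M where "M = {z \<in> {1..int n}. \<exists>q\<in>Q. z mod int n = g q mod int n}"
  define h where "h z = (SOME q. q \<in> Q \<and> z mod int n = g q mod int n)" for z
  have h: "h z \<in> Q \<and> z mod int n = g (h z) mod int n" if "z \<in> M" for z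
    unfolding h_def by (rule someI_ex) (use that in \<open>auto simp: M_def\<close>)
  have "inj_on h M"
  proof (rule inj_onI)
    fix z z' assume z: "z \<in> M" "z' \<in> M" and eq: "h z = h z'"
    have "z mod int n = z' mod int n" using h[OF z(1)] h[OF z(2)] unfolding eq by simp
    moreover have "z \<in> {1..int n}" "z' \<in> {1..int n}" using z unfolding M_def by blast+
    ultimately show "z = z'" using residue_unique by simp
  qed
  moreover have "h ` M \<subseteq> Q" using h by blast
  ultimately have "card M \<le> card Q" using assms by (rule card_inj_on_le)
  then show ?thesis by (simp only: M_def)
qed
text \<open>The rows and columns in which a queen would fail one of the requirements below fall into five
  types, each of which is counted separately.\<close>

lemma card_exceptional:
  fixes g\<^sub>1 g\<^sub>2 :: "'a \<Rightarrow> int"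
  assumes "finite Q"
  shows "real (card {z \<in> {1..int n}. \<not> int n \<le> 20 * \<bar>z - u\<^sub>1\<bar> \<or> \<not> int n \<le> 20 * \<bar>z - u\<^sub>2\<bar> \<or> z = w
     \<or> (\<exists>q\<in>Q. z mod int n = g\<^sub>1 q mod int n) \<or> (\<exists>q\<in>Q. z mod int n = g\<^sub>2 q mod int n)})
    \<le> n / 5 + 3 + 2 * card Q" (is "real (card ?Z) \<le> _")
proof -
  let ?I = "\<lambda>u. {z \<in> {1..int n}. \<not> int n \<le> 20 * \<bar>z - u\<bar>}"
  let ?M = "\<lambda>g. {z \<in> {1..int n}. \<exists>q\<in>Q. z mod int n = g q mod int n}"
  have "?Z \<subseteq> ?I u\<^sub>1 \<union> (?I u\<^sub>2 \<union> ({w} \<union> (?M g\<^sub>1 \<union> ?M g\<^sub>2)))" by blast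
  moreover have "finite {z \<in> {1..int n}. P z}" for P
    by (rule finite_subset[of _ "{1..int n}"]) auto
  ultimately have "card ?Z \<le> card (?I u\<^sub>1 \<union> (?I u\<^sub>2 \<union> ({w} \<union> (?M g\<^sub>1 \<union> ?M g\<^sub>2))))"
    by (intro card_mono finite_UnI finite.insertI finite.emptyI)
  also have "\<dots> \<le> card (?I u\<^sub>1) + (card (?I u\<^sub>2) + (card {w} + (card (?M g\<^sub>1) + card (?M g\<^sub>2))))"
    by (intro order.trans[OF card_Un_le] add_mono card_Un_le order.refl)
  also have "card {w} = 1" by simp
  finally have "real (card ?Z) \<le> real (card (?I u\<^sub>1)) + real (card (?I u\<^sub>2)) + 1 + real (card (?M g\<^sub>1)) + real (card (?M g\<^sub>2))"
    by linarith
  also have "\<dots> \<le> (n / 10 + 1) + (n / 10 + 1) + 1 + card Q + card Q"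
    by (intro add_mono of_nat_mono order.refl card_near card_congruent assms)
  finally show ?thesis by simp
qed

lemma complement_large:
  assumes "int k \<le> int n - a" "int n \<le> 20 * a"
  shows "real n / 20 \<le> real (n - k)"
proof -
  have "int (20 * k + n) \<le> int (20 * n)" using assms by simp
  then have "20 * k + n \<le> 20 * n" by (simp only: of_nat_le_iff)
  then have "n \<le> 20 * (n - k)" by linarith
  then have "real n \<le> real (20 * (n - k))" by (rule of_nat_mono)
  then show ?thesis by simp
qed

locale board_cell =
  fixes n :: nat and r c :: int
  assumes large: "1000 \<le> n" and r: "r \<in> {1..int n}" and c: "c \<in> {1..int n}"
begin

lemma n_positive: "n > 0" using large by simp

sublocale quad_hypergraph "board n" "{0..3} \<times> {0..<int n}" "lines n" n
  by (rule torus_hypergraph[OF n_positive])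

text \<open>The four diagonals that have to stay empty for \<open>(x, y)\<close> to be an absorber of \<open>(r, c)\<close>, each paired
  with the toroidal diagonal that contains it.\<close>

fun tests :: "pos \<Rightarrow> ((nat \<times> int) \<times> pos set) set" where
  "tests (x, y) =
    {((2, (r + y) mod int n), antidiagonal n (r + y)), ((3, (r - y) mod int n), diagonal n (r - y)),
     ((2, (x + c) mod int n), antidiagonal n (x + c)), ((3, (x - c) mod int n), diagonal n (x - c))}"

text \<open>The congruences ensure that the four toroidal diagonals of \<open>tests (x, y)\<close> are distinct, the
  inequations \<open>x \<noteq> r\<close> and \<open>y \<noteq> c\<close> that the queen \<open>(x, y)\<close> itself is on none of them, and the inequalities
  that the complementary part of each toroidal diagonal has at least \<open>n / 20\<close> cells.\<close>

definition eligible :: "pos set" where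
  "eligible = {(x, y) \<in> board n. x \<noteq> r \<and> y \<noteq> c \<and>
     (x - y) mod int n \<noteq> (r - c) mod int n \<and> (x + y) mod int n \<noteq> (r + c) mod int n \<and>
     int n \<le> 20 * \<bar>y - (int n + 1 - r)\<bar> \<and> int n \<le> 20 * \<bar>y - r\<bar> \<and>
     int n \<le> 20 * \<bar>x - (int n + 1 - c)\<bar> \<and> int n \<le> 20 * \<bar>x - c\<bar>}"

lemma antidiagonal_test:
  assumes "2 \<le> s" "s \<le> 2 * int n" "int n \<le> 20 * \<bar>s - int n - 1\<bar>"
  defines "v \<equiv> (2, s mod int n)"
  shows "v \<in> {0..3} \<times> {0..<int n} \<and> antidiagonal n s \<subseteq> {e \<in> board n. v \<in> lines n e} \<and>
    real n / 20 \<le> real (card ({e \<in> board n. v \<in> lines n e} - antidiagonal n s))"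
proof (intro conjI)
  show v: "v \<in> {0..3} \<times> {0..<int n}" using n_positive by (simp add: v_def)
  show sub: "antidiagonal n s \<subseteq> {e \<in> board n. v \<in> lines n e}" by (auto simp: antidiagonal_def v_def)
  have "card ({e \<in> board n. v \<in> lines n e} - antidiagonal n s) = n - card (antidiagonal n s)"
    using sub degree[OF v] by (subst card_Diff_subset) (auto intro: finite_subset[OF _ finite_board])
  then show "real n / 20 \<le> real (card ({e \<in> board n. v \<in> lines n e} - antidiagonal n s))"
    using complement_large[OF card_antidiagonal_le[OF assms(1,2)] assms(3)] by simp
qed

lemma diagonal_test:
  assumes "\<bar>s\<bar> \<le> int n" "int n \<le> 20 * \<bar>s\<bar>"
  defines "v \<equiv> (3, s mod int n)"
  shows "v \<in> {0..3} \<times> {0..<int n} \<and> diagonal n s \<subseteq> {e \<in> board n. v \<in> lines n e} \<and>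
    real n / 20 \<le> real (card ({e \<in> board n. v \<in> lines n e} - diagonal n s))"
proof (intro conjI)
  show v: "v \<in> {0..3} \<times> {0..<int n}" using n_positive by (simp add: v_def)
  show sub: "diagonal n s \<subseteq> {e \<in> board n. v \<in> lines n e}" by (auto simp: diagonal_def v_def)
  have "card ({e \<in> board n. v \<in> lines n e} - diagonal n s) = n - card (diagonal n s)"
    using sub degree[OF v] by (subst card_Diff_subset) (auto intro: finite_subset[OF _ finite_board])
  then show "real n / 20 \<le> real (card ({e \<in> board n. v \<in> lines n e} - diagonal n s))"
    using complement_large[OF card_diagonal_le[OF assms(1)] assms(2)] by simp
qed

lemma mod_transfer:
  "(x - y) mod int n = (r - c) mod int n \<longleftrightarrow> (r + y) mod int n = (x + c) mod int n"
  "(x + y) mod int n = (r + c) mod int n \<longleftrightarrow> (r - y) mod int n = (x - c) mod int n"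
proof -
  have eq: "x - y - (r - c) = - ((r + y) - (x + c))" "x + y - (r + c) = - ((r - y) - (x - c))" by auto
  show "(x - y) mod int n = (r - c) mod int n \<longleftrightarrow> (r + y) mod int n = (x + c) mod int n"
    "(x + y) mod int n = (r + c) mod int n \<longleftrightarrow> (r - y) mod int n = (x - c) mod int n"
    unfolding mod_eq_dvd_iff eq by (simp_all only: dvd_minus_iff)
qed

lemma test_family_tests:
  assumes "q \<in> eligible"
  shows "test_family (tests q)"
proof -
  obtain x y where q: "q = (x, y)" by fastforce
  have el: "(x, y) \<in> board n" "(x - y) mod int n \<noteq> (r - c) mod int n" "(x + y) mod int n \<noteq> (r + c) mod int n"
     "int n \<le> 20 * \<bar>y - (int n + 1 - r)\<bar>" "int n \<le> 20 * \<bar>y - r\<bar>"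
     "int n \<le> 20 * \<bar>x - (int n + 1 - c)\<bar>" "int n \<le> 20 * \<bar>x - c\<bar>"
    using assms unfolding q eligible_def by blast+
  then have xy: "x \<in> {1..int n}" "y \<in> {1..int n}" by (simp_all add: board_def)
  have "r + y - int n - 1 = y - (int n + 1 - r)" "x + c - int n - 1 = x - (int n + 1 - c)" by simp_all
  then have e: "(r + y) mod int n \<noteq> (x + c) mod int n" "(r - y) mod int n \<noteq> (x - c) mod int n"
     "int n \<le> 20 * \<bar>r + y - int n - 1\<bar>" "int n \<le> 20 * \<bar>r - y\<bar>"
     "int n \<le> 20 * \<bar>x + c - int n - 1\<bar>" "int n \<le> 20 * \<bar>x - c\<bar>"
    using el(2-7) by (simp_all only: mod_transfer abs_minus_commute[of r] not_False_eq_True)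
  have 1: "2 \<le> r + y" "r + y \<le> 2 * int n" "2 \<le> x + c" "x + c \<le> 2 * int n" "\<bar>r - y\<bar> \<le> int n" "\<bar>x - c\<bar> \<le> int n"
    using xy r c by auto
  note t = antidiagonal_test[OF 1(1,2) e(3)] antidiagonal_test[OF 1(3,4) e(5)]
     diagonal_test[OF 1(5) e(4)] diagonal_test[OF 1(6) e(6)]
  have "\<forall>(v, D)\<in>tests q. v \<in> {0..3} \<times> {0..<int n} \<and> D \<subseteq> {e \<in> board n. v \<in> lines n e} \<and>
      real n / 20 \<le> real (card ({e \<in> board n. v \<in> lines n e} - D))"
    unfolding q tests.simps ball_simps prod.case using t by blast
  moreover have "card (tests q) \<le> 4" unfolding q tests.simps by (simp add: card_insert_if)
  moreover have "inj_on fst (tests q)" unfolding q tests.simps using e(1,2) by (simp add: inj_on_def)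
  moreover have "finite (tests q)" by (simp add: q)
  ultimately show ?thesis unfolding test_family_def by blast
qed

lemma mod_add_cancel: "(x + y) mod int n = (x + y') mod int n \<longleftrightarrow> y mod int n = y' mod int n"
  "(y + x) mod int n = (y' + x) mod int n \<longleftrightarrow> y mod int n = y' mod int n"
  "(x - y) mod int n = (x - y') mod int n \<longleftrightarrow> y mod int n = y' mod int n"
  "(y - x) mod int n = (y' - x) mod int n \<longleftrightarrow> y mod int n = y' mod int n"
proof -
  have eq: "(x + y) - (x + y') = y - y'" "(y + x) - (y' + x) = y - y'"
    "(x - y) - (x - y') = - (y - y')" "(y - x) - (y' - x) = y - y'" by auto
  show "(x + y) mod int n = (x + y') mod int n \<longleftrightarrow> y mod int n = y' mod int n"
    "(y + x) mod int n = (y' + x) mod int n \<longleftrightarrow> y mod int n = y' mod int n"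
    "(x - y) mod int n = (x - y') mod int n \<longleftrightarrow> y mod int n = y' mod int n"
    "(y - x) mod int n = (y' - x) mod int n \<longleftrightarrow> y mod int n = y' mod int n"
    unfolding mod_eq_dvd_iff eq by (simp_all only: dvd_minus_iff)
qed

lemma own_tests:
  assumes "q \<in> eligible" "(v, D) \<in> tests q"
  shows "v \<notin> lines n q"
proof -
  obtain x y where q: "q = (x, y)" by fastforce
  have "x mod int n \<noteq> r mod int n" "y mod int n \<noteq> c mod int n"
    using assms(1) residue_unique[of x n r] residue_unique[of y n c] r c
    by (auto simp: q eligible_def board_def)
  then show ?thesis using assms(2) by (auto simp: q mod_add_cancel)
qed

text \<open>Each of the two toroidal diagonals through \<open>e\<close> meets row \<open>r\<close> and column \<open>c\<close> in one cell of the
  torus, and thereby determines the column or the row of the queen whose test it affects.\<close>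

lemma card_affected:
  assumes Q: "matching Q"
  shows "card {q \<in> Q. \<exists>(v, D)\<in>tests q. v \<in> lines n e} \<le> 4"
proof -
  obtain a b where e: "e = (a, b)" by fastforce
  have sub: "Q \<subseteq> board n" using Q by (simp add: matching_def)
  then have fin: "finite Q" using finite_subset finite_board by blast
  have dis: "p = q" if "p \<in> Q" "q \<in> Q" "lines n p \<inter> lines n q \<noteq> {}" for p q
    using Q that by (auto simp: matching_def)
  have row: "card {q \<in> Q. f q} \<le> 1" if "\<And>x y x' y'. f (x, y) \<Longrightarrow> f (x', y') \<Longrightarrow> x mod int n = x' mod int n \<or> y mod int n = y' mod int n" for f
  proof -
    have "p = q" if "p \<in> {q \<in> Q. f q}" "q \<in> {q \<in> Q. f q}" for p q
    proof -
      obtain x y x' y' where pq: "p = (x, y)" "q = (x', y')" by fastforce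
      then have "x mod int n = x' mod int n \<or> y mod int n = y' mod int n"
        using that \<open>\<And>x y x' y'. f (x, y) \<Longrightarrow> f (x', y') \<Longrightarrow> _\<close>[of x y x' y'] by blast
      then have "lines n p \<inter> lines n q \<noteq> {}" by (auto simp: pq)
      then show ?thesis using that dis by blast
    qed
    then show ?thesis using fin card_le_Suc0_iff_eq[of "{q \<in> Q. f q}"] by auto
  qed
  let ?f1 = "\<lambda>(x, y). (a + b) mod int n = (r + y) mod int n"
  let ?f2 = "\<lambda>(x, y). (a - b) mod int n = (r - y) mod int n"
  let ?f3 = "\<lambda>(x, y). (a + b) mod int n = (x + c) mod int n"
  let ?f4 = "\<lambda>(x, y). (a - b) mod int n = (x - c) mod int n"
  have "{q \<in> Q. \<exists>(v, D)\<in>tests q. v \<in> lines n e} \<subseteq>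
     {q \<in> Q. ?f1 q} \<union> ({q \<in> Q. ?f2 q} \<union> ({q \<in> Q. ?f3 q} \<union> {q \<in> Q. ?f4 q}))"
    by (auto simp: e)
  then have "card {q \<in> Q. \<exists>(v, D)\<in>tests q. v \<in> lines n e} \<le>
     card ({q \<in> Q. ?f1 q} \<union> ({q \<in> Q. ?f2 q} \<union> ({q \<in> Q. ?f3 q} \<union> {q \<in> Q. ?f4 q})))"
    using fin by (intro card_mono) auto
  also have "\<dots> \<le> card {q \<in> Q. ?f1 q} + (card {q \<in> Q. ?f2 q} + (card {q \<in> Q. ?f3 q} + card {q \<in> Q. ?f4 q}))"
    by (intro order.trans[OF card_Un_le] add_mono card_Un_le order.refl)
  also have "\<dots> \<le> 1 + (1 + (1 + 1))"
    by (intro add_mono row) (simp_all add: mod_add_cancel)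
  finally show ?thesis by simp
qed

text \<open>Choosing one of these cells creates a queen all of whose tests are undecided.\<close>

definition fresh :: "pos set \<Rightarrow> pos set" where
  "fresh Q = {e \<in> avail Q \<inter> eligible. \<forall>(v, D)\<in>tests e. v \<in> free Q}"

lemma many_fresh:
  assumes Q: "matching Q" and size: "400 * card Q \<le> n"
  shows "real (card (fresh Q)) \<ge> real n ^ 2 / 2"
proof -
  have sub: "Q \<subseteq> board n" using Q by (simp add: matching_def)
  then have fin: "finite Q" using finite_subset finite_board by blast
  let ?N = "{1..int n}"
  define X where "X = {z \<in> ?N. \<not> int n \<le> 20 * \<bar>z - (int n + 1 - c)\<bar> \<or> \<not> int n \<le> 20 * \<bar>z - c\<bar> \<or> z = r
     \<or> (\<exists>q\<in>Q. z mod int n = (case q of (a, b) \<Rightarrow> a + b - c) mod int n) \<or> (\<exists>q\<in>Q. z mod int n = (case q of (a, b) \<Rightarrow> a - b + c) mod int n)}"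
  define Y where "Y = {z \<in> ?N. \<not> int n \<le> 20 * \<bar>z - (int n + 1 - r)\<bar> \<or> \<not> int n \<le> 20 * \<bar>z - r\<bar> \<or> z = c
     \<or> (\<exists>q\<in>Q. z mod int n = (case q of (a, b) \<Rightarrow> a + b - r) mod int n) \<or> (\<exists>q\<in>Q. z mod int n = (case q of (a, b) \<Rightarrow> r - a + b) mod int n)}"
  have XY: "real (card X) \<le> n / 5 + 3 + 2 * card Q" "real (card Y) \<le> n / 5 + 3 + 2 * card Q"
    unfolding X_def Y_def by (rule card_exceptional[OF fin])+
  have finXY: "finite X" "finite Y"
    by (rule finite_subset[of _ ?N]; auto simp: X_def Y_def)+
  let ?L = "\<lambda>v. {e \<in> board n. v \<in> lines n e}"
  let ?U = "\<Union>q\<in>Q. \<Union>v\<in>lines n q. ?L v"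
  let ?l1 = "(3, (r - c) mod int n)" and ?l2 = "(2, (r + c) mod int n)"
  have cL: "card (?L v) = n" if "v \<in> {0..3} \<times> {0..<int n}" for v using degree[OF that] .
  have "board n \<subseteq> fresh Q \<union> (X \<times> ?N \<union> (?N \<times> Y \<union> (?L ?l1 \<union> (?L ?l2 \<union> ?U))))"
  proof
    fix e assume e: "e \<in> board n"
    obtain x y where xy: "e = (x, y)" by fastforce
    have N: "x \<in> ?N" "y \<in> ?N" using e by (auto simp: xy board_def)
    show "e \<in> fresh Q \<union> (X \<times> ?N \<union> (?N \<times> Y \<union> (?L ?l1 \<union> (?L ?l2 \<union> ?U))))"
    proof (rule ccontr)
      assume no: "\<not> ?thesis"
      then have x: "x \<notin> X" and y: "y \<notin> Y" and l: "?l1 \<notin> lines n e" "?l2 \<notin> lines n e" and u: "e \<notin> ?U"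
        using N e xy by blast+
      have "e \<in> avail Q" using u e inc_subset[OF e] by (auto simp: avail_def free_def)
      moreover have "e \<in> eligible"
        using x y l N e unfolding X_def Y_def eligible_def xy by auto
      moreover have "v \<in> free Q" if vD: "(v, D) \<in> tests e" for v D
      proof -
        have "v \<in> {0..3} \<times> {0..<int n}" using vD n_positive by (auto simp: xy)
        moreover have "v \<notin> lines n q" if q: "q \<in> Q" for q
        proof
          assume v: "v \<in> lines n q"
          obtain a b where ab: "q = (a, b)" by fastforce
          have "(r + y) mod int n = (a + b) mod int n \<or> (r - y) mod int n = (a - b) mod int n
             \<or> (x + c) mod int n = (a + b) mod int n \<or> (x - c) mod int n = (a - b) mod int n"
            using v vD by (auto simp: xy ab)
          moreover have eq: "(r + y) - (a + b) = y - (a + b - r)" "(r - y) - (a - b) = - (y - (r - a + b))"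
            "(x + c) - (a + b) = x - (a + b - c)" "(x - c) - (a - b) = x - (a - b + c)" by auto
          have "(r + y) mod int n = (a + b) mod int n \<longleftrightarrow> y mod int n = (a + b - r) mod int n"
            "(r - y) mod int n = (a - b) mod int n \<longleftrightarrow> y mod int n = (r - a + b) mod int n"
            "(x + c) mod int n = (a + b) mod int n \<longleftrightarrow> x mod int n = (a + b - c) mod int n"
            "(x - c) mod int n = (a - b) mod int n \<longleftrightarrow> x mod int n = (a - b + c) mod int n"
            unfolding mod_eq_dvd_iff eq by (simp_all only: dvd_minus_iff)
          ultimately consider "y mod int n = (a + b - r) mod int n" | "y mod int n = (r - a + b) mod int n"
            | "x mod int n = (a + b - c) mod int n" | "x mod int n = (a - b + c) mod int n" by blast
          then show False
            using x y N q unfolding X_def Y_def ab by cases force+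
        qed
        ultimately show ?thesis by (auto simp: free_def)
      qed
      ultimately have "e \<in> fresh Q" by (auto simp: fresh_def)
      then show False using no by blast
    qed
  qed
  moreover have finU: "finite ?U" by (rule finite_subset[OF _ finite_board[of n]]) auto
  moreover have "finite (fresh Q)" by (simp add: fresh_def)
  ultimately have "card (board n) \<le> card (fresh Q \<union> (X \<times> ?N \<union> (?N \<times> Y \<union> (?L ?l1 \<union> (?L ?l2 \<union> ?U)))))"
    using finXY by (intro card_mono) auto
  also have "\<dots> \<le> card (fresh Q) + (card (X \<times> ?N) + (card (?N \<times> Y) + (card (?L ?l1) + (card (?L ?l2) + card ?U))))"
    by (intro order.trans[OF card_Un_le] add_mono card_Un_le order.refl)
  also have "card (?L ?l1) = n" using n_positive by (intro cL) auto
  also have "card (?L ?l2) = n" using n_positive by (intro cL) auto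
  also have "card ?U \<le> (\<Sum>q\<in>Q. card (\<Union>v\<in>lines n q. ?L v))" using fin by (rule card_UN_le)
  also have "\<dots> \<le> (\<Sum>q\<in>Q. 4 * n)"
  proof (rule sum_mono)
    fix q assume q: "q \<in> Q"
    then have q': "q \<in> board n" using sub by auto
    have "card (\<Union>v\<in>lines n q. ?L v) \<le> (\<Sum>v\<in>lines n q. card (?L v))"
      using finite_inc[OF q'] by (rule card_UN_le)
    also have "\<dots> = (\<Sum>v\<in>lines n q. n)" using inc_subset[OF q'] by (intro sum.cong) (auto simp: cL)
    also have "\<dots> = 4 * n" using card_inc[OF q'] by simp
    finally show "card (\<Union>v\<in>lines n q. ?L v) \<le> 4 * n" .
  qed
  finally have "n * n \<le> card (fresh Q) + (card X * n + (n * card Y + (n + (n + card Q * (4 * n)))))"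
    by (simp add: board_def card_cartesian_product)
  then have "real (n * n) \<le> real (card (fresh Q) + (card X * n + (n * card Y + (n + (n + card Q * (4 * n))))))"
    by (rule of_nat_mono)
  then have "real n * n \<le> card (fresh Q) + n * (card X + card Y + 2 + 4 * real (card Q))"
    by (simp add: algebra_simps)
  also have "card X + card Y + 2 + 4 * real (card Q) \<le> n / 2"
  proof -
    have "400 * real (card Q) \<le> n" using size by linarith
    moreover have "real n \<ge> 1000" using large by linarith
    ultimately show ?thesis using XY by linarith
  qed
  then have "n * (card X + card Y + 2 + 4 * real (card Q)) \<le> n * (real n / 2)"
    by (intro mult_left_mono) auto
  finally show ?thesis by (simp add: power2_eq_square)
qed

end

section \<open>Safe queens: concentration\<close>

lemma exp_minus_le:
  fixes z :: real
  assumes "\<bar>z\<bar> \<le> 1"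
  shows "exp (- z) \<le> 1 - z + z\<^sup>2"
proof (cases "z \<le> 0")
  case True
  then show ?thesis using exp_bound[of "- z"] assms by simp
next
  case False
  have pos: "0 < 1 + z + z\<^sup>2 / 2" using False by (simp add: add_pos_nonneg)
  have "exp (- z) \<le> 1 / (1 + z + z\<^sup>2 / 2)"
    using exp_lower_Taylor_quadratic[of z] False pos by (simp add: exp_minus divide_simps)
  also have "\<dots> \<le> 1 - z + z\<^sup>2"
  proof -
    have "(1 - z + z\<^sup>2) * (1 + z + z\<^sup>2 / 2) = 1 + (z\<^sup>2 + z ^ 3 + z ^ 4) / 2"
      by (simp add: field_simps power2_eq_square eval_nat_numeral)
    also have "\<dots> \<ge> 1" using False by simp
    finally show ?thesis using pos by (simp add: divide_le_eq)
  qed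
  finally show ?thesis .
qed

context board_cell
begin

definition potential :: "real \<Rightarrow> pos set \<Rightarrow> real" where
  "potential \<beta> Q = (\<Sum>q\<in>Q \<inter> eligible. weight \<beta> Q (tests q))"

lemma finite_matching: "matching Q \<Longrightarrow> finite Q"
  unfolding matching_def using finite_board finite_subset by blast

lemma potential_insert:
  assumes "matching Q" "e \<in> avail Q"
  shows "potential \<beta> (insert e Q) = (\<Sum>q\<in>Q \<inter> eligible. weight \<beta> (insert e Q) (tests q)) +
    (if e \<in> eligible then weight \<beta> (insert e Q) (tests e) else 0)"
proof -
  have "e \<notin> Q" "finite Q" using avail_notin[OF assms(2)] finite_matching[OF assms(1)] by auto
  then show ?thesis by (simp add: potential_def Int_insert_left)
qed

lemma tests_card: "q \<in> eligible \<Longrightarrow> card {(v, D)\<in>tests q. P v D} \<le> 4"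
proof -
  assume "q \<in> eligible"
  then have "finite (tests q)" "card (tests q) \<le> 4"
    using test_family_tests by (auto simp: test_family_def)
  moreover from this have "card {(v, D)\<in>tests q. P v D} \<le> card (tests q)" by (intro card_mono) auto
  ultimately show ?thesis by simp
qed

lemma test_line:
  assumes "q \<in> eligible" "(v, D) \<in> tests q" "e \<in> D"
  shows "v \<in> lines n e"
  using test_family_tests[OF assms(1)] assms(2,3) by (auto simp: test_family_def)

lemma weight_fresh:
  assumes Q: "matching Q" and e: "e \<in> fresh Q" and \<beta>: "0 \<le> \<beta>" "\<beta> \<le> 1"
  shows "\<beta> ^ 4 \<le> weight \<beta> (insert e Q) (tests e)"
proof -
  have el: "e \<in> eligible" using e by (simp add: fresh_def)
  have "insert e Q \<inter> D = {}" if vD: "(v, D) \<in> tests e" for v D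
  proof -
    have "v \<in> free Q" using e vD by (auto simp: fresh_def)
    then have "q \<notin> D" if "q \<in> Q" for q using test_line[OF el vD, of q] that by (auto simp: free_def)
    moreover have "e \<notin> D" using test_line[OF el vD, of e] own_tests[OF el vD] by blast
    ultimately show ?thesis by blast
  qed
  then have "\<not> (\<exists>(v, D)\<in>tests e. insert e Q \<inter> D \<noteq> {})" by blast
  then have "weight \<beta> (insert e Q) (tests e) = \<beta> ^ card {(v, D)\<in>tests e. v \<in> free (insert e Q)}"
    unfolding weight_def by (rule if_not_P)
  then show ?thesis using \<beta> tests_card[OF el] by (simp add: power_decreasing)
qed

text \<open>The weights of the old queens decrease on average by at most a negligible amount, and at least half of
  all choices create a queen with four undecided tests.\<close>

lemma potential_drift:
  assumes Q: "matching Q" and size: "400 * card Q \<le> n"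
    and \<beta>: "0 \<le> \<beta>" "\<beta> \<le> 1 / 1600" and d: "d = 1 / (800 * real n)"
  shows "(\<Sum>e\<in>avail Q. potential \<beta> (insert e Q)) \<ge>
    real (card (avail Q)) * potential (\<beta> + d) Q - card Q + real n ^ 2 / 2 * \<beta> ^ 4"
proof -
  define A where "A = real (card (avail Q))"
  have fin: "finite Q" using finite_matching[OF Q] .
  have fresh: "fresh Q \<subseteq> avail Q" by (auto simp: fresh_def)
  have "(\<Sum>q\<in>Q \<inter> eligible. A * weight (\<beta> + d) Q (tests q) - 1) + real (card (fresh Q)) * \<beta> ^ 4
    \<le> (\<Sum>q\<in>Q \<inter> eligible. \<Sum>e\<in>avail Q. weight \<beta> (insert e Q) (tests q)) +
      (\<Sum>e\<in>avail Q. if e \<in> eligible then weight \<beta> (insert e Q) (tests e) else 0)"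
  proof (rule add_mono)
    show "(\<Sum>q\<in>Q \<inter> eligible. A * weight (\<beta> + d) Q (tests q) - 1) \<le>
      (\<Sum>q\<in>Q \<inter> eligible. \<Sum>e\<in>avail Q. weight \<beta> (insert e Q) (tests q))"
      unfolding A_def using weight_step[OF Q size large test_family_tests \<beta> d] by (intro sum_mono) auto
    have "real (card (fresh Q)) * \<beta> ^ 4 = (\<Sum>e\<in>fresh Q. \<beta> ^ 4)" by simp
    also have "\<dots> \<le> (\<Sum>e\<in>fresh Q. if e \<in> eligible then weight \<beta> (insert e Q) (tests e) else 0)"
      using weight_fresh[OF Q _ \<beta>(1)] \<beta>(2) by (intro sum_mono) (auto simp: fresh_def)
    also have "\<dots> \<le> (\<Sum>e\<in>avail Q. if e \<in> eligible then weight \<beta> (insert e Q) (tests e) else 0)"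
      using weight_nonneg[OF \<beta>(1)] fresh by (intro sum_mono2) auto
    finally show "real (card (fresh Q)) * \<beta> ^ 4 \<le> (\<Sum>e\<in>avail Q. if e \<in> eligible then weight \<beta> (insert e Q) (tests e) else 0)" .
  qed
  also have "\<dots> = (\<Sum>e\<in>avail Q. potential \<beta> (insert e Q))"
    by (subst sum.swap) (simp add: potential_insert[OF Q] sum.distrib)
  finally have "(\<Sum>q\<in>Q \<inter> eligible. A * weight (\<beta> + d) Q (tests q) - 1) + real (card (fresh Q)) * \<beta> ^ 4
    \<le> (\<Sum>e\<in>avail Q. potential \<beta> (insert e Q))" .
  moreover have "(\<Sum>q\<in>Q \<inter> eligible. A * weight (\<beta> + d) Q (tests q) - 1) \<ge> A * potential (\<beta> + d) Q - card Q"
    using card_mono[OF fin, of "Q \<inter> eligible"]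
    by (simp add: potential_def sum_subtractf flip: sum_distrib_left)
  moreover have "real (card (fresh Q)) * \<beta> ^ 4 \<ge> real n ^ 2 / 2 * \<beta> ^ 4"
    using many_fresh[OF Q size] by (intro mult_right_mono) auto
  ultimately show ?thesis by (simp add: A_def)
qed

text \<open>One step affects the tests of at most four queens and adds at most one queen; the remaining
  unit is the change of the discount factor, summed over all queens.\<close>

lemma potential_change:
  assumes Q: "matching Q" and e: "e \<in> avail Q"
    and \<beta>: "0 \<le> \<beta>" "\<beta> \<le> 1 / 1600" and d: "d = 1 / (800 * real n)"
  shows "\<bar>potential \<beta> (insert e Q) - potential (\<beta> + d) Q\<bar> \<le> 6"
proof -
  have fin: "finite Q" using finite_matching[OF Q] .
  have n0: "real n > 0" using n_positive by simp
  have d0: "0 \<le> d" "d \<le> 1 / 800" using n_positive by (auto simp: d field_simps)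
  have le1: "\<beta> \<le> 1" "\<beta> + d \<le> 1" "0 \<le> \<beta> + d" using \<beta> d0 by auto
  let ?aff = "{q \<in> Q. \<exists>(v, D)\<in>tests q. v \<in> lines n e}"
  let ?w = "\<lambda>q. weight \<beta> (insert e Q) (tests q) - weight (\<beta> + d) Q (tests q)"
  have one: "\<bar>?w q\<bar> \<le> 4 * d + (if q \<in> ?aff then 1 else 0)" if q: "q \<in> Q \<inter> eligible" for q
  proof (cases "q \<in> ?aff")
    case True
    have "0 \<le> weight \<beta> (insert e Q) (tests q)" "weight \<beta> (insert e Q) (tests q) \<le> 1"
      "0 \<le> weight (\<beta> + d) Q (tests q)" "weight (\<beta> + d) Q (tests q) \<le> 1"
      using weight_nonneg weight_le_1 \<beta> le1 by auto
    then show ?thesis using True d0 by auto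
  next
    case False
    then have "v \<notin> lines n e" if "(v, D) \<in> tests q" for v D using q that by blast
    then show ?thesis
      using weight_unaffected[OF test_family_tests _ \<beta>(1) d0(1) le1(2), of q e Q] q False by auto
  qed
  have "\<bar>\<Sum>q\<in>Q \<inter> eligible. ?w q\<bar> \<le> (\<Sum>q\<in>Q \<inter> eligible. 4 * d + (if q \<in> ?aff then 1 else 0))"
    using one by (intro order.trans[OF sum_abs] sum_mono)
  also have "\<dots> \<le> (\<Sum>q\<in>Q. 4 * d + (if q \<in> ?aff then 1 else 0))"
    using fin d0 by (intro sum_mono2) auto
  also have "\<dots> = real (card Q) * (4 * d) + real (card ?aff)"
    using fin by (simp add: sum.distrib sum.If_cases Int_def)
  also have "\<dots> \<le> real n * (4 * d) + 4"
    using card_affected[OF Q, of e] card_free(2)[OF Q] d0 by (intro add_mono mult_right_mono) auto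
  also have "real n * (4 * d) \<le> 1" using n0 by (simp add: d)
  finally have 1: "\<bar>\<Sum>q\<in>Q \<inter> eligible. ?w q\<bar> \<le> 5" by simp
  have 2: "0 \<le> (if e \<in> eligible then weight \<beta> (insert e Q) (tests e) else 0)"
    "(if e \<in> eligible then weight \<beta> (insert e Q) (tests e) else 0) \<le> 1"
    using weight_nonneg weight_le_1 \<beta> le1 by auto
  have "potential \<beta> (insert e Q) - potential (\<beta> + d) Q = (\<Sum>q\<in>Q \<inter> eligible. ?w q) +
    (if e \<in> eligible then weight \<beta> (insert e Q) (tests e) else 0)"
    unfolding potential_insert[OF Q e] by (simp add: potential_def sum_subtractf)
  then show ?thesis using 1 2 by linarith
qed

text \<open>The usual exponential moment estimate for bounded increments, with the quadratic bound for the
  exponential function: \<open>36\<close> is the square of the largest increment.\<close>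

lemma potential_mgf:
  assumes Q: "matching Q" and size: "400 * card Q \<le> n"
    and \<beta>: "0 \<le> \<beta>" "\<beta> \<le> 1 / 1600" and d: "d = 1 / (800 * real n)" and \<kappa>: "0 \<le> \<kappa>" "\<kappa> \<le> 1 / 6"
  shows "(\<Sum>e\<in>avail Q. exp (- \<kappa> * (potential \<beta> (insert e Q) - potential (\<beta> + d) Q))) \<le>
    real (card (avail Q)) * exp (- \<kappa> * (\<beta> ^ 4 / 2 - 2 / n - 36 * \<kappa>))"
    and "avail Q \<noteq> {}"
proof -
  define A where "A = real (card (avail Q))"
  define \<Delta> where "\<Delta> = (\<lambda>e. potential \<beta> (insert e Q) - potential (\<beta> + d) Q)"
  have n0: "real n > 0" using n_positive by simp
  have A1: "A \<ge> real n ^ 2 / 2"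
  proof -
    have "card (fresh Q) \<le> card (avail Q)" by (intro card_mono) (auto simp: fresh_def)
    then show ?thesis using many_fresh[OF Q size] by (simp add: A_def)
  qed
  have "real n ^ 2 / 2 > 0" using n0 by simp
  then have A0: "A > 0" using A1 by linarith
  then show "avail Q \<noteq> {}" by (auto simp: A_def)
  have A2: "A \<le> real n ^ 2"
  proof -
    have "card (avail Q) \<le> card (board n)" using avail_subset by (intro card_mono) auto
    also have "\<dots> = n * n" by (simp add: board_def card_cartesian_product)
    finally have "real (card (avail Q)) \<le> real (n * n)" by (rule of_nat_mono)
    then show ?thesis by (simp add: A_def power2_eq_square)
  qed
  have "(\<Sum>e\<in>avail Q. \<Delta> e) \<ge> - real (card Q) + real n ^ 2 / 2 * \<beta> ^ 4"
    using potential_drift[OF Q size \<beta> d] by (simp add: \<Delta>_def sum_subtractf)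
  moreover have "A * (\<beta> ^ 4 / 2) \<le> real n ^ 2 / 2 * \<beta> ^ 4"
    using mult_right_mono[OF A2, of "\<beta> ^ 4 / 2"] by simp
  moreover have "real (card Q) \<le> A * (2 / n)"
  proof -
    have "real (card Q) \<le> n" using card_free(2)[OF Q] by simp
    also have "\<dots> = real n ^ 2 / 2 * (2 / n)" using n0 by (simp add: power2_eq_square)
    also have "\<dots> \<le> A * (2 / n)" using A1 by (intro mult_right_mono) auto
    finally show ?thesis .
  qed
  ultimately have "(\<Sum>e\<in>avail Q. \<Delta> e) \<ge> A * (\<beta> ^ 4 / 2 - 2 / n)"
    unfolding right_diff_distrib by linarith
  then have drift: "\<kappa> * (\<Sum>e\<in>avail Q. \<Delta> e) \<ge> \<kappa> * (A * (\<beta> ^ 4 / 2 - 2 / n))"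
    using \<kappa> by (intro mult_left_mono)
  have "(\<Sum>e\<in>avail Q. exp (- \<kappa> * \<Delta> e)) \<le> (\<Sum>e\<in>avail Q. 1 - \<kappa> * \<Delta> e + \<kappa>\<^sup>2 * 36)"
  proof (rule sum_mono)
    fix e assume e: "e \<in> avail Q"
    have \<Delta>: "\<bar>\<Delta> e\<bar> \<le> 6" unfolding \<Delta>_def by (rule potential_change[OF Q e \<beta> d])
    have "\<bar>\<kappa> * \<Delta> e\<bar> \<le> (1 / 6) * 6"
      unfolding abs_mult using \<Delta> \<kappa> by (intro mult_mono) auto
    then have "exp (- (\<kappa> * \<Delta> e)) \<le> 1 - \<kappa> * \<Delta> e + (\<kappa> * \<Delta> e)\<^sup>2" by (intro exp_minus_le) simp
    also have "(\<kappa> * \<Delta> e)\<^sup>2 \<le> \<kappa>\<^sup>2 * 36"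
    proof -
      have "(\<Delta> e)\<^sup>2 \<le> 6\<^sup>2" using \<Delta> by (metis abs_le_square_iff abs_numeral)
      then show ?thesis unfolding power_mult_distrib by (intro mult_left_mono) auto
    qed
    finally show "exp (- \<kappa> * \<Delta> e) \<le> 1 - \<kappa> * \<Delta> e + \<kappa>\<^sup>2 * 36" by simp
  qed
  also have "\<dots> = A - \<kappa> * (\<Sum>e\<in>avail Q. \<Delta> e) + A * (\<kappa>\<^sup>2 * 36)"
    by (simp add: sum.distrib sum_subtractf A_def flip: sum_distrib_left)
  also have "\<dots> \<le> A - \<kappa> * (A * (\<beta> ^ 4 / 2 - 2 / n)) + A * (\<kappa>\<^sup>2 * 36)" using drift by simp
  also have "\<dots> = A * (1 + (- \<kappa> * (\<beta> ^ 4 / 2 - 2 / n - 36 * \<kappa>)))"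
    by (simp add: algebra_simps power2_eq_square)
  also have "\<dots> \<le> A * exp (- \<kappa> * (\<beta> ^ 4 / 2 - 2 / n - 36 * \<kappa>))"
    using A0 by (intro mult_left_mono exp_ge_add_one_self) simp
  finally show "(\<Sum>e\<in>avail Q. exp (- \<kappa> * (potential \<beta> (insert e Q) - potential (\<beta> + d) Q))) \<le>
    real (card (avail Q)) * exp (- \<kappa> * (\<beta> ^ 4 / 2 - 2 / n - 36 * \<kappa>))"
    by (simp only: \<Delta>_def A_def)
qed

lemma card_greedy_le: "Q \<in> set_pmf (greedy n t) \<Longrightarrow> card Q \<le> t"
proof (induction t arbitrary: Q)
  case (Suc t)
  then obtain Q' where Q': "Q' \<in> set_pmf (greedy n t)" "Q = Q' \<or> (\<exists>p. Q = insert p Q')"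
    unfolding set_pmf_greedy_Suc by (auto split: if_splits)
  have "card (insert p Q') \<le> Suc (card Q')" for p by (rule card_insert_le_m1) simp_all
  then show ?case using Q' Suc.IH[OF Q'(1)] by (metis Suc_leI Suc_le_mono le_SucI le_trans)
qed simp

text \<open>The discount factor when \<open>k\<close> steps of the initial phase remain. It ends at \<open>0\<close>, so that at the end
  of the phase only queens without undecided tests count.\<close>

definition rate :: "nat \<Rightarrow> real" where
  "rate k = real k / (800 * real n)"

lemma potential_concentration:
  assumes m: "400 * m \<le> n" and \<kappa>: "0 \<le> \<kappa>" "\<kappa> \<le> 1 / 6"
  defines "\<theta> \<equiv> \<Sum>t<m. rate (m - Suc t) ^ 4 / 2 - 2 / n - 36 * \<kappa>"
  shows "measure_pmf.prob (greedy n m) {Q. potential 0 Q \<le> L} \<le> exp (- \<kappa> * (\<theta> - L))"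
proof -
  define \<Theta> where "\<Theta> = (\<lambda>k. \<Sum>t<k. rate (m - Suc t) ^ 4 / 2 - 2 / n - 36 * \<kappa>)"
  define f where "f = (\<lambda>t Q. exp (- \<kappa> * (potential (rate (m - t)) Q - \<Theta> t + \<theta> - L)))"
  define d where "d = 1 / (800 * real n)"
  have step: "available n Q \<noteq> {} \<and> (\<Sum>p\<in>available n Q. f (Suc t) (insert p Q)) \<le> card (available n Q) * f t Q"
    if t: "t < m" and Q: "Q \<in> set_pmf (greedy n t)" for t Q
  proof -
    have mQ: "matching Q" using greedy_toroidal[OF n_positive Q] .
    have av: "available n Q = avail Q"
      using available_eq_avail[OF n_positive, of Q] mQ by (simp add: matching_def)
    have "card Q \<le> m" using card_greedy_le[OF Q] t by simp
    then have size: "400 * card Q \<le> n" using m by linarith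
    define \<beta> where "\<beta> = rate (m - Suc t)"
    have \<beta>d: "rate (m - t) = \<beta> + d"
    proof -
      have "m - t = Suc (m - Suc t)" using t by simp
      then have "real (m - t) = real (m - Suc t) + 1" by linarith
      then show ?thesis unfolding \<beta>_def rate_def d_def by (simp only: add_divide_distrib)
    qed
    have \<beta>: "0 \<le> \<beta>" "\<beta> \<le> 1 / 1600"
    proof -
      show "0 \<le> \<beta>" by (simp add: \<beta>_def rate_def)
      have "1600 * real (m - Suc t) \<le> 800 * real n" using m by linarith
      then show "\<beta> \<le> 1 / 1600" using n_positive by (simp add: \<beta>_def rate_def divide_simps)
    qed
    let ?g = "\<beta> ^ 4 / 2 - 2 / n - 36 * \<kappa>"
    have \<Theta>: "\<Theta> (Suc t) = \<Theta> t + ?g" by (simp add: \<Theta>_def \<beta>_def)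
    have "(\<Sum>p\<in>avail Q. f (Suc t) (insert p Q)) =
      (\<Sum>p\<in>avail Q. exp (- \<kappa> * (potential \<beta> (insert p Q) - potential (\<beta> + d) Q)) * (f t Q * exp (\<kappa> * ?g)))"
      by (intro sum.cong refl) (simp add: f_def \<Theta> \<beta>d flip: exp_add \<beta>_def, simp add: algebra_simps)
    also have "\<dots> = (\<Sum>p\<in>avail Q. exp (- \<kappa> * (potential \<beta> (insert p Q) - potential (\<beta> + d) Q))) * (f t Q * exp (\<kappa> * ?g))"
      by (rule sum_distrib_right[symmetric])
    also have "\<dots> \<le> (real (card (avail Q)) * exp (- \<kappa> * ?g)) * (f t Q * exp (\<kappa> * ?g))"
      using potential_mgf(1)[OF mQ size \<beta> d_def \<kappa>] by (intro mult_right_mono) (auto simp: f_def)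
    also have "\<dots> = card (avail Q) * f t Q * (exp (- \<kappa> * ?g) * exp (\<kappa> * ?g))" by (simp only: ac_simps)
    also have "exp (- \<kappa> * ?g) * exp (\<kappa> * ?g) = 1" by (simp flip: exp_add)
    finally show ?thesis using potential_mgf(2)[OF mQ size \<beta> d_def \<kappa>] by (simp add: av)
  qed
  have sub: "{Q. potential 0 Q \<le> L} \<subseteq> {Q. f m Q \<ge> 1}"
  proof clarify
    fix Q assume "potential 0 Q \<le> L"
    then have "- \<kappa> * (potential 0 Q - L) \<ge> 0" using \<kappa> by (simp add: mult_nonneg_nonpos)
    then show "1 \<le> f m Q" by (simp add: f_def \<Theta>_def \<theta>_def rate_def)
  qed
  have "measure_pmf.prob (greedy n m) {Q. potential 0 Q \<le> L} \<le> measure_pmf.prob (greedy n m) {Q. f m Q \<ge> 1}"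
    by (intro measure_pmf.finite_measure_mono sub) auto
  also have "\<dots> \<le> f 0 {}"
    by (rule greedy_supermartingale[where f = f]) (use step in \<open>auto simp: f_def\<close>)
  also have "\<dots> = exp (- \<kappa> * (\<theta> - L))" by (simp add: f_def potential_def \<Theta>_def)
  finally show ?thesis .
qed

text \<open>Each of the four toroidal diagonals carries its queen outside of the part that has to stay empty.
  As the greedy process never puts a second queen on a toroidal diagonal, a safe queen remains safe.\<close>

definition safe :: "pos set \<Rightarrow> pos set" where
  "safe Q = {q \<in> Q \<inter> eligible. \<forall>(v, D)\<in>tests q. Q \<inter> D = {} \<and> v \<notin> free Q}"

lemma potential_0:
  assumes "matching Q"
  shows "potential 0 Q = card (safe Q)"
proof -
  have fin: "finite Q" using finite_matching[OF assms] .
  have "weight 0 Q (tests q) = (if q \<in> safe Q then 1 else 0)" if q: "q \<in> Q \<inter> eligible" for q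
  proof -
    have "finite (tests q)" using test_family_tests q by (auto simp: test_family_def)
    then have "finite {(v, D)\<in>tests q. v \<in> free Q}" by (rule finite_subset[rotated]) auto
    then have "(0::real) ^ card {(v, D)\<in>tests q. v \<in> free Q} = (if \<forall>(v, D)\<in>tests q. v \<notin> free Q then 1 else 0)"
      by (auto simp: power_0_left card_eq_0_iff)
    moreover have "q \<in> safe Q \<longleftrightarrow> \<not> (\<exists>(v, D)\<in>tests q. Q \<inter> D \<noteq> {}) \<and> (\<forall>(v, D)\<in>tests q. v \<notin> free Q)"
      using q unfolding safe_def by blast
    ultimately show ?thesis unfolding weight_def by simp
  qed
  then have "potential 0 Q = (\<Sum>q\<in>Q \<inter> eligible. if q \<in> safe Q then 1 else 0)"
    unfolding potential_def by (intro sum.cong) auto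
  also have "\<dots> = card (Q \<inter> eligible \<inter> safe Q)" using fin by (simp add: sum.If_cases)
  also have "Q \<inter> eligible \<inter> safe Q = safe Q" by (auto simp: safe_def)
  finally show ?thesis .
qed

lemma safe_mono:
  assumes "matching Q" "e \<in> avail Q"
  shows "safe Q \<subseteq> safe (insert e Q)"
proof
  fix q assume q: "q \<in> safe Q"
  have el: "q \<in> eligible" using q by (simp add: safe_def)
  have "insert e Q \<inter> D = {} \<and> v \<notin> free (insert e Q)" if vD: "(v, D) \<in> tests q" for v D
  proof -
    have *: "Q \<inter> D = {}" "v \<notin> free Q" using q vD by (auto simp: safe_def)
    then have "v \<notin> lines n e" using assms(2) by (auto simp: avail_def)
    then have "e \<notin> D" using test_line[OF el vD] by blast
    then show ?thesis using * by (auto simp: free_insert)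
  qed
  then show "q \<in> safe (insert e Q)" using q by (auto simp: safe_def)
qed

lemma safe_absorbers:
  assumes "matching Q"
  shows "safe Q \<subseteq> absorbers n Q r c"
proof
  fix q assume q: "q \<in> safe Q"
  obtain x y where xy: "q = (x, y)" by fastforce
  have sub: "Q \<subseteq> board n" using assms by (simp add: matching_def)
  have "(x, y) \<in> eligible" using q by (simp add: safe_def xy)
  then have ne: "r + y \<noteq> x + c" "r - y \<noteq> x - c"
    using mod_transfer[of x y] unfolding eligible_def by auto
  have hit: "Q \<inter> antidiagonal n (r + y) = {}" "Q \<inter> diagonal n (r - y) = {}"
    "Q \<inter> antidiagonal n (x + c) = {}" "Q \<inter> diagonal n (x - c) = {}"
    using q by (simp_all add: safe_def xy)
  have "a + b \<noteq> r + y \<and> a - b \<noteq> r - y \<and> a + b \<noteq> x + c \<and> a - b \<noteq> x - c" if "(a, b) \<in> Q" for a b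
    using hit that sub unfolding antidiagonal_def diagonal_def by blast
  then have "(x, y) \<in> absorbers n Q r c"
    unfolding absorbers_iff[OF sub r c] using q ne by (auto simp: safe_def xy)
  then show "q \<in> absorbers n Q r c" by (simp add: xy)
qed

end

context board_cell
begin

text \<open>In the first half of the initial phase the discount factor is at least \<open>b\<close>, and the phase has at least
  \<open>n / 800\<close> steps. The value of \<open>\<kappa>\<close> makes the second order term of the exponential moment a small
  fraction of the drift.\<close>

lemma drift_sum:
  fixes b \<kappa> :: real
  assumes b: "b = 1 / 1280000" and \<kappa>: "\<kappa> = b ^ 4 / 2400" and n: "25600 \<le> n * b ^ 4" and m: "m = n div 400"
  shows "n * b ^ 4 / 12800 \<le> (\<Sum>t<m. rate (m - Suc t) ^ 4 / 2 - 2 / n - 36 * \<kappa>)"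
proof -
  have n0: "real n > 0" using n_positive by simp
  have b0: "b > 0" by (simp add: b)
  have m1: "real m \<le> n / 400" "real m \<ge> n / 800" "real (m div 2) \<ge> n / 3200"
  proof -
    have m2: "2 \<le> m" using div_le_mono[OF large, of 400] by (simp add: m)
    have "1 \<le> m div 2" using div_le_mono[OF m2, of 2] by simp
    moreover have "n < 400 * m + 400" "400 * m \<le> n" "m < 2 * (m div 2) + 2" using m by linarith+
    ultimately have "400 * m \<le> n" "n \<le> 800 * m" "n \<le> 3200 * (m div 2)" using m2 by linarith+
    then have "real (400 * m) \<le> real n" "real n \<le> real (800 * m)" "real n \<le> real (3200 * (m div 2))"
      by (simp_all only: of_nat_le_iff)
    then show "real m \<le> n / 400" "real m \<ge> n / 800" "real (m div 2) \<ge> n / 3200" by simp_all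
  qed
  have "n / 3200 * b ^ 4 \<le> real (m div 2) * b ^ 4" using m1 by (intro mult_right_mono) auto
  also have "\<dots> = (\<Sum>t<m div 2. b ^ 4)" by simp
  also have "\<dots> \<le> (\<Sum>t<m div 2. rate (m - Suc t) ^ 4)"
  proof (rule sum_mono)
    fix t assume "t \<in> {..<m div 2}"
    then have "m \<le> 2 * (m - Suc t)" by simp
    then have "real m \<le> real (2 * (m - Suc t))" by (rule of_nat_mono)
    then have "n / 1600 \<le> real (m - Suc t)" using m1 by simp
    then have "b \<le> rate (m - Suc t)" using n0 by (simp add: b rate_def divide_simps)
    then show "b ^ 4 \<le> rate (m - Suc t) ^ 4" using b0 by (intro power_mono) auto
  qed
  also have "\<dots> \<le> (\<Sum>t<m. rate (m - Suc t) ^ 4)" by (intro sum_mono2) auto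
  finally have 1: "n / 3200 * b ^ 4 \<le> (\<Sum>t<m. rate (m - Suc t) ^ 4)" .
  have "real m * (2 / n) \<le> n / 400 * (2 / n)" using m1 by (intro mult_right_mono) auto
  also have "\<dots> \<le> 1" using n0 by simp
  finally have 2: "real m * (2 / n) \<le> 1" .
  have "real m * (36 * \<kappa>) \<le> n / 400 * (36 * \<kappa>)"
    using m1 by (intro mult_right_mono) (auto simp: \<kappa>)
  also have "\<dots> = (36 / 960000) * (n * b ^ 4)" by (simp add: \<kappa>)
  also have "\<dots> \<le> (1 / 25600) * (n * b ^ 4)" by (intro mult_right_mono) auto
  finally have 3: "real m * (36 * \<kappa>) \<le> (1 / 25600) * (n * b ^ 4)" .
  have "(\<Sum>t<m. rate (m - Suc t) ^ 4 / 2 - 2 / n - 36 * \<kappa>) =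
    (\<Sum>t<m. rate (m - Suc t) ^ 4) / 2 - real m * (2 / n) - real m * (36 * \<kappa>)"
    by (simp add: sum_subtractf sum_divide_distrib)
  moreover have "n / 3200 * b ^ 4 / 2 = 4 * (n * b ^ 4 / 25600)" by simp
  ultimately show ?thesis using 1 2 3 n by linarith
qed

text \<open>At the end of the initial phase the potential counts safe queens, which are absorbers and
  survive until the time \<open>t\<close>.\<close>

lemma few_absorbers:
  fixes b :: real
  assumes b: "b = 1 / 1280000" and n: "25600 \<le> n * b ^ 4" and t: "n div 400 \<le> t"
  shows "measure_pmf.prob (greedy n t) {Q. real (card (absorbers n Q r c)) \<le> b ^ 4 / 25600 * n}
    \<le> exp (- (b ^ 4 / 2400 * (b ^ 4 / 25600)) * n)"
proof -
  define m where "m = n div 400"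
  define \<kappa> where "\<kappa> = b ^ 4 / 2400"
  define L where "L = b ^ 4 / 25600 * n"
  define \<theta> where "\<theta> = (\<Sum>t<m. rate (m - Suc t) ^ 4 / 2 - 2 / n - 36 * \<kappa>)"
  have m: "400 * m \<le> n" by (simp add: m_def)
  have "b ^ 4 \<le> 1" by (rule power_le_one) (simp_all add: b)
  then have \<kappa>: "0 \<le> \<kappa>" "\<kappa> \<le> 1 / 6" by (simp_all add: \<kappa>_def)
  have \<theta>: "2 * L \<le> \<theta>" using drift_sum[OF b \<kappa>_def n m_def] by (simp add: \<theta>_def L_def)
  let ?U = "{Q. L < real (card (safe Q))}"
  have matching: "matching Q" if "Q \<in> set_pmf (greedy n k)" for Q k
    using greedy_toroidal[OF n_positive that] .
  have "measure_pmf.prob (greedy n t) {Q. real (card (absorbers n Q r c)) \<le> L} \<le>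
    measure_pmf.prob (greedy n t) (- ?U)"
  proof (rule measure_pmf.finite_measure_mono_AE)
    have small: "real (card (safe Q)) \<le> L" if Q: "Q \<in> set_pmf (greedy n t)" and L: "real (card (absorbers n Q r c)) \<le> L" for Q
    proof -
      have "absorbers n Q r c \<subseteq> Q" by (auto simp: absorbers_def)
      then have "finite (absorbers n Q r c)" using finite_matching[OF matching[OF Q]] finite_subset by blast
      then have "card (safe Q) \<le> card (absorbers n Q r c)"
        using safe_absorbers[OF matching[OF Q]] by (rule card_mono)
      then show ?thesis using L by linarith
    qed
    show "AE Q in greedy n t. Q \<in> {Q. real (card (absorbers n Q r c)) \<le> L} \<longrightarrow> Q \<in> - ?U"
    proof (rule AE_pmfI)
      fix Q assume "Q \<in> set_pmf (greedy n t)"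
      then show "Q \<in> {Q. real (card (absorbers n Q r c)) \<le> L} \<longrightarrow> Q \<in> - ?U"
        using small[of Q] by (simp add: not_less)
    qed
  qed simp
  also have "\<dots> = 1 - measure_pmf.prob (greedy n t) ?U"
    using measure_pmf.prob_compl[of ?U "greedy n t"] by (simp add: Compl_eq_Diff_UNIV)
  also have "\<dots> \<le> 1 - measure_pmf.prob (greedy n m) ?U"
  proof -
    have "measure_pmf.prob (greedy n m) ?U \<le> measure_pmf.prob (greedy n t) ?U"
    proof (rule greedy_prob_mono)
      fix k Q p assume Q: "Q \<in> set_pmf (greedy n k)" "Q \<in> ?U" "p \<in> available n Q"
      have mQ: "matching Q" using matching[OF Q(1)] .
      have p: "p \<in> avail Q"
        using Q(3) available_eq_avail[OF n_positive, of Q] mQ by (simp add: matching_def)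
      have "finite (safe (insert p Q))" using finite_matching[OF mQ] by (simp add: safe_def)
      then have "card (safe Q) \<le> card (safe (insert p Q))" using safe_mono[OF mQ p] by (rule card_mono)
      then show "insert p Q \<in> ?U" using Q(2) by simp
    qed (use t in \<open>simp add: m_def\<close>)
    then show ?thesis by simp
  qed
  also have "\<dots> = measure_pmf.prob (greedy n m) (- ?U)"
    using measure_pmf.prob_compl[of ?U "greedy n m"] by (simp add: Compl_eq_Diff_UNIV)
  also have "\<dots> \<le> measure_pmf.prob (greedy n m) {Q. potential 0 Q \<le> L}"
    by (rule measure_pmf.finite_measure_mono_AE) (auto intro!: AE_pmfI simp: potential_0 matching)
  also have "\<dots> \<le> exp (- \<kappa> * (\<theta> - L))"
    unfolding \<theta>_def by (rule potential_concentration[OF m \<kappa>])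
  also have "\<dots> \<le> exp (- \<kappa> * L)"
  proof -
    have "\<kappa> * L \<le> \<kappa> * (\<theta> - L)" using \<theta> \<kappa> by (intro mult_left_mono) auto
    then show ?thesis by simp
  qed
  finally show ?thesis by (simp add: L_def \<kappa>_def)
qed

end

lemma absorbers_concentration:
  obtains \<delta> \<rho> :: real and N :: nat where "\<delta> > 0" "\<rho> > 0"
    "\<And>n t r c. N \<le> n \<Longrightarrow> n div 400 \<le> t \<Longrightarrow> r \<in> {1..int n} \<Longrightarrow> c \<in> {1..int n} \<Longrightarrow>
      measure_pmf.prob (greedy n t) {Q. real (card (absorbers n Q r c)) \<le> \<delta> * n} \<le> exp (- \<rho> * n)"
proof
  define b :: real where "b = 1 / 1280000"
  show "b ^ 4 / 25600 > 0" "b ^ 4 / 2400 * (b ^ 4 / 25600) > 0" by (simp_all add: b_def)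
  fix n t :: nat and r c :: int
  assume n: "max 1000 (nat \<lceil>25600 / b ^ 4\<rceil>) \<le> n" and t: "n div 400 \<le> t"
    and rc: "r \<in> {1..int n}" "c \<in> {1..int n}"
  interpret board_cell n r c using n rc by unfold_locales auto
  have "25600 / b ^ 4 \<le> n" using n by linarith
  then have "25600 \<le> n * b ^ 4" by (simp add: b_def divide_le_eq)
  then show "measure_pmf.prob (greedy n t) {Q. real (card (absorbers n Q r c)) \<le> b ^ 4 / 25600 * n}
    \<le> exp (- (b ^ 4 / 2400 * (b ^ 4 / 25600)) * n)"
    using few_absorbers[OF b_def _ t] by simp
qed

section \<open>The toroidal greedy algorithm followed by absorption\<close>

text \<open>A union bound over the cells of the board. The number of queens at time \<open>t\<close> is at least the one
  at the earlier time \<open>m\<close>, so a bound on the size is needed at time \<open>m\<close> only.\<close>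

lemma failure_bound:
  fixes \<delta> p :: real
  assumes n: "n > 0" and t: "m \<le> t" and \<delta>: "9 * real (n - m) < \<delta> * n"
    and size: "measure_pmf.prob (greedy n m) {Q. card Q \<noteq> m} \<le> q"
    and absorb: "\<And>r c. r \<in> {1..int n} \<Longrightarrow> c \<in> {1..int n} \<Longrightarrow>
      measure_pmf.prob (greedy n t) {Q. real (card (absorbers n Q r c)) \<le> \<delta> * n} \<le> p"
  shows "1 - (q + real n ^ 2 * p) \<le> measure_pmf.prob (greedy n t) {Q. absorption_succeeds n Q}"
proof -
  let ?P = "measure_pmf.prob (greedy n t)"
  let ?S = "{Q. absorption_succeeds n Q}" and ?U = "{Q. m \<le> card Q}"
  let ?B = "\<lambda>(r, c). {Q. real (card (absorbers n Q r c)) \<le> \<delta> * n}"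
  have "1 - q \<le> ?P ?U"
  proof -
    have "1 - q \<le> 1 - measure_pmf.prob (greedy n m) {Q. card Q \<noteq> m}" using size by simp
    also have "\<dots> = measure_pmf.prob (greedy n m) (UNIV - {Q. card Q \<noteq> m})"
      using measure_pmf.prob_compl[of "{Q. card Q \<noteq> m}" "greedy n m"] by simp
    also have "\<dots> \<le> measure_pmf.prob (greedy n m) ?U"
      by (rule measure_pmf.finite_measure_mono) auto
    also have "\<dots> \<le> ?P ?U"
    proof (rule greedy_prob_mono[OF _ t])
      fix k Q p assume k: "Q \<in> set_pmf (greedy n k)" and Q: "Q \<in> ?U"
      have "Q \<subseteq> board n" using partial_queens_greedy[OF k] unfolding partial_queens_def by (rule conjunct1)
      then have "finite Q" using finite_board by (rule finite_subset)
      then have "card Q \<le> card (insert p Q)" by (intro card_mono) auto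
      then show "insert p Q \<in> ?U" using Q by simp
    qed
    finally show ?thesis .
  qed
  moreover have "?P ?U \<le> ?P (?S \<union> (\<Union>z\<in>board n. ?B z))"
  proof (rule measure_pmf.finite_measure_mono_AE)
    have success: "Q \<in> ?S" if Q: "Q \<in> set_pmf (greedy n t)" "Q \<in> ?U" and nB: "Q \<notin> (\<Union>z\<in>board n. ?B z)" for Q
    proof -
      have "9 * (n - card Q) \<le> card (absorbers n Q r c)" if "r \<in> {1..int n}" "c \<in> {1..int n}" for r c
      proof -
        have "(r, c) \<in> board n" using that by (simp add: board_def)
        then have "Q \<notin> ?B (r, c)" using nB by blast
        then have "\<delta> * n < real (card (absorbers n Q r c))" by simp
        moreover have "9 * (n - card Q) \<le> 9 * (n - m)" using Q(2) by simp
        then have "real (9 * (n - card Q)) \<le> real (9 * (n - m))" by (rule of_nat_mono)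
        moreover have "real (9 * (n - m)) = 9 * real (n - m)" by simp
        ultimately have "real (9 * (n - card Q)) \<le> real (card (absorbers n Q r c))" using \<delta> by linarith
        then show ?thesis by (simp only: of_nat_le_iff)
      qed
      then have "absorption_succeeds n Q" by (rule absorption_succeedsI[OF partial_queens_greedy[OF Q(1)]])
      then show ?thesis by (rule CollectI)
    qed
    show "AE Q in greedy n t. Q \<in> ?U \<longrightarrow> Q \<in> ?S \<union> (\<Union>z\<in>board n. ?B z)"
    proof (rule AE_pmfI)
      fix Q assume "Q \<in> set_pmf (greedy n t)"
      then show "Q \<in> ?U \<longrightarrow> Q \<in> ?S \<union> (\<Union>z\<in>board n. ?B z)" using success[of Q] by blast
    qed
  qed simp
  moreover have "?P (?S \<union> (\<Union>z\<in>board n. ?B z)) \<le> ?P ?S + ?P (\<Union>z\<in>board n. ?B z)"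
    by (rule measure_Un_le) auto
  moreover have "?P (\<Union>z\<in>board n. ?B z) \<le> (\<Sum>z\<in>board n. ?P (?B z))"
    by (rule measure_UNION_le) auto
  moreover have "(\<Sum>z\<in>board n. ?P (?B z)) \<le> (\<Sum>z\<in>board n. p)"
  proof (rule sum_mono)
    fix z assume "z \<in> board n"
    then show "?P (?B z) \<le> p" using absorb[of "fst z" "snd z"] by (simp add: board_def mem_Times_iff case_prod_unfold)
  qed
  moreover have "(\<Sum>z\<in>board n. p) = real n ^ 2 * p"
    by (simp add: board_def card_cartesian_product power2_eq_square)
  ultimately show ?thesis by linarith
qed

theorem mainTheorem4:
  fixes \<alpha> :: real and T :: "nat \<Rightarrow> nat"
  assumes "\<alpha> = 1 / 10 ^ 4"
    and "\<And>n. T n = nat \<lfloor>(1 - real n powr (- \<alpha>)) * real n\<rfloor>"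
  shows "(\<lambda>n. measure_pmf.prob (greedy n (T n)) {Q. absorption_succeeds n Q}) \<longlonglongrightarrow> 1"
proof -
  obtain \<delta> \<rho> :: real and N where \<delta>: "\<delta> > 0" and \<rho>: "\<rho> > 0"
    and absorb: "\<And>n t r c. N \<le> n \<Longrightarrow> n div 400 \<le> t \<Longrightarrow> r \<in> {1..int n} \<Longrightarrow> c \<in> {1..int n} \<Longrightarrow>
      measure_pmf.prob (greedy n t) {Q. real (card (absorbers n Q r c)) \<le> \<delta> * n} \<le> exp (- \<rho> * n)"
    using absorbers_concentration by blast
  \<comment> \<open>The greedy process leaves at most \<open>\<epsilon> n + 1\<close> rows empty, and nine times this number has to
    be less than \<open>\<delta> n\<close>.\<close>
  define \<epsilon> where "\<epsilon> = min (1 / 2) (\<delta> / 20)"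
  have \<epsilon>: "0 < \<epsilon>" "\<epsilon> \<le> 1 / 2" "\<epsilon> \<le> \<delta> / 20" using \<delta> by (auto simp: \<epsilon>_def)
  define K where "K = (1500 + 48 / \<epsilon> ^ 4) * exp (4 / \<epsilon> ^ 4) / \<epsilon> ^ 8"
  define m where "m = (\<lambda>n::nat. nat \<lfloor>(1 - \<epsilon>) * real n\<rfloor>)"
  have lower: "\<forall>\<^sub>F n in sequentially. 1 - (K / real n + real n ^ 2 * exp (- \<rho> * real n)) \<le>
    measure_pmf.prob (greedy n (T n)) {Q. absorption_succeeds n Q}"
  proof -
    have "((\<lambda>n. real n powr - \<alpha>) \<longlongrightarrow> 0) sequentially"
      unfolding assms(1) by real_asymp
    then have "\<forall>\<^sub>F n in sequentially. real n powr - \<alpha> < \<epsilon>"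
      using \<epsilon>(1) by (rule order_tendstoD(2))
    moreover have "\<forall>\<^sub>F n in sequentially. 20 < \<delta> * real n" using \<delta> by real_asymp
    moreover have "\<forall>\<^sub>F n in sequentially. max 1 N \<le> n" by (rule eventually_ge_at_top)
    ultimately show ?thesis
    proof eventually_elim
      case (elim n)
      have n: "n > 0" "N \<le> n" using elim by auto
      have "m n \<le> T n"
        unfolding m_def assms(2) using elim by (intro nat_mono floor_mono mult_right_mono) auto
      moreover have "n div 400 \<le> m n"
      proof -
        have "real (n div 400) \<le> n / 2" by linarith
        also have "\<dots> = (1 / 2) * real n" by simp
        also have "\<dots> \<le> (1 - \<epsilon>) * n" using \<epsilon> by (intro mult_right_mono) auto
        finally show ?thesis unfolding m_def by (rule le_nat_floor)
      qed
      ultimately have T: "m n \<le> T n" "n div 400 \<le> T n" by auto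
      have m0: "0 \<le> (1 - \<epsilon>) * real n" using \<epsilon> by simp
      have m1: "real (m n) \<le> (1 - \<epsilon>) * n" unfolding m_def using m0 by (rule of_nat_floor)
      have "(1 - \<epsilon>) * n < real (m n) + 1" unfolding m_def using m0 by linarith
      then have "real n - real (m n) < \<epsilon> * n + 1" by (simp add: algebra_simps)
      moreover have "real (m n) \<le> real n"
      proof -
        have "(1 - \<epsilon>) * real n \<le> 1 * real n" using \<epsilon> by (intro mult_right_mono) auto
        then show ?thesis using m1 by simp
      qed
      ultimately have "real (n - m n) < \<epsilon> * n + 1" by (simp add: of_nat_diff)
      moreover have "\<epsilon> * n \<le> \<delta> / 20 * n" using \<epsilon> by (intro mult_right_mono) auto
      ultimately have few: "9 * real (n - m n) < \<delta> * n" using elim(2) by linarith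
      have "measure_pmf.prob (greedy n (m n)) {Q. card Q \<noteq> m n} \<le> K / n"
        unfolding K_def using greedy_almost_complete[OF n(1) \<epsilon>(1) _ m1] \<epsilon>(2) by simp
      then show ?case by (rule failure_bound[OF n(1) T(1) few _ absorb[OF n(2) T(2)]])
    qed
  qed
  have limit: "(\<lambda>n. 1 - (K / real n + real n ^ 2 * exp (- \<rho> * real n))) \<longlonglongrightarrow> 1"
    using \<rho> by real_asymp
  have upper: "\<forall>\<^sub>F n in sequentially. measure_pmf.prob (greedy n (T n)) {Q. absorption_succeeds n Q} \<le> 1"
    by simp
  show ?thesis by (rule tendsto_sandwich[OF lower upper limit tendsto_const])
qed

end
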